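(* Let $n\ge1$, $a\in\mathbb{R}^n$ with $a_i>0$ for all $i$, $s>0$, $\beta>-1$, and $m\in\mathbb{N}$ with $m>s$. Then, for every $x\in E_a$, $$(-\Delta)^su_\beta(x)=\frac{2^{2s-1}\Gamma(\frac12+s)\Gamma(1+\beta)\,c_{n,m,s}}{\Gamma(1+\beta-s)\Gamma(\frac12)\,c_{1,m,s}}\int_{\partial E_a}\big(u_1(x)+\langle x,\theta\rangle_a^2\big)^{\beta-s}\;{}_2F_1\Big(s+\tfrac12,-\beta+s;\tfrac12;\frac{\langle x,\theta\rangle_a^2}{u_1(x)+\langle x,\theta\rangle_a^2}\Big)\,\mu(d\theta),$$ with the convention that $1/\Gamma(t)=0$ for $t\in\{0,-1,-2,\dots\}$.
   Context: Let $A=\mathrm{diag}(a_1,\dots,a_n)$, $\langle x,y\rangle_a:=Ax\cdot y$, $|x|_a:=\sqrt{\langle x,x\rangle_a}$, $E_a:=\{x\in\mathbb{R}^n:|x|_a<1\}$. For $\beta>-1$, $u_\beta(x):=(1-|x|_a^2)_+^\beta$ (equal to $(1-|x|_a^2)^\beta$ in $E_a$ and $0$ outside). $\mu(d\theta)=\dfrac{d\theta}{|\theta|^{n+2s}|A\theta|}$, where $d\theta$ is the surface measure of $\partial E_a$ (counting measure if $n=1$). ${}_2F_1(a,b;c;z)=\sum_{k\ge0}\frac{(a)_k(b)_k}{(c)_k}\frac{z^k}{k!}$ for $|z|<1$ is the Gauss hypergeometric function, with $(q)_0=1$, $(q)_k=\prod_{i=0}^{k-1}(q+i)$. $\mathbb{N}=\{1,2,\dots\}$.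 Pointwise fractional Laplacian: for $s>0$, $$(-\Delta)^s u(x)=\frac{c_{n,m,s}}{2}\int_{\mathbb{R}^n}\frac{\delta_m u(x,y)}{|y|^{n+2s}}\,dy,\qquad \delta_m u(x,y):=\sum_{k=-m}^m(-1)^k\binom{2m}{m-k}u(x+ky),$$ where $m\in\mathbb{N}$ is any integer with $m>s$ (the value does not depend on this choice), and $c_{n,m,s}$ is the positive constant $$c_{n,m,s}=\begin{cases}\dfrac{4^{s}\Gamma(\frac n2+s)}{\pi^{n/2}\Gamma(-s)}\Big(\sum_{k=1}^{m}(-1)^{k}\binom{2m}{m-k}k^{2s}\Big)^{-1}, & s\in(0,m)\setminus\mathbb{N},\\[2mm] \dfrac{4^{s}\Gamma(\frac n2+s)\,s!}{2\pi^{n/2}}\Big(\sum_{k=2}^m(-1)^{k-s+1}\binom{2m}{m-k}k^{2s}\ln k\Big)^{-1}, & s\in\{1,\dots,m-1\}.\end{cases}$$ ($c_{1,m,s}$ is the same constant with $n=1$.) *)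

theory Defs
  imports "HOL-Analysis.Analysis"
begin

section \<open>Ellipsoids\<close>

definition diag_matrix :: "real^'n \<Rightarrow> real^'n^'n" where
  "diag_matrix a = (\<chi> i j. if i = j then a $ i else 0)"

definition inner_a :: "real^'n \<Rightarrow> real^'n \<Rightarrow> real^'n \<Rightarrow> real" where
  "inner_a a x y = (diag_matrix a *v x) \<bullet> y"

definition norm_a :: "real^'n \<Rightarrow> real^'n \<Rightarrow> real" where
  "norm_a a x = sqrt (inner_a a x x)"

definition ellipsoid :: "real^'n \<Rightarrow> (real^'n) set" where
  "ellipsoid a = {x. norm_a a x < 1}"

definition u_pow :: "real^'n \<Rightarrow> real \<Rightarrow> real^'n \<Rightarrow> real" where
  "u_pow a \<beta> x = (if x \<in> ellipsoid a then (1 - (norm_a a x)\<^sup>2) powr \<beta> else 0)"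


section \<open>Surface measure\<close>

text \<open>
  Lebesgue measure of dimension \<open>CARD('n) - 1\<close> on the coordinate hyperplane \<open>{x. x $ k = 0}\<close>,
  as a Borel measure on the whole space. If \<open>CARD('n) = 1\<close>, the product is over the empty
  index set, and the result is the unit point mass at \<open>0\<close>.
\<close>
definition hyperplane_lborel :: "'n \<Rightarrow> (real^'n::finite) measure" where
  "hyperplane_lborel k =
     distr (\<Pi>\<^sub>M i\<in>UNIV - {k}. (lborel :: real measure)) borel
       (\<lambda>f. \<chi> i. if i = k then 0 else f i)"

text \<open>
  \<open>G\<close> is the classical parametrisation of a piece of \<open>S\<close> as the graph of a \<open>C\<^sup>1\<close> function
  over an open part of the hyperplane \<open>{x. x $ k = 0}\<close>, and the surface element of such a
  graph is \<open>sqrt (1 + |\<nabla>g|\<^sup>2)\<close>, where \<open>\<nabla>g\<close> is the gradient within that hyperplane (hence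
  the sum omits \<open>k\<close>). Every \<open>C\<^sup>1\<close> hypersurface is covered by countably many such graphs
  (with \<open>k\<close> varying), so at most one measure has this property. In dimension one the
  graphs are the single points of \<open>S\<close> and each gets mass \<open>1\<close>, so that the surface
  measure of a finite set is its counting measure.
\<close>
definition is_surface_measure :: "(real^'n) set \<Rightarrow> (real^'n) measure \<Rightarrow> bool" where
  "is_surface_measure S \<sigma> \<longleftrightarrow>
     sets \<sigma> = sets borel \<and>
     emeasure \<sigma> (- S) = 0 \<and>
     (\<forall>k U (g :: real^'n \<Rightarrow> real) (D :: real^'n \<Rightarrow> real^'n).
        let G = (\<lambda>x. x + g x *\<^sub>R axis k 1) in
        open U \<longrightarrow>
        (\<forall>x\<in>U. (g has_derivative (\<lambda>h. D x \<bullet> h)) (at x)) \<longrightarrow>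
        continuous_on U D \<longrightarrow>
        (\<forall>x\<in>U. x $ k = 0 \<longrightarrow> G x \<in> S) \<longrightarrow>
        (\<forall>V\<in>sets borel. V \<subseteq> U \<inter> {x. x $ k = 0} \<longrightarrow>
           emeasure \<sigma> (G ` V) =
             (\<integral>\<^sup>+x\<in>V. ennreal (sqrt (1 + (\<Sum>i\<in>UNIV - {k}. (D x $ i)\<^sup>2))) \<partial>hyperplane_lborel k)))"

definition surface_measure :: "(real^'n) set \<Rightarrow> (real^'n) measure" where
  "surface_measure S = (THE \<sigma>. is_surface_measure S \<sigma>)"

definition mu_measure :: "real^'n \<Rightarrow> real \<Rightarrow> (real^'n) measure" where
  "mu_measure a s =
     density (surface_measure (frontier (ellipsoid a)))
       (\<lambda>\<theta>. ennreal (1 / (norm \<theta> powr (real CARD('n) + 2 * s) * norm (diag_matrix a *v \<theta>))))"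


section \<open>The hypergeometric function\<close>

definition hyp2F1 :: "real \<Rightarrow> real \<Rightarrow> real \<Rightarrow> real \<Rightarrow> real" where
  "hyp2F1 a b c z =
     (\<Sum>k. pochhammer a k * pochhammer b k / pochhammer c k * (z ^ k / fact k))"


section \<open>The fractional Laplacian\<close>

definition frac_const :: "nat \<Rightarrow> nat \<Rightarrow> real \<Rightarrow> real" where
  "frac_const n m s =
     (if s \<notin> \<nat> then
        4 powr s * Gamma (real n / 2 + s) / (pi powr (real n / 2) * Gamma (- s)) *
        inverse (\<Sum>k=1..m. (-1) ^ k * real ((2 * m) choose (m - k)) * real k powr (2 * s))
      else
        4 powr s * Gamma (real n / 2 + s) * fact (nat \<lfloor>s\<rfloor>) / (2 * pi powr (real n / 2)) *
        inverse (\<Sum>k=2..m. (-1) powi (int k - \<lfloor>s\<rfloor> + 1) * real ((2 * m) choose (m - k)) *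
                   real k powr (2 * s) * ln (real k)))"

definition finite_diff :: "nat \<Rightarrow> (real^'n \<Rightarrow> real) \<Rightarrow> real^'n \<Rightarrow> real^'n \<Rightarrow> real" where
  "finite_diff m u x y =
     (\<Sum>k\<in>{- int m..int m}. (-1) powi k * real ((2 * m) choose nat (int m - k)) *
        u (x + of_int k *\<^sub>R y))"

definition frac_laplacian_integrand ::
  "nat \<Rightarrow> real \<Rightarrow> (real^'n \<Rightarrow> real) \<Rightarrow> real^'n \<Rightarrow> real^'n \<Rightarrow> real" where
  "frac_laplacian_integrand m s u x y =
     finite_diff m u x y / norm y powr (real CARD('n) + 2 * s)"

definition frac_laplacian :: "nat \<Rightarrow> real \<Rightarrow> (real^'n \<Rightarrow> real) \<Rightarrow> real^'n \<Rightarrow> real" where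
  "frac_laplacian m s u x =
     frac_const CARD('n) m s / 2 * (\<integral>y. frac_laplacian_integrand m s u x y \<partial>lborel)"

end

theory Submission
  imports Defs "HOL-Complex_Analysis.Conformal_Mappings"
begin

text \<open>
  The boundary \<open>S\<close> of the ellipsoid is the unit sphere of \<open>norm_a\<close>, and for \<open>\<theta> \<in> S\<close> with outer unit
  normal \<open>\<nu>\<close> one has \<open>\<theta> \<cdot> \<nu> = 1 / |A \<theta>|\<close>. Hence \<open>1 / |A \<theta>|\<close> turns the surface measure into the cone
  measure \<open>B \<mapsto> n |{r \<theta>. 0 < r < 1, \<theta> \<in> B}|\<close>, for which polar coordinates \<open>y = r \<theta>\<close> are a matter of
  scaling. They give
  \<open>\<integral> \<delta>(x,y) |y|\<^bsup>-n-2s\<^esup> dy = \<integral>\<^sub>S (\<integral>\<^sub>0\<^sup>\<infinity> \<delta>(x, r \<theta>) r\<^bsup>-1-2s\<^esup> dr) \<mu>(d\<theta>)\<close>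
  (\<open>nn_integral_mu_polar\<close>, \<open>integral_mu_polar\<close>). Since the surface measure is given by its values on
  graphs, this needs two facts: the weighted cone measure has these values
  (\<open>emeasure_cone_surface_measure_graph\<close>), and they determine a measure on \<open>S\<close>
  (\<open>is_surface_measure_unique\<close>).

  Along the line \<open>x + r \<theta>\<close> the function \<open>u\<^sub>\<beta>\<close> is a rescaled copy of \<open>bump \<beta> t = (1 - t\<^sup>2)\<^sub>+\<^sup>\<beta>\<close>: with
  \<open>p = \<langle>x,\<theta>\<rangle>\<^sub>a\<close> and \<open>R\<^sup>2 = u\<^sub>1(x) + p\<^sup>2\<close> one has \<open>u\<^sub>\<beta>(x + r \<theta>) = R\<^bsup>2\<beta>\<^esup> bump \<beta> ((p + r) / R)\<close>
  (\<open>u_pow_line\<close>). The inner integral is therefore \<open>R\<^bsup>2\<beta>-2s\<^esup> H(p / R)\<close>, where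
  \<open>H(z) = \<integral>\<^sub>0\<^sup>\<infinity> \<Sum>\<^sub>k (-1)\<^sup>k (2m choose m-k) bump \<beta> (z + k y) y\<^bsup>-1-2s\<^esup> dy\<close>, and the theorem becomes the
  one-dimensional statement that \<open>H(z)\<close> is a constant times \<open>F(s + 1/2, s - \<beta>; 1/2; z\<^sup>2)\<close>
  (\<open>central_diff_mellin_value\<close>).

  For \<open>s < 0\<close> this is elementary, because the terms of the central difference may then be integrated one
  by one near \<open>y = 0\<close>, and everything reduces to the Riesz potential
  \<open>\<integral> bump \<beta> (z + t) |t|\<^bsup>-1-2s\<^esup> dt\<close>. The Moebius map \<open>\<tau> \<mapsto> (z + \<tau>) / (1 + z \<tau>)\<close> of the interval moves
  the singularity to the origin; a binomial expansion and Beta integrals then give a hypergeometric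
  series, which Euler's transformation brings into the required form (\<open>riesz_potential_bump\<close>).
  The central difference is \<open>O(y\<^bsup>2m\<^esup>)\<close> at the origin. After removal of its constant value for large \<open>y\<close>,
  which contributes an explicit multiple of \<open>1 / s\<close>, its Mellin transform is holomorphic for
  \<open>Re s < m\<close>, and the formula extends to this half plane by the identity theorem
  (\<open>mellin_identity\<close>). At an integer \<open>s > 0\<close> both sides of the continued identity vanish, and \<open>H\<close> is
  recovered from their derivatives; this is where the logarithms in the normalising constant come from.
\<close>

section \<open>Central differences\<close>

text \<open>
  By Pascal's rule the sum for \<open>N + 1\<close> is minus the sum for \<open>N\<close> of the first differences, and the
  first difference of a power is a combination of lower powers.
\<close>
lemma alternating_binomial_power_sum:
  fixes c :: "'a::comm_ring_1"
  assumes "i < N"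
  shows "(\<Sum>l\<le>N. (-1) ^ l * of_nat (N choose l) * (of_nat l + c) ^ i) = 0"
  using assms
proof (induction N arbitrary: i c)
  case (Suc N)
  let ?f = "\<lambda>l. (of_nat l + c) ^ i"
  have "(\<Sum>l\<le>Suc N. (-1) ^ l * of_nat (Suc N choose l) * ?f l)
      = ?f 0 + (\<Sum>l\<le>N. (-1) ^ Suc l * of_nat (Suc N choose Suc l) * ?f (Suc l))"
    by (subst sum.atMost_Suc_shift) simp
  also have "(\<Sum>l\<le>N. (-1) ^ Suc l * of_nat (Suc N choose Suc l) * ?f (Suc l))
      = (\<Sum>l\<le>N. (-1) ^ Suc l * of_nat (N choose Suc l) * ?f (Suc l))
        - (\<Sum>l\<le>N. (-1) ^ l * of_nat (N choose l) * ?f (Suc l))"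
    unfolding sum_subtractf[symmetric] by (intro sum.cong refl) (simp add: ring_distribs)
  also have "?f 0 + (\<dots>) = (\<Sum>l\<le>Suc N. (-1) ^ l * of_nat (N choose l) * ?f l)
        - (\<Sum>l\<le>N. (-1) ^ l * of_nat (N choose l) * ?f (Suc l))"
    by (subst sum.atMost_Suc_shift) simp
  also have "\<dots> = (\<Sum>l\<le>N. (-1) ^ l * of_nat (N choose l) * (?f l - ?f (Suc l)))"
    by (simp add: right_diff_distrib sum_subtractf binomial_eq_0)
  also have "\<dots> = - (\<Sum>l\<le>N. \<Sum>j<i. of_nat (i choose j) *
                 ((-1) ^ l * of_nat (N choose l) * (of_nat l + c) ^ j))"
  proof -
    have "?f (Suc l) - ?f l = (\<Sum>j<i. of_nat (i choose j) * (of_nat l + c) ^ j)" for l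
    proof -
      have "?f (Suc l) = ((of_nat l + c) + 1) ^ i" by (simp add: algebra_simps)
      also have "\<dots> = (\<Sum>j\<le>i. of_nat (i choose j) * (of_nat l + c) ^ j)"
        by (subst binomial_ring) simp
      finally show ?thesis by (simp add: lessThan_Suc_atMost[symmetric])
    qed
    hence *: "?f l - ?f (Suc l) = - (\<Sum>j<i. of_nat (i choose j) * (of_nat l + c) ^ j)" for l
      by (metis minus_diff_eq)
    show ?thesis
      unfolding * by (simp add: sum_negf[symmetric] sum_distrib_left algebra_simps)
  qed
  also have "(\<Sum>l\<le>N. \<Sum>j<i. of_nat (i choose j) *
                 ((-1) ^ l * of_nat (N choose l) * (of_nat l + c) ^ j))
       = (\<Sum>j<i. of_nat (i choose j) *
                 (\<Sum>l\<le>N. (-1) ^ l * of_nat (N choose l) * (of_nat l + c) ^ j))"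
    by (subst sum.swap) (simp add: sum_distrib_left)
  also have "\<dots> = 0"
    using Suc by (intro sum.neutral) auto
  finally show ?case by simp
qed simp

definition central_coeff :: "nat \<Rightarrow> int \<Rightarrow> real" where
  "central_coeff m k = (-1) powi k * real ((2 * m) choose nat (int m - k))"

lemma central_coeff_minus: "- int m \<le> k \<Longrightarrow> k \<le> int m \<Longrightarrow> central_coeff m (- k) = central_coeff m k"
proof -
  assume k: "- int m \<le> k" "k \<le> int m"
  have "(2 * m) choose nat (int m + k) = (2 * m) choose (2 * m - nat (int m + k))"
    using k by (intro binomial_symmetric) auto
  also have "2 * m - nat (int m + k) = nat (int m - k)" using k by auto
  finally show ?thesis by (simp add: central_coeff_def power_int_minus_one_minus)
qed

text \<open>
  The central difference of order \<open>2m\<close> annihilates polynomials of degree less than \<open>2m\<close>. This is used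
  twice: it makes the central difference of a smooth function small at the origin, and it makes the
  Mellin transform regular at the positive integers below \<open>m\<close>.
\<close>
lemma central_moment_zero:
  assumes "i < 2 * m"
  shows "(\<Sum>k\<in>{-int m..int m}. central_coeff m k * of_int k ^ i) = (0::real)"
proof -
  have "(\<Sum>k\<in>{-int m..int m}. central_coeff m k * of_int k ^ i)
     = (\<Sum>l\<le>2*m. central_coeff m (int m - int l) * of_int (int m - int l) ^ i)"
    by (rule sum.reindex_bij_witness[of _ "\<lambda>l. int m - int l" "\<lambda>k. nat (int m - k)"]) auto
  also have "\<dots> = (\<Sum>l\<le>2*m. (-1)^m * (-1)^i * ((-1) ^ l * of_nat (2*m choose l) * (of_nat l + (- of_nat m)) ^ i))"
  proof (intro sum.cong refl)
    fix l assume "l \<in> {..2*m}"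
    have "(-1::real) powi (int m - int l) = (-1)^m * (-1)^l"
      by (subst power_int_diff) (auto simp: field_simps power_add mult_ac simp flip: power_mult_distrib)
    moreover have "of_int (int m - int l) ^ i = (-1)^i * (real l + (- of_nat m)) ^ i"
      by (simp flip: power_mult_distrib)
    ultimately show "central_coeff m (int m - int l) * of_int (int m - int l) ^ i =
      (-1)^m * (-1)^i * ((-1) ^ l * of_nat (2*m choose l) * (of_nat l + (- of_nat m)) ^ i)"
      by (simp add: central_coeff_def)
  qed
  also have "\<dots> = 0"
    using alternating_binomial_power_sum[OF assms, of "- of_nat m :: real"]
    by (simp flip: sum_distrib_left)
  finally show ?thesis .
qed

lemma sum_symmetric_int:
  fixes f :: "int \<Rightarrow> 'a::comm_monoid_add"
  shows "(\<Sum>k\<in>{-int m..int m}. f k) = f 0 + (\<Sum>k=1..m. f (int k) + f (- int k))"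
proof (induction m)
  case (Suc m)
  have "{-int (Suc m)..int (Suc m)} = insert (int (Suc m)) (insert (- int (Suc m)) {-int m..int m})"
    by auto
  then show ?case using Suc by (simp add: algebra_simps)
qed simp

lemma central_coeff_nat: "central_coeff m (int k) = (-1)^k * real ((2*m) choose (m - k))"
  by (simp add: central_coeff_def nat_minus_as_int del: of_nat_diff)

text \<open>
  The sum from the normalising constant for non-integer \<open>s\<close>. It arises when the scaled copies
  \<open>f (k y)\<close> are integrated against \<open>y\<^bsup>-1-2s\<^esup>\<close>.
\<close>
definition half_moment :: "nat \<Rightarrow> real \<Rightarrow> real" where
  "half_moment m s = (\<Sum>k=1..m. (-1) ^ k * real ((2 * m) choose (m - k)) * real k powr (2 * s))"

lemma half_moment_nat_zero:
  assumes "1 \<le> j" "j < m"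
  shows "half_moment m (real j) = 0"
proof -
  have "0 = (\<Sum>k\<in>{-int m..int m}. central_coeff m k * of_int k ^ (2*j))"
    using central_moment_zero[of "2*j" m] assms by simp
  also have "\<dots> = (\<Sum>k=1..m. 2 * (central_coeff m (int k) * of_nat k ^ (2*j)))"
    using assms by (subst sum_symmetric_int) (auto intro!: sum.cong simp: central_coeff_minus)
  also have "\<dots> = 2 * half_moment m (real j)"
    by (auto simp: half_moment_def sum_distrib_left central_coeff_nat powr_realpow[symmetric] intro!: sum.cong)
  finally show ?thesis by simp
qed

definition bump :: "real \<Rightarrow> real \<Rightarrow> real" where
  "bump \<beta> t = (if \<bar>t\<bar> < 1 then (1 - t\<^sup>2) powr \<beta> else 0)"

definition central_diff :: "nat \<Rightarrow> real \<Rightarrow> real \<Rightarrow> real \<Rightarrow> real" where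
  "central_diff m \<beta> z y = (\<Sum>k\<in>{-int m..int m}. central_coeff m k * bump \<beta> (z + of_int k * y))"

lemma borel_measurable_bump [measurable]: "bump \<beta> \<in> borel_measurable borel"
  unfolding bump_def[abs_def] by measurable

lemma borel_measurable_central_diff [measurable]: "central_diff m \<beta> z \<in> borel_measurable borel"
  unfolding central_diff_def[abs_def] by measurable

lemma bump_nonneg: "bump \<beta> t \<ge> 0"
  by (auto simp: bump_def)

text \<open>
  The real part of \<open>1 - w\<^sup>2\<close> is positive in the unit disc, so the principal branch of its power is
  holomorphic there. In this way all derivatives needed for Taylor's formula exist at once, with bounds
  that are uniform on compact subsets.
\<close>
lemma bump_holomorphic_extension:
  obtains f where "f holomorphic_on ball 0 1" "\<And>t. \<bar>t\<bar> < 1 \<Longrightarrow> f (complex_of_real t) = of_real (bump \<beta> t)"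
proof
  let ?f = "\<lambda>w::complex. (1 - w\<^sup>2) powr of_real \<beta>"
  have "1 - w\<^sup>2 \<notin> \<real>\<^sub>\<le>\<^sub>0" if "w \<in> ball 0 1" for w :: complex
  proof -
    have "norm (w\<^sup>2) < 1" using that by (simp add: norm_power power_less_one_iff)
    hence "Re (w\<^sup>2) < 1" using complex_Re_le_cmod[of "w\<^sup>2"] by linarith
    thus ?thesis by (auto simp: complex_nonpos_Reals_iff)
  qed
  thus "?f holomorphic_on ball 0 1" by (intro holomorphic_intros) auto
  show "?f (complex_of_real t) = of_real (bump \<beta> t)" if "\<bar>t\<bar> < 1" for t
  proof -
    have "t\<^sup>2 < 1" using that by (simp add: abs_square_less_1)
    hence "of_real ((1 - t\<^sup>2) powr \<beta>) = complex_of_real (1 - t\<^sup>2) powr of_real \<beta>"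
      by (intro powr_of_real[symmetric]) auto
    thus ?thesis using that by (simp add: bump_def)
  qed
qed

text \<open>
  The Taylor polynomial of degree \<open>2m - 1\<close> at \<open>z\<close> is annihilated by the central difference, so only the
  remainder contributes. The bound is uniform in \<open>z\<close> because in the main theorem \<open>z\<close> depends on the
  direction \<open>\<theta>\<close>.
\<close>
lemma central_diff_Taylor_bound:
  assumes "0 \<le> q" "q < 1" "m > 0"
  obtains K \<eta> where "\<eta> > 0" "\<eta> \<le> 1" "K \<ge> 0"
    "\<And>z y. \<bar>z\<bar> \<le> q \<Longrightarrow> 0 \<le> y \<Longrightarrow> y \<le> \<eta> \<Longrightarrow> \<bar>central_diff m \<beta> z y\<bar> \<le> K * y ^ (2*m)"
proof -
  obtain f where f: "f holomorphic_on ball 0 1"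
    and fb: "\<And>t. \<bar>t\<bar> < 1 \<Longrightarrow> f (complex_of_real t) = of_real (bump \<beta> t)"
    using bump_holomorphic_extension by blast
  define q' where "q' = (1 + q) / 2"
  have q': "q < q'" "q' < 1" "0 < q'" using assms by (auto simp: q'_def field_simps)
  let ?S = "cball (0::complex) q'"
  have S: "?S \<subseteq> ball 0 1" using q' by auto
  have hol: "(deriv ^^ i) f holomorphic_on ball 0 1" for i
    by (intro holomorphic_higher_deriv f) auto
  have "compact ((deriv ^^ (2*m)) f ` ?S)"
    using hol[of "2*m"] by (intro compact_continuous_image)
      (auto intro: continuous_on_subset[OF holomorphic_on_imp_continuous_on S])
  then obtain B where B: "\<And>w. w \<in> ?S \<Longrightarrow> norm ((deriv ^^ (2*m)) f w) \<le> B"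
    by (meson bounded_iff compact_imp_bounded imageI)
  have "B \<ge> 0" using B[of 0] q' by (auto intro: order_trans[OF norm_ge_zero])
  define n where "n = 2 * m - 1"
  have n: "Suc n = 2 * m" using assms by (simp add: n_def)
  have T: "norm (f z - (\<Sum>i\<le>n. (deriv ^^ i) f w * (z - w) ^ i / fact i))
       \<le> B * norm (z - w) ^ Suc n / fact n" if "w \<in> ?S" "z \<in> ?S" for w z
  proof -
    have "norm ((deriv ^^ 0) f z - (\<Sum>i\<le>n. (deriv ^^ i) f w * (z - w) ^ i / fact i))
       \<le> B * norm (z - w) ^ Suc n / fact n"
    proof (rule complex_Taylor[of ?S])
      fix i x assume "x \<in> ?S" "i \<le> n"
      hence "((deriv ^^ i) f has_field_derivative deriv ((deriv ^^ i) f) x) (at x)"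
        using hol[of i] S by (intro holomorphic_derivI[of _ "ball 0 1"]) auto
      thus "((deriv ^^ i) f has_field_derivative (deriv ^^ Suc i) f x) (at x within ?S)"
        by (simp add: has_field_derivative_at_within)
    qed (use that B n in auto)
    thus ?thesis by simp
  qed
  define K where "K = (\<Sum>k\<in>{-int m..int m}. \<bar>central_coeff m k\<bar> * (B * \<bar>of_int k\<bar> ^ (2*m) / fact n))"
  \<comment> \<open>all points \<open>z + k y\<close> with \<open>0 \<le> y \<le> \<eta>\<close> stay in the disc of radius \<open>q'\<close>, halfway between \<open>q\<close> and \<open>1\<close>\<close>
  define \<eta> where "\<eta> = (1 - q) / (2 * real m)"
  have \<eta>: "\<eta> > 0" "\<eta> \<le> 1" "real m * \<eta> = q' - q" using assms by (auto simp: \<eta>_def q'_def field_simps)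
  show thesis
  proof
    show "\<eta> > 0" "\<eta> \<le> 1" by fact+
    show "K \<ge> 0" unfolding K_def using \<open>B \<ge> 0\<close> by (intro sum_nonneg) auto
    fix z y :: real assume zy: "\<bar>z\<bar> \<le> q" "0 \<le> y" "y \<le> \<eta>"
    define P where "P = (\<lambda>k::int. \<Sum>i\<le>n. (deriv ^^ i) f z * (of_int k * of_real y) ^ i / fact i)"
    have in_S: "\<bar>z + of_int k * y\<bar> \<le> q'" if "k \<in> {-int m..int m}" for k
    proof -
      have "\<bar>of_int k * y\<bar> \<le> real m * \<eta>" unfolding abs_mult
        using that zy by (intro mult_mono) auto
      thus ?thesis using zy \<eta> by linarith
    qed
    have "(\<Sum>k\<in>{-int m..int m}. of_real (central_coeff m k) * P k)
       = (\<Sum>i\<le>n. (deriv ^^ i) f z * of_real y ^ i / fact i *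
           of_real (\<Sum>k\<in>{-int m..int m}. central_coeff m k * of_int k ^ i))"
      unfolding P_def by (subst sum_distrib_left, subst sum.swap)
        (simp add: sum_distrib_left power_mult_distrib mult_ac)
    also have "\<dots> = 0" using n by (intro sum.neutral) (auto simp: central_moment_zero)
    finally have P0: "(\<Sum>k\<in>{-int m..int m}. of_real (central_coeff m k) * P k) = 0" .
    have "complex_of_real (central_diff m \<beta> z y)
      = (\<Sum>k\<in>{-int m..int m}. of_real (central_coeff m k) * f (of_real (z + of_int k * y)))"
      unfolding central_diff_def of_real_sum of_real_mult
      using in_S q' by (intro sum.cong refl) (subst fb, fastforce+)
    also have "\<dots> = (\<Sum>k\<in>{-int m..int m}. of_real (central_coeff m k) * (f (of_real (z + of_int k * y)) - P k))"
      using P0 by (simp add: algebra_simps sum_subtractf)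
    finally have "\<bar>central_diff m \<beta> z y\<bar> = norm (\<Sum>k\<in>{-int m..int m}. of_real (central_coeff m k) * (f (of_real (z + of_int k * y)) - P k))"
      by (metis norm_of_real)
    also have "\<dots> \<le> (\<Sum>k\<in>{-int m..int m}. \<bar>central_coeff m k\<bar> * (B * \<bar>of_int k\<bar> ^ (2*m) / fact n) * y ^ (2*m))"
    proof (rule sum_norm_le)
      fix k assume k: "k \<in> {-int m..int m}"
      have "norm (f (of_real (z + of_int k * y)) - P k)
          \<le> B * norm (of_real (z + of_int k * y) - complex_of_real z) ^ Suc n / fact n"
        unfolding P_def using T[of "of_real z" "of_real (z + of_int k * y)"] zy q' in_S[OF k]
        by (simp del: of_real_add of_real_mult) (simp)
      also have "norm (of_real (z + of_int k * y) - complex_of_real z) = \<bar>of_int k\<bar> * y"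
        using zy by (simp add: norm_mult)
      finally show "norm (of_real (central_coeff m k) * (f (of_real (z + of_int k * y)) - P k))
        \<le> \<bar>central_coeff m k\<bar> * (B * \<bar>of_int k\<bar> ^ (2*m) / fact n) * y ^ (2*m)"
        using mult_left_mono[of _ _ "\<bar>central_coeff m k\<bar>"]
        by (fastforce simp: norm_mult n power_mult_distrib mult_ac)
    qed
    finally show "\<bar>central_diff m \<beta> z y\<bar> \<le> K * y ^ (2*m)"
      by (simp add: K_def sum_distrib_right)
  qed
qed

section \<open>Euler's transformation of the hypergeometric function\<close>

text \<open>
  The ratio test; the quotients are arranged so that each factor tends to \<open>1\<close>, apart from \<open>r\<close>.
\<close>
lemma summable_hypergeometric:
  fixes a b c r :: real
  assumes "c > 0" "\<bar>r\<bar> < 1"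
  shows "summable (\<lambda>k. norm (pochhammer a k * pochhammer b k / (pochhammer c k * fact k) * r ^ k))"
proof -
  let ?f = "\<lambda>k. pochhammer a k * pochhammer b k / (pochhammer c k * fact k) * r ^ k"
  let ?q = "\<lambda>k. (a + real k) / (c + real k) * ((b + real k) / (1 + real k)) * r"
  have quot: "?f (Suc k) = ?q k * ?f k" for k
    using assms by (simp add: pochhammer_Suc field_simps)
  have lim: "(\<lambda>k. (x + real k) / (y + real k)) \<longlonglongrightarrow> 1" for x y
  proof -
    have "filterlim (\<lambda>k. y + real k) at_top sequentially"
      by (intro filterlim_tendsto_add_at_top[OF tendsto_const] filterlim_real_sequentially)
    hence "(\<lambda>k. 1 + (x - y) / (y + real k)) \<longlonglongrightarrow> 1 + 0"
      by (intro tendsto_intros tendsto_divide_0[OF tendsto_const] filterlim_at_top_imp_at_infinity)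
    moreover have "\<forall>\<^sub>F k in sequentially. 1 + (x - y) / (y + real k) = (x + real k) / (y + real k)"
      using eventually_gt_at_top[of "nat \<lceil>\<bar>y\<bar>\<rceil>"]
    proof eventually_elim
      case (elim k)
      hence "y + real k > 0" by linarith
      thus ?case by (simp add: field_simps)
    qed
    ultimately show ?thesis by (simp add: tendsto_cong)
  qed
  have "(\<lambda>k. norm (?q k)) \<longlonglongrightarrow> norm (1 * 1 * r)"
    by (intro tendsto_intros lim)
  moreover define \<rho> where "\<rho> = (1 + \<bar>r\<bar>) / 2"
  ultimately have "\<forall>\<^sub>F k in sequentially. norm (?q k) < \<rho>"
    using assms by (intro order_tendstoD(2)) (auto simp: field_simps)
  then obtain N where N: "\<And>k. k \<ge> N \<Longrightarrow> norm (?q k) < \<rho>"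
    by (auto simp: eventually_at_top_linorder)
  show ?thesis
  proof (rule summable_ratio_test[of \<rho> N])
    show "\<rho> < 1" using assms by (simp add: \<rho>_def)
    fix k assume "k \<ge> N"
    have "norm (norm (?f (Suc k))) = norm (?q k) * norm (?f k)"
      unfolding quot by (simp add: norm_mult abs_mult)
    also have "\<dots> \<le> \<rho> * norm (?f k)" using N[OF \<open>k \<ge> N\<close>] by (intro mult_right_mono) auto
    finally show "norm (norm (?f (Suc k))) \<le> \<rho> * norm (norm (?f k))" by simp
  qed
qed

lemma hyp2F1_sums:
  assumes "c > 0" "\<bar>z\<bar> < 1"
  shows "(\<lambda>k. pochhammer a k * pochhammer b k / (pochhammer c k * fact k) * z ^ k) sums hyp2F1 a b c z"
  using summable_sums[OF summable_norm_cancel[OF summable_hypergeometric[OF assms, of a b]]]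
  by (simp add: hyp2F1_def mult_ac)

definition fps_2F1 :: "real \<Rightarrow> real \<Rightarrow> real \<Rightarrow> real fps" where
  "fps_2F1 a b c = Abs_fps (\<lambda>k. pochhammer a k * pochhammer b k / (pochhammer c k * fact k))"

text \<open>
  The operator of Gauss's differential equation \<open>z (1 - z) y'' + (c - (a + b + 1) z) y' - a b y\<close>. Formal
  power series are used for the transformation because on them the equation is nothing but the
  two-term recurrence of the coefficients.
\<close>
definition hypergeometric_operator :: "real \<Rightarrow> real \<Rightarrow> real \<Rightarrow> real fps \<Rightarrow> real fps" where
  "hypergeometric_operator a b c y =
     fps_X * (1 - fps_X) * fps_deriv (fps_deriv y)
     + (fps_const c - fps_const (a + b + 1) * fps_X) * fps_deriv y - fps_const (a * b) * y"

lemma hypergeometric_operator_nth: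
  "fps_nth (hypergeometric_operator a b c y) k =
     real (Suc k) * (c + real k) * fps_nth y (Suc k) - (a + real k) * (b + real k) * fps_nth y k"
proof -
  have eq: "hypergeometric_operator a b c y = fps_X * fps_deriv (fps_deriv y)
      - fps_X * (fps_X * fps_deriv (fps_deriv y)) + fps_const c * fps_deriv y
      - fps_const (a + b + 1) * (fps_X * fps_deriv y) - fps_const (a * b) * y"
    unfolding hypergeometric_operator_def by (simp add: algebra_simps)
  show ?thesis
    unfolding eq by (cases k; cases "k - 1") (auto simp: algebra_simps)
qed

lemma hypergeometric_operator_2F1:
  assumes "c > 0"
  shows "hypergeometric_operator a b c (fps_2F1 a b c) = 0"
proof (rule fps_ext)
  fix k
  have "pochhammer c k \<noteq> 0" "c + real k \<noteq> 0" using assms pochhammer_pos[of c k] by auto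
  thus "fps_nth (hypergeometric_operator a b c (fps_2F1 a b c)) k = fps_nth 0 k"
    unfolding hypergeometric_operator_nth
    by (simp add: fps_2F1_def pochhammer_Suc divide_simps)
qed

text \<open>
  For \<open>c > 0\<close> the leading factor \<open>(k + 1) (c + k)\<close> of the recurrence never vanishes.
\<close>
lemma hypergeometric_operator_unique:
  assumes "c > 0" "hypergeometric_operator a b c y = 0" "fps_nth y 0 = 1"
  shows "y = fps_2F1 a b c"
proof (rule fps_ext)
  fix k show "fps_nth y k = fps_nth (fps_2F1 a b c) k"
  proof (induction k)
    case (Suc k)
    have "real (Suc k) * (c + real k) * fps_nth y (Suc k) = (a + real k) * (b + real k) * fps_nth y k"
      if "hypergeometric_operator a b c y = 0" for y
      using hypergeometric_operator_nth[of a b c y k] that by simp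
    from this[OF assms(2)] this[OF hypergeometric_operator_2F1[OF assms(1)]] Suc
    have "real (Suc k) * (c + real k) * fps_nth y (Suc k)
        = real (Suc k) * (c + real k) * fps_nth (fps_2F1 a b c) (Suc k)" by simp
    moreover have "real (Suc k) * (c + real k) \<noteq> 0" using assms by auto
    ultimately show ?case using mult_cancel_left by blast
  qed (use assms in \<open>simp add: fps_2F1_def\<close>)
qed

text \<open>
  Here \<open>E\<close> stands for \<open>(1 - X)\<^sup>p\<close> and \<open>y\<close> for a solution with parameters \<open>a, b, c\<close>; the conclusion says that
  \<open>E y\<close> solves the equation with parameters \<open>c - a, c - b, c\<close>, up to the factor \<open>1 - X\<close>.
\<close>
lemma euler_transformation_algebra:
  fixes X E E1 E2 y y1 y2 a b c p :: "'a::idom"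
  assumes "(1 - X) * E1 = - p * E" "(1 - X) * E2 = (1 - p) * E1"
    "X * (1 - X) * y2 + (c - (a + b + 1) * X) * y1 - a * b * y = 0"
    "p = a + b - c"
  shows "(1 - X) * (X * (1 - X) * (E2 * y + 2 * E1 * y1 + E * y2)
     + (c - ((c - a) + (c - b) + 1) * X) * (E1 * y + E * y1) - (c - a) * (c - b) * (E * y)) = 0"
  using assms by algebra

lemma fps_euler_transformation:
  assumes "c > 0"
  shows "Abs_fps (\<lambda>n. ((a + b - c) gchoose n) * (-1) ^ n) * fps_2F1 a b c = fps_2F1 (c - a) (c - b) c"
proof (rule hypergeometric_operator_unique[OF assms])
  define p where "p = a + b - c"
  define E where "E = Abs_fps (\<lambda>n. (p gchoose n) * (-1) ^ n)"
  define y where "y = fps_2F1 a b c"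
  have E1: "(1 - fps_X) * fps_deriv E = - fps_const p * E"
  proof (rule fps_ext)
    fix n
    have "real (Suc n) * (p gchoose Suc n) = p * (p gchoose n) - real n * (p gchoose n)"
      using gbinomial_mult_1[of p n] by (simp add: algebra_simps)
    hence "real (Suc n) * (p gchoose Suc n) * (-1) ^ n
         = (p * (p gchoose n) - real n * (p gchoose n)) * (-1) ^ n" by simp
    thus "fps_nth ((1 - fps_X) * fps_deriv E) n = fps_nth (- fps_const p * E) n"
      by (cases n) (auto simp: left_diff_distrib E_def algebra_simps)
  qed
  have E2: "(1 - fps_X) * fps_deriv (fps_deriv E) = (1 - fps_const p) * fps_deriv E"
    using arg_cong[OF E1, of fps_deriv] by (simp add: algebra_simps del: fps_const_neg)
  have y: "fps_X * (1 - fps_X) * fps_deriv (fps_deriv y)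
     + (fps_const c - (fps_const a + fps_const b + 1) * fps_X) * fps_deriv y - fps_const a * fps_const b * y = 0"
    using hypergeometric_operator_2F1[OF assms, of a b]
    unfolding hypergeometric_operator_def y_def
    by (simp only: fps_const_add[symmetric] fps_const_mult[symmetric] fps_const_1_eq_1)
  have p: "fps_const p = fps_const a + fps_const b - fps_const c" by (simp add: p_def)
  have d1: "fps_deriv (E * y) = fps_deriv E * y + E * fps_deriv y" by simp
  have d2: "fps_deriv (fps_deriv E * y + E * fps_deriv y)
      = fps_deriv (fps_deriv E) * y + 2 * fps_deriv E * fps_deriv y + E * fps_deriv (fps_deriv y)"
    by (simp add: algebra_simps)
  have "(1 - fps_X) * hypergeometric_operator (c - a) (c - b) c (E * y) = 0"
    using euler_transformation_algebra[OF E1 E2 y p]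
    unfolding hypergeometric_operator_def d2 d1
    by (simp only: fps_const_add[symmetric] fps_const_sub[symmetric] fps_const_mult[symmetric] fps_const_1_eq_1)
  moreover have "(1 - fps_X :: real fps) \<noteq> 0"
    using arg_cong[of "1 - fps_X :: real fps" 0 "\<lambda>f. fps_nth f 0"] by auto
  ultimately show "hypergeometric_operator (c - a) (c - b) c
      (Abs_fps (\<lambda>n. ((a + b - c) gchoose n) * (-1) ^ n) * fps_2F1 a b c) = 0"
    unfolding E_def y_def p_def by simp
qed (simp add: fps_2F1_def)

lemma hyp2F1_euler:
  assumes "c > 0" "\<bar>z\<bar> < 1"
  shows "hyp2F1 (c - a) (c - b) c z = (1 - z) powr (a + b - c) * hyp2F1 a b c z"
proof -
  define p where "p = a + b - c"
  have E: "(\<lambda>n. (p gchoose n) * (-1) ^ n * w ^ n) sums (1 - w) powr p" if "\<bar>w\<bar> < 1" for w :: real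
    using gen_binomial_real[of "- w" p] that by (simp add: power_minus[of w] mult_ac)
  obtain w where w: "\<bar>z\<bar> < w" "w < 1" using assms dense by blast
  have sE: "summable (\<lambda>n. norm ((p gchoose n) * (-1) ^ n * z ^ n))"
    by (rule powser_insidea[OF sums_summable[OF E[of w]]]) (use w in auto)
  let ?h = "\<lambda>a b k. pochhammer a k * pochhammer b k / (pochhammer c k * fact k)"
  have "(\<lambda>k. \<Sum>i\<le>k. ((p gchoose i) * (-1) ^ i * z ^ i) * (?h a b (k - i) * z ^ (k - i)))
      sums ((\<Sum>n. (p gchoose n) * (-1) ^ n * z ^ n) * (\<Sum>k. ?h a b k * z ^ k))"
    by (rule Cauchy_product_sums[OF sE summable_hypergeometric[OF assms]])
  also have "(\<Sum>n. (p gchoose n) * (-1) ^ n * z ^ n) = (1 - z) powr p"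
    using E assms by (simp add: sums_iff)
  also have "(\<Sum>k. ?h a b k * z ^ k) = hyp2F1 a b c z"
    using hyp2F1_sums[OF assms] by (simp add: sums_iff)
  also have "(\<lambda>k. \<Sum>i\<le>k. ((p gchoose i) * (-1) ^ i * z ^ i) * (?h a b (k - i) * z ^ (k - i)))
      = (\<lambda>k. ?h (c - a) (c - b) k * z ^ k)"
  proof
    fix k
    have "?h (c - a) (c - b) k = (\<Sum>i=0..k. ((p gchoose i) * (-1) ^ i) * ?h a b (k - i))"
      using arg_cong[OF fps_euler_transformation[OF assms(1), of a b], of "\<lambda>f. fps_nth f k"]
      by (simp add: fps_mult_nth fps_2F1_def p_def)
    moreover have "((p gchoose i) * (-1) ^ i * z ^ i) * (?h a b (k - i) * z ^ (k - i))
        = ((p gchoose i) * (-1) ^ i) * ?h a b (k - i) * z ^ k" if "i \<le> k" for i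
    proof -
      have "z ^ k = z ^ i * z ^ (k - i)" using that by (simp flip: power_add)
      thus ?thesis by (simp only: mult_ac)
    qed
    hence "(\<Sum>i\<le>k. ((p gchoose i) * (-1) ^ i * z ^ i) * (?h a b (k - i) * z ^ (k - i)))
        = (\<Sum>i\<le>k. ((p gchoose i) * (-1) ^ i) * ?h a b (k - i) * z ^ k)"
      by (intro sum.cong refl) auto
    ultimately show "(\<Sum>i\<le>k. ((p gchoose i) * (-1) ^ i * z ^ i) * (?h a b (k - i) * z ^ (k - i)))
       = ?h (c - a) (c - b) k * z ^ k"
      by (simp add: sum_distrib_right atLeast0AtMost)
  qed
  finally have "(\<lambda>k. ?h (c - a) (c - b) k * z ^ k) sums ((1 - z) powr p * hyp2F1 a b c z)" .
  thus ?thesis using hyp2F1_sums[OF assms, of "c - a" "c - b"] sums_unique2 by (simp add: p_def) blast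
qed

section \<open>The Riesz potential of the bump for negative exponents\<close>

lemma nn_integral_even:
  fixes f :: "real \<Rightarrow> ennreal"
  assumes [measurable]: "f \<in> borel_measurable borel" and even: "\<And>x. f (- x) = f x"
  shows "(\<integral>\<^sup>+x. f x \<partial>lborel) = 2 * (\<integral>\<^sup>+x\<in>{0<..}. f x \<partial>lborel)"
proof -
  have "(\<integral>\<^sup>+x. f x \<partial>lborel) = (\<integral>\<^sup>+x. f x * indicator {0<..} x + f x * indicator {..<0} x \<partial>lborel)"
    using AE_lborel_singleton[of "0::real"]
    by (intro nn_integral_cong_AE) (auto simp: indicator_def elim!: eventually_mono)
  also have "\<dots> = (\<integral>\<^sup>+x\<in>{0<..}. f x \<partial>lborel) + (\<integral>\<^sup>+x\<in>{..<0}. f x \<partial>lborel)"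
    by (intro nn_integral_add) auto
  also have "(\<integral>\<^sup>+x\<in>{..<0}. f x \<partial>lborel) = (\<integral>\<^sup>+x. f (0 + (-1) * x) * indicator {..<0} (0 + (-1) * x) \<partial>lborel)"
    by (subst nn_integral_real_affine[where c = "-1" and t = 0]) auto
  also have "\<dots> = (\<integral>\<^sup>+x\<in>{0<..}. f x \<partial>lborel)"
    by (intro nn_integral_cong) (auto simp: even indicator_def)
  finally show ?thesis by (simp add: mult_2)
qed

lemma nn_integral_scale_positive:
  fixes f :: "real \<Rightarrow> ennreal"
  assumes [measurable]: "f \<in> borel_measurable borel" and c: "c > 0"
  shows "(\<integral>\<^sup>+r\<in>{0<..}. f r \<partial>lborel) = (\<integral>\<^sup>+r\<in>{0<..}. ennreal c * f (c * r) \<partial>lborel)"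
proof -
  have "(\<integral>\<^sup>+r\<in>{0<..}. f r \<partial>lborel) = ennreal \<bar>c\<bar> * (\<integral>\<^sup>+r. f (0 + c * r) * indicator {0<..} (0 + c * r) \<partial>lborel)"
    using c by (intro nn_integral_real_affine) auto
  also have "\<dots> = (\<integral>\<^sup>+r. ennreal \<bar>c\<bar> * (f (0 + c * r) * indicator {0<..} (0 + c * r)) \<partial>lborel)"
    by (intro nn_integral_cmult[symmetric]) measurable
  also have "\<dots> = (\<integral>\<^sup>+r\<in>{0<..}. ennreal c * f (c * r) \<partial>lborel)"
    using c by (intro nn_integral_cong) (auto simp: indicator_def zero_less_mult_iff)
  finally show ?thesis .
qed

lemma set_integral_scale_positive:
  fixes f :: "real \<Rightarrow> real"
  assumes c: "c > 0"
  shows "(LINT r:{0<..}|lborel. f r) = (LINT r:{0<..}|lborel. c * f (c * r))"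
proof -
  have "(LINT r:{0<..}|lborel. f r) = \<bar>c\<bar> *\<^sub>R (\<integral>r. indicator {0<..} (0 + c * r) *\<^sub>R f (0 + c * r) \<partial>lborel)"
    unfolding set_lebesgue_integral_def using c by (intro lborel_integral_real_affine) auto
  also have "\<dots> = (\<integral>r. c * (indicator {0<..} (0 + c * r) *\<^sub>R f (0 + c * r)) \<partial>lborel)"
    using c by simp
  also have "\<dots> = (LINT r:{0<..}|lborel. c * f (c * r))"
    unfolding set_lebesgue_integral_def using c
    by (intro Bochner_Integration.integral_cong) (auto simp: indicator_def zero_less_mult_iff)
  finally show ?thesis .
qed

text \<open>
  The substitution \<open>u = t\<^sup>2\<close> leads to Euler's Beta integral.
\<close>
lemma nn_integral_bump_moment:
  assumes "\<beta> > -1" "\<alpha> > -1"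
  shows "(\<integral>\<^sup>+t. ennreal (bump \<beta> t * \<bar>t\<bar> powr \<alpha>) \<partial>lborel) = ennreal (Beta ((\<alpha> + 1) / 2) (\<beta> + 1))"
proof -
  define f where "f = (\<lambda>u::real. u powr ((\<alpha> + 1) / 2 - 1) * (1 - u) powr (\<beta> + 1 - 1))"
  have f_meas [measurable]: "f \<in> borel_measurable borel" unfolding f_def by measurable
  have "(\<integral>\<^sup>+t. ennreal (bump \<beta> t * \<bar>t\<bar> powr \<alpha>) \<partial>lborel) = 2 * (\<integral>\<^sup>+t\<in>{0<..}. ennreal (bump \<beta> t * \<bar>t\<bar> powr \<alpha>) \<partial>lborel)"
    by (intro nn_integral_even) (auto simp: bump_def)
  also have "\<dots> = (\<integral>\<^sup>+t\<in>{0<..}. ennreal (bump \<beta> t * \<bar>t\<bar> powr \<alpha> * 2) \<partial>lborel)"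
    by (subst nn_integral_cmult[symmetric]) (auto intro!: nn_integral_cong simp: mult_ac ennreal_mult'' bump_nonneg)
  also have "\<dots> = (\<integral>\<^sup>+t. ennreal (f (t\<^sup>2)) * ennreal (2 * t) * indicator {0..1} t \<partial>lborel)"
  proof (intro nn_integral_cong)
    fix t :: real
    consider "t \<le> 0" | "0 < t" "t < 1" | "t = 1" | "t > 1" by linarith
    thus "ennreal (bump \<beta> t * \<bar>t\<bar> powr \<alpha> * 2) * indicator {0<..} t
        = ennreal (f (t\<^sup>2)) * ennreal (2 * t) * indicator {0..1} t"
    proof cases
      case 2
      have "(t\<^sup>2) powr ((\<alpha> + 1) / 2 - 1) * t = t powr \<alpha>"
      proof -
        have "t\<^sup>2 = t powr 2" using 2 by (simp add: powr_numeral)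
        hence "(t\<^sup>2) powr ((\<alpha> + 1) / 2 - 1) = t powr (\<alpha> - 1)" by (simp add: powr_powr diff_divide_distrib ring_distribs)
        moreover have "t powr \<alpha> = t powr (\<alpha> - 1) * t" using 2 by (simp add: powr_diff)
        ultimately show ?thesis by simp
      qed
      hence "f (t\<^sup>2) * (2 * t) = bump \<beta> t * \<bar>t\<bar> powr \<alpha> * 2"
        using 2 by (simp add: f_def bump_def)
      moreover have "ennreal (f (t\<^sup>2)) * ennreal (2 * t) = ennreal (f (t\<^sup>2) * (2 * t))"
        using 2 by (simp add: ennreal_mult'')
      moreover have "f (t\<^sup>2) * (2 * t) = bump \<beta> t * \<bar>t\<bar> powr \<alpha> * 2"
        using calculation(1) by simp
      ultimately show ?thesis using 2 by (simp only: indicator_simps) simp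
    qed (auto simp: f_def bump_def indicator_def)
  qed
  also have "\<dots> = (\<integral>\<^sup>+t. ennreal (f t) * indicator {0\<^sup>2..1\<^sup>2} t \<partial>lborel)"
  proof -
    have "(\<integral>\<^sup>+t. ennreal (f t) * indicator {0\<^sup>2..1\<^sup>2} t \<partial>lborel)
        = (\<integral>\<^sup>+t. ennreal (f (t\<^sup>2) * (2 * t)) * indicator {0..1} t \<partial>lborel)"
    proof (subst nn_integral_set_ennreal, subst nn_integral_set_ennreal, rule nn_integral_substitution)
      show "set_borel_measurable borel {0\<^sup>2..1\<^sup>2} f" unfolding set_borel_measurable_def by measurable
    qed (auto intro!: derivative_eq_intros continuous_intros)
    also have "\<dots> = (\<integral>\<^sup>+t. ennreal (f (t\<^sup>2)) * ennreal (2 * t) * indicator {0..1} t \<partial>lborel)"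
      by (intro nn_integral_cong) (auto simp: indicator_def intro!: ennreal_mult'')
    finally show ?thesis by simp
  qed
  also have "\<dots> = ennreal (Beta ((\<alpha> + 1) / 2) (\<beta> + 1))"
    using nn_integral_has_integral_lebesgue'[OF _ has_integral_Beta_real[of "(\<alpha> + 1) / 2" "\<beta> + 1"]] assms
    by (simp add: f_def)
  finally show ?thesis .
qed

lemma bump_minus: "bump \<beta> (- t) = bump \<beta> t"
  by (simp add: bump_def)

definition bump_weight :: "real \<Rightarrow> real \<Rightarrow> real \<Rightarrow> real" where
  "bump_weight \<beta> \<alpha> t = bump \<beta> t * \<bar>t\<bar> powr \<alpha>"

lemma borel_measurable_bump_weight [measurable]: "bump_weight \<beta> \<alpha> \<in> borel_measurable borel"
  unfolding bump_weight_def[abs_def] by measurable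

lemma bump_weight_nonneg: "bump_weight \<beta> \<alpha> t \<ge> 0"
  by (simp add: bump_weight_def bump_nonneg)

lemma integrable_bump_weight:
  assumes "\<beta> > -1" "\<alpha> > -1"
  shows "integrable lborel (bump_weight \<beta> \<alpha>)"
    and "integral\<^sup>L lborel (bump_weight \<beta> \<alpha>) = Beta ((\<alpha> + 1) / 2) (\<beta> + 1)"
proof -
  have nn: "(\<integral>\<^sup>+t. ennreal (bump_weight \<beta> \<alpha> t) \<partial>lborel) = ennreal (Beta ((\<alpha> + 1) / 2) (\<beta> + 1))"
    unfolding bump_weight_def by (rule nn_integral_bump_moment[OF assms])
  thus "integrable lborel (bump_weight \<beta> \<alpha>)"
    by (intro integrableI_nonneg) (auto simp: bump_weight_nonneg)
  have "(\<alpha> + 1) / 2 > 0" "\<beta> + 1 > 0" using assms by auto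
  hence "Beta ((\<alpha> + 1) / 2) (\<beta> + 1) \<ge> 0"
    unfolding Beta_def by (intro divide_nonneg_nonneg mult_nonneg_nonneg Gamma_real_nonneg add_nonneg_nonneg) linarith+
  thus "integral\<^sup>L lborel (bump_weight \<beta> \<alpha>) = Beta ((\<alpha> + 1) / 2) (\<beta> + 1)"
    using nn by (simp add: integral_eq_nn_integral bump_weight_nonneg)
qed

lemma bump_weight_moments:
  assumes "\<beta> > -1" "\<alpha> > -1"
  shows "integrable lborel (\<lambda>t. bump_weight \<beta> \<alpha> t * t ^ n)"
    and "even n \<Longrightarrow> (\<integral>t. bump_weight \<beta> \<alpha> t * t ^ n \<partial>lborel) = Beta ((\<alpha> + real n + 1) / 2) (\<beta> + 1)"
    and "odd n \<Longrightarrow> (\<integral>t. bump_weight \<beta> \<alpha> t * t ^ n \<partial>lborel) = 0"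
proof -
  show int: "integrable lborel (\<lambda>t. bump_weight \<beta> \<alpha> t * t ^ n)"
  proof (rule Bochner_Integration.integrable_bound[OF integrable_bump_weight(1)[OF assms]])
    show "AE t in lborel. norm (bump_weight \<beta> \<alpha> t * t ^ n) \<le> norm (bump_weight \<beta> \<alpha> t)"
      by (rule AE_I2) (auto simp: bump_weight_def bump_def abs_mult power_abs
           intro!: mult_left_le power_le_one)
  qed auto
  show "(\<integral>t. bump_weight \<beta> \<alpha> t * t ^ n \<partial>lborel) = 0" if "odd n"
  proof -
    have "(\<integral>t. bump_weight \<beta> \<alpha> t * t ^ n \<partial>lborel)
        = (\<integral>t. bump_weight \<beta> \<alpha> (0 + (-1) * t) * (0 + (-1) * t) ^ n \<partial>lborel)"
      by (subst lborel_integral_real_affine[where c = "-1" and t = 0]) auto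
    also have "\<dots> = - (\<integral>t. bump_weight \<beta> \<alpha> t * t ^ n \<partial>lborel)"
      using that by (simp add: bump_weight_def bump_minus flip: Bochner_Integration.integral_minus)
    finally show ?thesis by simp
  qed
  show "(\<integral>t. bump_weight \<beta> \<alpha> t * t ^ n \<partial>lborel) = Beta ((\<alpha> + real n + 1) / 2) (\<beta> + 1)" if "even n"
  proof -
    have "(\<integral>t. bump_weight \<beta> \<alpha> t * t ^ n \<partial>lborel) = (\<integral>t. bump_weight \<beta> (\<alpha> + real n) t \<partial>lborel)"
    proof (rule integral_cong_AE)
      show "AE t in lborel. bump_weight \<beta> \<alpha> t * t ^ n = bump_weight \<beta> (\<alpha> + real n) t"
        using AE_lborel_singleton[of "0::real"]
      proof eventually_elim
        case (elim t)
        have "t ^ n = \<bar>t\<bar> ^ n" using that by (simp add: power_even_abs)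
        also have "\<dots> = \<bar>t\<bar> powr real n" using elim by (simp add: powr_realpow)
        finally show ?case by (simp add: bump_weight_def powr_add)
      qed
    qed auto
    thus ?thesis using integrable_bump_weight(2)[OF assms(1), of "\<alpha> + real n"] assms
      by (simp add: add_ac)
  qed
qed

text \<open>
  Expand \<open>(1 + z t)\<^sup>p\<close> in powers of \<open>z t\<close>. Odd moments of the weight vanish and even ones are Beta values.
  With \<open>p = 2 s - 1 - 2 \<beta>\<close> the coefficient \<open>p gchoose 2k\<close> contains the factor
  \<open>pochhammer (1 + \<beta> - s) k\<close>, which cancels the denominator of the \<open>k\<close>-th Beta value, so that a
  hypergeometric series with \<open>c = 1/2\<close> is left.
\<close>
lemma bump_weight_binomial:
  assumes "\<beta> > -1" "s < 0" "\<bar>z\<bar> < 1"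
  defines "p \<equiv> 2 * s - 1 - 2 * \<beta>"
  shows "integrable lborel (\<lambda>t. bump_weight \<beta> (-1 - 2 * s) t * (1 + z * t) powr p)"
    and "(\<integral>t. bump_weight \<beta> (-1 - 2 * s) t * (1 + z * t) powr p \<partial>lborel)
       = Beta (- s) (\<beta> + 1) * hyp2F1 (1 / 2 + \<beta> - s) (- s) (1 / 2) (z\<^sup>2)"
proof -
  define \<omega> where "\<omega> = bump_weight \<beta> (-1 - 2 * s)"
  have \<alpha>: "-1 - 2 * s > -1" using assms by simp
  have \<omega>_meas [measurable]: "\<omega> \<in> borel_measurable borel" unfolding \<omega>_def by measurable
  have \<omega>_int: "integrable lborel (\<lambda>t. \<omega> t * t ^ n)" for n
    unfolding \<omega>_def using bump_weight_moments(1)[OF assms(1) \<alpha>] .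
  have \<omega>_nonneg: "\<omega> t \<ge> 0" for t unfolding \<omega>_def by (rule bump_weight_nonneg)
  have \<omega>_0: "\<omega> t = 0" if "\<not> \<bar>t\<bar> < 1" for t using that by (auto simp: \<omega>_def bump_weight_def bump_def)
  define f where "f = (\<lambda>n t. (p gchoose n) * z ^ n * (\<omega> t * t ^ n))"
  \<comment> \<open>convergence at a point \<open>w\<close> beyond \<open>|z|\<close> gives absolute convergence at \<open>z\<close>\<close>
  obtain w where w: "\<bar>z\<bar> < w" "w < 1" using assms dense by blast
  have coef: "summable (\<lambda>n. norm ((p gchoose n) * z ^ n))"
    by (rule powser_insidea[OF sums_summable[OF gen_binomial_real[of w p]]]) (use w in auto)
  have f_le: "norm (f n t) \<le> norm ((p gchoose n) * z ^ n) * \<omega> t" for n t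
  proof (cases "\<bar>t\<bar> < 1")
    case True
    hence "\<omega> t * \<bar>t\<bar> ^ n \<le> \<omega> t" by (intro mult_left_le) (auto simp: \<omega>_nonneg power_le_one)
    thus ?thesis unfolding f_def
      by (auto simp: norm_mult abs_mult power_abs \<omega>_nonneg mult_left_mono mult.assoc)
  qed (simp add: f_def \<omega>_0)
  have f_int: "integrable lborel (f n)" for n unfolding f_def using \<omega>_int by simp
  have sum1: "AE t in lborel. summable (\<lambda>n. norm (f n t))"
    by (rule AE_I2, rule summable_comparison_test'[OF summable_mult2[OF coef]]) (use f_le in auto)
  have sum2: "summable (\<lambda>n. \<integral>t. norm (f n t) \<partial>lborel)"
  proof (rule summable_comparison_test'[OF summable_mult2[OF coef, of "\<integral>t. \<omega> t \<partial>lborel"]])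
    fix n
    have "(\<integral>t. norm (f n t) \<partial>lborel) \<le> (\<integral>t. norm ((p gchoose n) * z ^ n) * \<omega> t \<partial>lborel)"
      using f_int f_le \<omega>_int[of 0] by (intro integral_mono) auto
    thus "norm (\<integral>t. norm (f n t) \<partial>lborel) \<le> norm ((p gchoose n) * z ^ n) * (\<integral>t. \<omega> t \<partial>lborel)"
      by (simp add: integral_nonneg_AE)
  qed
  have f_sum: "(\<Sum>n. f n t) = \<omega> t * (1 + z * t) powr p" for t
  proof (cases "\<bar>t\<bar> < 1")
    case True
    have "\<bar>z * t\<bar> < 1" using assms(3) True
      by (metis abs_mult abs_ge_zero mult_strict_mono mult_1 less_one zero_less_one)
    from sums_mult2[OF gen_binomial_real[OF this, of p], of "\<omega> t"] show ?thesis
      unfolding f_def by (simp add: sums_iff power_mult_distrib mult_ac)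
  qed (simp add: f_def \<omega>_0)
  show "integrable lborel (\<lambda>t. bump_weight \<beta> (-1 - 2 * s) t * (1 + z * t) powr p)"
    using integrable_suminf[OF f_int sum1 sum2] unfolding f_sum \<omega>_def .
  have sums: "(\<lambda>n. integral\<^sup>L lborel (f n)) sums (\<integral>t. \<omega> t * (1 + z * t) powr p \<partial>lborel)"
    using sums_integral[OF f_int sum1 sum2] unfolding f_sum .
  have "(\<lambda>k. integral\<^sup>L lborel (f (2 * k))) sums (\<integral>t. \<omega> t * (1 + z * t) powr p \<partial>lborel)"
  proof -
    have "integral\<^sup>L lborel (f n) = 0" if "n \<notin> range (\<lambda>k. 2 * k)" for n
    proof -
      have "odd n" using that by (auto elim!: evenE)
      thus ?thesis using bump_weight_moments(3)[OF assms(1) \<alpha>, of n] by (simp add: f_def \<omega>_def)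
    qed
    with sums show ?thesis
      by (subst (asm) sums_mono_reindex[of "\<lambda>k. 2 * k", symmetric]) (auto simp: strict_mono_def)
  qed
  also have "(\<lambda>k. integral\<^sup>L lborel (f (2 * k))) = (\<lambda>k. Beta (- s) (\<beta> + 1) *
      (pochhammer (1 / 2 + \<beta> - s) k * pochhammer (- s) k / (pochhammer (1 / 2) k * fact k) * (z\<^sup>2) ^ k))"
  proof
    fix k
    have pos: "pochhammer (1 + \<beta> - s) k > 0" "Gamma (1 + \<beta> - s) > 0" "pochhammer (1 / 2 :: real) k > 0"
      using assms by (auto intro!: pochhammer_pos Gamma_real_pos)
    have "integral\<^sup>L lborel (f (2 * k)) = (p gchoose (2 * k)) * z ^ (2 * k) * Beta ((-1 - 2 * s + real (2 * k) + 1) / 2) (\<beta> + 1)"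
      using bump_weight_moments(2)[OF assms(1) \<alpha>, of "2 * k"] by (simp add: f_def \<omega>_def)
    also have "(-1 - 2 * s + real (2 * k) + 1) / 2 = - s + real k" by (simp add: field_simps)
    also have "Beta (- s + real k) (\<beta> + 1) = Beta (- s) (\<beta> + 1) * pochhammer (- s) k / pochhammer (1 + \<beta> - s) k"
    proof -
      have "- s \<notin> \<int>\<^sub>\<le>\<^sub>0" "1 + \<beta> - s \<notin> \<int>\<^sub>\<le>\<^sub>0" using assms by (auto elim!: nonpos_Ints_cases)
      hence "Gamma (- s + real k) = pochhammer (- s) k * Gamma (- s)"
            "Gamma (1 + \<beta> - s + real k) = pochhammer (1 + \<beta> - s) k * Gamma (1 + \<beta> - s)"
        using Gamma_eq_zero_iff[of "-s"] Gamma_eq_zero_iff[of "1 + \<beta> - s"]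
        by (simp_all add: pochhammer_Gamma)
      moreover have "- s + real k + (\<beta> + 1) = 1 + \<beta> - s + real k" "- s + (\<beta> + 1) = 1 + \<beta> - s" by simp_all
      ultimately show ?thesis by (simp only: Beta_def) (simp add: mult.commute)
    qed
    also have "(p gchoose (2 * k)) = pochhammer (1 / 2 + \<beta> - s) k * pochhammer (1 + \<beta> - s) k / (pochhammer (1 / 2) k * fact k)"
    proof -
      have "(p gchoose (2 * k)) = pochhammer (2 * (1 / 2 + \<beta> - s)) (2 * k) / fact (2 * k)"
        by (simp add: gbinomial_pochhammer p_def algebra_simps)
      also have "\<dots> = (2 ^ (2 * k) * pochhammer (1 / 2 + \<beta> - s) k * pochhammer (1 + \<beta> - s) k) /
          (2 ^ (2 * k) * pochhammer (1 / 2) k * fact k)"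
        by (subst pochhammer_double, subst fact_double) (simp add: algebra_simps)
      finally show ?thesis by simp
    qed
    finally show "integral\<^sup>L lborel (f (2 * k)) = Beta (- s) (\<beta> + 1) *
      (pochhammer (1 / 2 + \<beta> - s) k * pochhammer (- s) k / (pochhammer (1 / 2) k * fact k) * (z\<^sup>2) ^ k)"
      using pos by (simp add: power_mult)
  qed
  finally have "(\<lambda>k. Beta (- s) (\<beta> + 1) *
      (pochhammer (1 / 2 + \<beta> - s) k * pochhammer (- s) k / (pochhammer (1 / 2) k * fact k) * (z\<^sup>2) ^ k))
      sums (\<integral>t. \<omega> t * (1 + z * t) powr p \<partial>lborel)" .
  moreover have "\<bar>z\<^sup>2\<bar> < 1" using assms(3) by (simp add: abs_square_less_1)
  ultimately show "(\<integral>t. bump_weight \<beta> (-1 - 2 * s) t * (1 + z * t) powr p \<partial>lborel)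
       = Beta (- s) (\<beta> + 1) * hyp2F1 (1 / 2 + \<beta> - s) (- s) (1 / 2) (z\<^sup>2)"
    unfolding \<omega>_def using sums_mult[OF hyp2F1_sums[of "1/2" "z\<^sup>2" "1 / 2 + \<beta> - s" "- s"], of "Beta (- s) (\<beta> + 1)"]
    by (intro sums_unique2) auto
qed

text \<open>
  The map \<open>g(t) = (z + t) / (1 + z t)\<close> maps \<open>[-1, 1]\<close> onto itself and \<open>0\<close> to \<open>z\<close>, and satisfies
  \<open>1 - g\<^sup>2 = (1 - z\<^sup>2) (1 - t\<^sup>2) / (1 + z t)\<^sup>2\<close> and \<open>g - z = (1 - z\<^sup>2) t / (1 + z t)\<close>. The integrand is thus
  transformed into the weight of the preceding lemma times powers of \<open>1 - z\<^sup>2\<close> and \<open>1 + z t\<close>. The remaining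
  power of \<open>1 - z\<^sup>2\<close> is exactly the one that Euler's transformation absorbs.
\<close>
lemma riesz_potential_bump:
  assumes "\<beta> > -1" "s < 0" "\<bar>z\<bar> < 1"
  shows "(\<integral>\<^sup>+t. ennreal (bump \<beta> (z + t) * \<bar>t\<bar> powr (-1 - 2 * s)) \<partial>lborel)
       = ennreal (Beta (- s) (\<beta> + 1) * hyp2F1 (s + 1 / 2) (s - \<beta>) (1 / 2) (z\<^sup>2))"
    and "Beta (- s) (\<beta> + 1) * hyp2F1 (s + 1 / 2) (s - \<beta>) (1 / 2) (z\<^sup>2) \<ge> 0"
proof -
  define \<alpha> where "\<alpha> = -1 - 2 * s"
  define p where "p = 2 * s - 1 - 2 * \<beta>"
  define g where "g = (\<lambda>t. (z + t) / (1 + z * t))"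
  define g' where "g' = (\<lambda>t. (1 - z\<^sup>2) / (1 + z * t)\<^sup>2)"
  define f where "f = (\<lambda>t. bump \<beta> t * \<bar>t - z\<bar> powr \<alpha>)"
  have z2: "z\<^sup>2 < 1" using assms(3) by (simp add: abs_square_less_1)
  have euler: "(1 - z\<^sup>2) powr (\<beta> - 2 * s) * hyp2F1 (1 / 2 + \<beta> - s) (- s) (1 / 2) (z\<^sup>2)
     = hyp2F1 (s + 1 / 2) (s - \<beta>) (1 / 2) (z\<^sup>2)"
    using hyp2F1_euler[of "1/2" "z\<^sup>2" "- s" "1 / 2 + \<beta> - s"] z2
    by (simp add: algebra_simps hyp2F1_def)
  have "0 \<le> (1 - z\<^sup>2) powr (\<beta> - 2 * s) * (\<integral>t. bump_weight \<beta> (-1 - 2 * s) t * (1 + z * t) powr p \<partial>lborel)"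
    by (intro mult_nonneg_nonneg integral_nonneg_AE AE_I2) (auto simp: bump_weight_nonneg)
  thus "Beta (- s) (\<beta> + 1) * hyp2F1 (s + 1 / 2) (s - \<beta>) (1 / 2) (z\<^sup>2) \<ge> 0"
    unfolding p_def bump_weight_binomial(2)[OF assms] euler[symmetric] by (simp add: mult_ac)
  have pos: "1 + z * t > 0" if "\<bar>t\<bar> \<le> 1" for t
  proof -
    have "\<bar>z * t\<bar> \<le> \<bar>z\<bar> * 1" unfolding abs_mult using that by (intro mult_left_mono) auto
    thus ?thesis using assms(3) by linarith
  qed
  have ne: "1 + z * t \<noteq> 0" if "t \<in> {-1..1}" for t
    using pos[of t] that by (auto simp: abs_le_iff)
  have [measurable]: "f \<in> borel_measurable borel" unfolding f_def by measurable
  have g1: "g (-1) = -1" "g 1 = 1" using pos[of 1] pos[of "-1"] by (auto simp: g_def field_simps)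
  have transf: "f (g t) * g' t = (1 - z\<^sup>2) powr (\<beta> - 2 * s) * (bump_weight \<beta> \<alpha> t * (1 + z * t) powr p)"
    if "\<bar>t\<bar> < 1" for t
  proof -
    define d where "d = 1 + z * t"
    have d: "d > 0" using pos[of t] that by (simp add: d_def)
    have t2: "t\<^sup>2 < 1" using that by (simp add: abs_square_less_1)
    have *: "1 - (g t)\<^sup>2 = (1 - z\<^sup>2) * (1 - t\<^sup>2) / d\<^sup>2"
      using d unfolding g_def d_def[symmetric] by (simp add: field_simps) (simp add: d_def power2_eq_square algebra_simps)
    have "1 - (g t)\<^sup>2 > 0" unfolding * using d z2 t2 by (intro divide_pos_pos mult_pos_pos) auto
    hence gt: "\<bar>g t\<bar> < 1" by (simp add: abs_square_less_1)
    have **: "\<bar>g t - z\<bar> = (1 - z\<^sup>2) * \<bar>t\<bar> / d"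
    proof -
      have "g t - z = (1 - z\<^sup>2) * t / d" using d unfolding g_def d_def[symmetric]
        by (simp add: field_simps) (simp add: d_def power2_eq_square algebra_simps)
      thus ?thesis using d z2 by (simp add: abs_mult)
    qed
    have d2: "(d\<^sup>2) powr \<beta> = d powr (2 * \<beta>)"
      using d powr_powr[of d 2 \<beta>] by (simp add: powr_numeral)
    have "f (g t) * g' t = ((1 - z\<^sup>2) powr \<beta> * (1 - t\<^sup>2) powr \<beta> / d powr (2 * \<beta>)) *
       ((1 - z\<^sup>2) powr \<alpha> * \<bar>t\<bar> powr \<alpha> / d powr \<alpha>) * ((1 - z\<^sup>2) powr 1 / d powr 2)"
      using gt d z2 t2 unfolding f_def g'_def bump_def * ** d_def[symmetric]
      by (simp add: powr_mult powr_divide d2)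
    also have "\<dots> = (1 - z\<^sup>2) powr (\<beta> + \<alpha> + 1) * ((1 - t\<^sup>2) powr \<beta> * \<bar>t\<bar> powr \<alpha> * d powr (- (2 * \<beta>) - \<alpha> - 2))"
      by (simp add: powr_add powr_diff powr_minus field_simps)
    also have "\<dots> = (1 - z\<^sup>2) powr (\<beta> - 2 * s) * (bump_weight \<beta> \<alpha> t * d powr p)"
      using that by (simp add: bump_weight_def bump_def p_def \<alpha>_def algebra_simps)
    finally show ?thesis by (simp add: d_def)
  qed
  have "(\<integral>\<^sup>+t. ennreal (bump \<beta> (z + t) * \<bar>t\<bar> powr \<alpha>) \<partial>lborel) = (\<integral>\<^sup>+t. ennreal (f t) \<partial>lborel)"
    by (subst nn_integral_real_affine[where c = 1 and t = z]) (auto simp: f_def)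
  also have "\<dots> = (\<integral>\<^sup>+t. ennreal (f t) * indicator {g (-1)..g 1} t \<partial>lborel)"
    unfolding g1 by (intro nn_integral_cong) (auto simp: indicator_def f_def bump_def)
  also have "\<dots> = (\<integral>\<^sup>+t. ennreal (f (g t) * g' t) * indicator {-1..1} t \<partial>lborel)"
  proof (subst nn_integral_set_ennreal, subst nn_integral_set_ennreal, rule nn_integral_substitution)
    show "set_borel_measurable borel {g (- 1)..g 1} f" unfolding set_borel_measurable_def by measurable
    show "continuous_on {-1..1} g'" unfolding g'_def using ne
      by (intro continuous_intros) auto
    show "(g has_real_derivative g' x) (at x)" if "x \<in> {-1..1}" for x
      unfolding g_def g'_def using ne[OF that]
      by (auto intro!: derivative_eq_intros simp: power2_eq_square field_simps)
    show "g' x \<ge> 0" for x using z2 by (auto simp: g'_def)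
  qed auto
  also have "\<dots> = (\<integral>\<^sup>+t. ennreal ((1 - z\<^sup>2) powr (\<beta> - 2 * s)) * ennreal (bump_weight \<beta> \<alpha> t * (1 + z * t) powr p) \<partial>lborel)"
  proof (intro nn_integral_cong)
    fix t :: real
    consider "\<bar>t\<bar> < 1" | "t = 1" | "t = -1" | "\<bar>t\<bar> > 1" by linarith
    thus "ennreal (f (g t) * g' t) * indicator {-1..1} t
      = ennreal ((1 - z\<^sup>2) powr (\<beta> - 2 * s)) * ennreal (bump_weight \<beta> \<alpha> t * (1 + z * t) powr p)"
    proof cases
      case 1
      thus ?thesis
        by (simp only: transf) (auto simp: ennreal_mult bump_weight_nonneg indicator_def)
    qed (auto simp: indicator_def g1 f_def bump_def bump_weight_def)
  qed
  also have "\<dots> = ennreal ((1 - z\<^sup>2) powr (\<beta> - 2 * s)) * (\<integral>\<^sup>+t. ennreal (bump_weight \<beta> \<alpha> t * (1 + z * t) powr p) \<partial>lborel)"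
    by (intro nn_integral_cmult) auto
  also have "(\<integral>\<^sup>+t. ennreal (bump_weight \<beta> \<alpha> t * (1 + z * t) powr p) \<partial>lborel)
      = ennreal (Beta (- s) (\<beta> + 1) * hyp2F1 (1 / 2 + \<beta> - s) (- s) (1 / 2) (z\<^sup>2))"
    unfolding \<alpha>_def p_def using bump_weight_binomial[OF assms]
    by (subst nn_integral_eq_integral) (auto simp: bump_weight_nonneg)
  also have "ennreal ((1 - z\<^sup>2) powr (\<beta> - 2 * s)) * \<dots> =
     ennreal (Beta (- s) (\<beta> + 1) * ((1 - z\<^sup>2) powr (\<beta> - 2 * s) * hyp2F1 (1 / 2 + \<beta> - s) (- s) (1 / 2) (z\<^sup>2)))"
    by (subst ennreal_mult'[symmetric]) (auto simp: mult_ac)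
  also note euler
  finally show "(\<integral>\<^sup>+t. ennreal (bump \<beta> (z + t) * \<bar>t\<bar> powr (-1 - 2 * s)) \<partial>lborel)
       = ennreal (Beta (- s) (\<beta> + 1) * hyp2F1 (s + 1 / 2) (s - \<beta>) (1 / 2) (z\<^sup>2))"
    by (simp add: \<alpha>_def)
qed

section \<open>Mellin transforms are holomorphic\<close>

text \<open>
  The Mellin transform of \<open>g\<close> at \<open>-2 s\<close>, so that the variable agrees with the order of the operator.
\<close>
definition mellin :: "(real \<Rightarrow> real) \<Rightarrow> complex \<Rightarrow> complex" where
  "mellin g s = (LINT y:{0<..}|lborel. of_real (g y) * of_real y powr (-1 - 2 * s))"

lemma norm_mellin_integrand:
  assumes "y > 0"
  shows "norm (complex_of_real (g y) * of_real y powr w) = \<bar>g y\<bar> * y powr Re w"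
  using assms by (simp add: norm_mult norm_powr_real_powr)

lemma set_integrable_mellin:
  assumes [measurable]: "g \<in> borel_measurable borel"
    and "set_integrable lborel {0<..} (\<lambda>y. g y * y powr (-1 - 2 * Re s))"
  shows "set_integrable lborel {0<..} (\<lambda>y. complex_of_real (g y) * of_real y powr (-1 - 2 * s))"
  using assms(2)
proof (rule set_integrable_bound)
  show "AE x in lborel. x \<in> {0<..} \<longrightarrow>
     norm (complex_of_real (g x) * of_real x powr (-1 - 2 * s)) \<le> norm (g x * x powr (-1 - 2 * Re s))"
    by (rule AE_I2) (auto simp: norm_mellin_integrand abs_mult)
qed (auto simp: set_borel_measurable_def)

lemma mellin_of_real:
  "mellin g (of_real s) = of_real (LINT y:{0<..}|lborel. g y * y powr (-1 - 2 * s))"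
proof -
  have "complex_of_real (g y) * of_real y powr (-1 - 2 * complex_of_real s)
      = complex_of_real (g y * y powr (-1 - 2 * s))" if "y \<in> {0<..}" for y
  proof -
    have "complex_of_real y powr (complex_of_real (-1 - 2 * s)) = of_real (y powr (-1 - 2 * s))"
      using that by (intro powr_of_real) auto
    thus ?thesis by simp
  qed
  hence "mellin g (of_real s) = (LINT y:{0<..}|lborel. complex_of_real (g y * y powr (-1 - 2 * s)))"
    unfolding mellin_def by (intro set_lebesgue_integral_cong) auto
  also have "\<dots> = of_real (LINT y:{0<..}|lborel. g y * y powr (-1 - 2 * s))"
    by (rule set_integral_complex_of_real)
  finally show ?thesis .
qed

text \<open>
  Differentiation under the integral sign, with a quadratic remainder estimate in place of dominated
  convergence. With \<open>L = -2 ln y\<close> the increment \<open>h\<close> multiplies the integrand by \<open>exp (h L)\<close>, and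
  \<open>|exp w - 1 - w| \<le> |w|\<^sup>2 exp |w|\<close>. The factors \<open>L\<close> and \<open>L\<^sup>2\<close> are absorbed by \<open>exp (2 \<delta> |L|)\<close>, which is at most
  \<open>y\<^bsup>4\<delta>\<^esup> + y\<^bsup>-4\<delta>\<^esup>\<close>; this shifts \<open>Re s\<close> by \<open>2 \<delta>\<close> either way.
\<close>
lemma mellin_has_derivative:
  fixes s :: complex
  assumes [measurable]: "g \<in> borel_measurable borel"
    and int: "\<And>\<sigma>. \<sigma> < b \<Longrightarrow> set_integrable lborel {0<..} (\<lambda>y. g y * y powr (-1 - 2 * \<sigma>))"
    and s: "Re s < b"
  shows "\<exists>D. (mellin g has_field_derivative D) (at s)"
proof -
  \<comment> \<open>so small that \<open>Re s + 2 \<delta> < b\<close>\<close>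
  define \<delta> where "\<delta> = (b - Re s) / 4"
  define \<sigma> where "\<sigma> = Re s"
  have \<delta>: "\<delta> > 0" "\<sigma> + 2 * \<delta> < b" "\<sigma> - 2 * \<delta> < b" using s by (auto simp: \<delta>_def \<sigma>_def field_simps)
  define L where "L = (\<lambda>y::real. - 2 * ln y)"
  define F where "F = (\<lambda>s y. complex_of_real (g y) * of_real y powr (-1 - 2 * s))"
  define B where "B = (\<lambda>y. \<bar>g y\<bar> * (y powr (-1 - 2 * (\<sigma> + 2 * \<delta>)) + y powr (-1 - 2 * (\<sigma> - 2 * \<delta>))))"
  have B_int: "set_integrable lborel {0<..} B"
    using set_integrable_abs[OF int[OF \<delta>(2)]] set_integrable_abs[OF int[OF \<delta>(3)]]
    unfolding B_def by (auto simp: distrib_left abs_mult intro!: set_integral_add)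
  have exp_bound: "\<bar>g y\<bar> * y powr (-1 - 2 * \<sigma>) * exp (2 * \<delta> * \<bar>L y\<bar>) \<le> B y" if "y > 0" for y
  proof -
    have "exp (2 * \<delta> * \<bar>L y\<bar>) \<le> y powr (- 4 * \<delta>) + y powr (4 * \<delta>)"
      using that by (cases "ln y \<ge> 0") (auto simp: L_def powr_def mult_ac)
    hence "y powr (-1 - 2 * \<sigma>) * exp (2 * \<delta> * \<bar>L y\<bar>)
        \<le> y powr (-1 - 2 * \<sigma>) * (y powr (- 4 * \<delta>) + y powr (4 * \<delta>))"
      by (intro mult_left_mono) auto
    also have "\<dots> = y powr (-1 - 2 * (\<sigma> + 2 * \<delta>)) + y powr (-1 - 2 * (\<sigma> - 2 * \<delta>))"
      by (simp add: distrib_left powr_add[symmetric] algebra_simps)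
    finally show ?thesis unfolding B_def by (simp add: mult_left_mono mult.assoc)
  qed
  have F_exp: "F (s + h) y = F s y * exp (h * of_real (L y))" if "y > 0" for h y
    using that by (simp add: F_def powr_def Ln_of_real L_def exp_add[symmetric] exp_diff algebra_simps)
  have F_norm: "norm (F s y) = \<bar>g y\<bar> * y powr (-1 - 2 * \<sigma>)" if "y > 0" for y
    using norm_mellin_integrand[OF that] by (simp add: F_def \<sigma>_def)
  have F_int: "set_integrable lborel {0<..} (F w)" if "Re w < b" for w
    unfolding F_def using that by (intro set_integrable_mellin int) auto
  have M: "mellin g w = (LINT y:{0<..}|lborel. F w y)" for w by (simp add: mellin_def F_def)
  have lin: "x \<le> exp x" for x :: real using exp_ge_add_one_self[of x] by linarith
  have quad: "x\<^sup>2 \<le> 2 * exp x" if "x \<ge> 0" for x :: real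
    using exp_lower_Taylor_quadratic[OF that] that by simp
  have F'_int: "set_integrable lborel {0<..} (\<lambda>y. F s y * of_real (L y))"
  proof (rule set_integrable_bound)
    show "set_integrable lborel {0<..} (\<lambda>y. B y / (2 * \<delta>))" using B_int by simp
    show "set_borel_measurable lborel {0<..} (\<lambda>y. F s y * of_real (L y))"
      unfolding set_borel_measurable_def F_def L_def by measurable
    show "AE y in lborel. y \<in> {0<..} \<longrightarrow> norm (F s y * of_real (L y)) \<le> norm (B y / (2 * \<delta>))"
    proof (intro AE_I2 impI)
      fix y :: real assume "y \<in> {0<..}"
      hence y: "y > 0" by simp
      have "norm (F s y * of_real (L y)) * (2 * \<delta>) = \<bar>g y\<bar> * y powr (-1 - 2 * \<sigma>) * (2 * \<delta> * \<bar>L y\<bar>)"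
        by (simp add: norm_mult F_norm[OF y])
      also have "\<dots> \<le> \<bar>g y\<bar> * y powr (-1 - 2 * \<sigma>) * exp (2 * \<delta> * \<bar>L y\<bar>)"
        by (intro mult_left_mono lin) auto
      also have "\<dots> \<le> B y" by (rule exp_bound[OF y])
      finally have "norm (F s y * of_real (L y)) \<le> B y / (2 * \<delta>)" using \<delta> by (simp add: field_simps)
      thus "norm (F s y * of_real (L y)) \<le> norm (B y / (2 * \<delta>))"
        by (metis abs_ge_self order_trans real_norm_def)
    qed
  qed
  define D where "D = (LINT y:{0<..}|lborel. F s y * of_real (L y))"
  define K where "K = (LINT y:{0<..}|lborel. 2 * B y / \<delta>\<^sup>2)"
  have main: "norm ((mellin g (s + h) - mellin g s) / h - D) \<le> K * norm h" if h: "h \<noteq> 0" "norm h \<le> \<delta>" for h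
  proof -
    have hb: "Re (s + h) < b" using h \<delta> abs_Re_le_cmod[of h] by (simp add: \<sigma>_def)
    have "mellin g (s + h) - mellin g s - h * D =
       (LINT y:{0<..}|lborel. F (s + h) y - F s y - h * (F s y * of_real (L y)))"
      unfolding M D_def using F_int[OF hb] F_int[OF s] F'_int by (simp add: set_integral_diff set_integral_mult_right)
    also have "norm \<dots> \<le> (LINT y:{0<..}|lborel. 2 * B y / \<delta>\<^sup>2 * (norm h)\<^sup>2)"
    proof (rule order_trans[OF set_integral_norm_bound])
      show int': "set_integrable lborel {0<..} (\<lambda>y. F (s + h) y - F s y - h * (F s y * of_real (L y)))"
        using F_int[OF hb] F_int[OF s] F'_int by (intro set_integral_diff set_integrable_mult_right) auto
      show "(LINT y:{0<..}|lborel. norm (F (s + h) y - F s y - h * (F s y * of_real (L y))))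
         \<le> (LINT y:{0<..}|lborel. 2 * B y / \<delta>\<^sup>2 * (norm h)\<^sup>2)"
      proof (rule set_integral_mono)
        show "set_integrable lborel {0<..} (\<lambda>y. norm (F (s + h) y - F s y - h * (F s y * of_real (L y))))"
          using int' by (rule set_integrable_norm)
        show "set_integrable lborel {0<..} (\<lambda>y. 2 * B y / \<delta>\<^sup>2 * (norm h)\<^sup>2)" using B_int by simp
        fix y :: real assume "y \<in> {0<..}"
        hence y: "y > 0" by simp
        define w where "w = h * of_real (L y)"
        have w: "norm w \<le> \<delta> * \<bar>L y\<bar>" using h by (simp add: w_def norm_mult mult_right_mono)
        have "norm (F (s + h) y - F s y - h * (F s y * of_real (L y))) = norm (F s y) * norm (exp w - (1 + w))"
          unfolding F_exp[OF y] w_def norm_mult[symmetric] by (simp add: algebra_simps)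
        also have "norm (exp w - (1 + w)) \<le> exp \<bar>Re w\<bar> * (norm w)\<^sup>2"
          using Taylor_exp[of w 1] by (simp add: numeral_2_eq_2)
        also have "exp \<bar>Re w\<bar> * (norm w)\<^sup>2 \<le> exp (\<delta> * \<bar>L y\<bar>) * ((\<delta> * \<bar>L y\<bar>)\<^sup>2 * ((norm h)\<^sup>2 / \<delta>\<^sup>2))"
        proof (rule mult_mono)
          show "exp \<bar>Re w\<bar> \<le> exp (\<delta> * \<bar>L y\<bar>)" using w abs_Re_le_cmod[of w] by simp
          show "(norm w)\<^sup>2 \<le> (\<delta> * \<bar>L y\<bar>)\<^sup>2 * ((norm h)\<^sup>2 / \<delta>\<^sup>2)"
            using \<delta> by (simp add: w_def norm_mult power_mult_distrib)
        qed auto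
        also have "\<dots> \<le> exp (\<delta> * \<bar>L y\<bar>) * ((2 * exp (\<delta> * \<bar>L y\<bar>)) * ((norm h)\<^sup>2 / \<delta>\<^sup>2))"
          using \<delta> by (intro mult_left_mono mult_right_mono quad) auto
        also have "\<dots> = exp (2 * \<delta> * \<bar>L y\<bar>) * (2 / \<delta>\<^sup>2 * (norm h)\<^sup>2)"
        proof -
          have "exp (2 * \<delta> * \<bar>L y\<bar>) = exp (\<delta> * \<bar>L y\<bar>) * exp (\<delta> * \<bar>L y\<bar>)"
            by (simp flip: exp_add)
          thus ?thesis by simp
        qed
        finally have "norm (F (s + h) y - F s y - h * (F s y * of_real (L y)))
           \<le> norm (F s y) * (exp (2 * \<delta> * \<bar>L y\<bar>) * (2 / \<delta>\<^sup>2 * (norm h)\<^sup>2))"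
          by (simp add: mult_left_mono)
        also have "\<dots> = (\<bar>g y\<bar> * y powr (-1 - 2 * \<sigma>) * exp (2 * \<delta> * \<bar>L y\<bar>)) * (2 / \<delta>\<^sup>2 * (norm h)\<^sup>2)"
          by (simp add: F_norm[OF y])
        also have "\<dots> \<le> B y * (2 / \<delta>\<^sup>2 * (norm h)\<^sup>2)"
          using exp_bound[OF y] by (intro mult_right_mono) auto
        finally show "norm (F (s + h) y - F s y - h * (F s y * of_real (L y))) \<le> 2 * B y / \<delta>\<^sup>2 * (norm h)\<^sup>2"
          by (simp add: mult_ac)
      qed
    qed
    also have "\<dots> = K * (norm h)\<^sup>2" unfolding K_def by (rule set_integral_mult_left)
    finally have *: "norm (mellin g (s + h) - mellin g s - h * D) \<le> K * (norm h)\<^sup>2" .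
    have "(mellin g (s + h) - mellin g s) / h - D = (mellin g (s + h) - mellin g s - h * D) / h"
      using h by (simp add: field_simps)
    also have "norm \<dots> \<le> K * (norm h)\<^sup>2 / norm h"
      unfolding norm_divide using * by (intro divide_right_mono) auto
    finally show ?thesis using h by (simp add: power2_eq_square)
  qed
  have "((\<lambda>h. (mellin g (s + h) - mellin g s) / h) \<longlongrightarrow> D) (at 0)"
  proof (subst Lim_null, rule Lim_null_comparison)
    have "eventually (\<lambda>h. h \<in> ball 0 \<delta> - {0}) (at (0::complex))"
      using \<delta> eventually_at_in_open[of "ball (0::complex) \<delta>" 0] by auto
    thus "eventually (\<lambda>h. norm ((mellin g (s + h) - mellin g s) / h - D) \<le> K * norm h) (at 0)"
      by eventually_elim (use main in auto)
    show "((\<lambda>h. K * norm h) \<longlongrightarrow> 0) (at (0::complex))"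
      by (auto intro!: tendsto_eq_intros)
  qed
  hence "(mellin g has_field_derivative D) (at s)" by (simp add: DERIV_def)
  thus ?thesis ..
qed

lemma mellin_holomorphic:
  assumes "g \<in> borel_measurable borel"
    and "\<And>\<sigma>. \<sigma> < b \<Longrightarrow> set_integrable lborel {0<..} (\<lambda>y. g y * y powr (-1 - 2 * \<sigma>))"
  shows "mellin g holomorphic_on {s. Re s < b}"
  using mellin_has_derivative[OF assms]
  by (subst holomorphic_on_open) (auto simp: open_halfspace_Re_lt)

section \<open>The Mellin transform of the central difference\<close>

text \<open>
  For large \<open>y\<close> only the term \<open>k = 0\<close> of the central difference survives. It is independent of \<open>y\<close> and
  would confine convergence to \<open>Re s > 0\<close>; its removal on \<open>[1, \<infinity>)\<close> leaves a function whose Mellin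
  transform converges for all \<open>Re s < m\<close>.
\<close>
definition cut_diff :: "nat \<Rightarrow> real \<Rightarrow> real \<Rightarrow> real \<Rightarrow> real" where
  "cut_diff m \<beta> z y = central_diff m \<beta> z y - (if 1 \<le> y then central_coeff m 0 * bump \<beta> z else 0)"

lemma borel_measurable_cut_diff [measurable]: "cut_diff m \<beta> z \<in> borel_measurable borel"
  unfolding cut_diff_def[abs_def] by measurable

lemma central_coeff_0_nonneg: "central_coeff m 0 \<ge> 0"
  by (simp add: central_coeff_def)

lemma central_diff_split:
  "central_diff m \<beta> z y = central_coeff m 0 * bump \<beta> z
     + (\<Sum>k=1..m. central_coeff m (int k) * (bump \<beta> (z + real k * y) + bump \<beta> (z - real k * y)))"
  unfolding central_diff_def
  by (subst sum_symmetric_int) (auto intro!: sum.cong simp: central_coeff_minus distrib_left)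

lemma nn_integral_bump_translate:
  assumes "\<beta> > -1" "c \<noteq> 0"
  shows "(\<integral>\<^sup>+y. ennreal (bump \<beta> (z + c * y)) \<partial>lborel) = ennreal (Beta (1 / 2) (\<beta> + 1) / \<bar>c\<bar>)"
proof -
  have "ennreal (Beta (1 / 2) (\<beta> + 1)) = (\<integral>\<^sup>+y. ennreal (bump \<beta> y * \<bar>y\<bar> powr 0) \<partial>lborel)"
    using nn_integral_bump_moment[of \<beta> 0] assms by simp
  also have "\<dots> = (\<integral>\<^sup>+y. ennreal (bump \<beta> y) \<partial>lborel)"
  proof (rule nn_integral_cong_AE)
    show "AE y in lborel. ennreal (bump \<beta> y * \<bar>y\<bar> powr 0) = ennreal (bump \<beta> y)"
      using AE_lborel_singleton[of "0::real"] by eventually_elim simp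
  qed
  also have "\<dots> = \<bar>c\<bar> * (\<integral>\<^sup>+y. ennreal (bump \<beta> (z + c * y)) \<partial>lborel)"
    using assms by (intro nn_integral_real_affine) auto
  finally have "ennreal (1 / \<bar>c\<bar>) * (\<bar>c\<bar> * (\<integral>\<^sup>+y. ennreal (bump \<beta> (z + c * y)) \<partial>lborel)) = ennreal (1 / \<bar>c\<bar>) * ennreal (Beta (1 / 2) (\<beta> + 1))"
    by simp
  moreover have "ennreal (1 / \<bar>c\<bar>) * ennreal \<bar>c\<bar> = 1"
    using assms by (subst ennreal_mult[symmetric]) auto
  ultimately show ?thesis
    by (simp add: mult.assoc[symmetric] ennreal_mult'[symmetric])
qed

lemma nn_integral_powr_0:
  assumes "a > -1" "c \<ge> 0"
  shows "(\<integral>\<^sup>+y\<in>{0..c}. ennreal (y powr a) \<partial>lborel) = ennreal (c powr (a + 1) / (a + 1))"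
  using assms by (intro nn_integral_has_integral_lebesgue' has_integral_powr_from_0) auto

lemma bump_le:
  assumes "\<bar>z\<bar> \<le> q" "q < 1"
  shows "bump \<beta> z \<le> 1 + (1 - q\<^sup>2) powr \<beta>"
  proof (cases "\<beta> \<ge> 0")
    case True
    have "z\<^sup>2 \<le> 1" using assms by (simp add: abs_square_le_1)
    hence "(1 - z\<^sup>2) powr \<beta> \<le> 1 powr \<beta>" using True by (intro powr_mono2) auto
    thus ?thesis by (auto simp: bump_def add_increasing2)
  next
    case False
    have "z\<^sup>2 \<le> q\<^sup>2" "q\<^sup>2 < 1" using assms power_mono[of "\<bar>z\<bar>" q 2] by (auto simp: abs_square_less_1)
    hence "(1 - z\<^sup>2) powr \<beta> \<le> (1 - q\<^sup>2) powr \<beta>" using False by (intro powr_mono2') auto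
    thus ?thesis by (auto simp: bump_def)
  qed

text \<open>
  Split at \<open>\<eta>\<close> and \<open>2\<close>. Below \<open>\<eta>\<close> the Taylor bound makes the integrand \<open>O(y\<^bsup>2m-1-2\<sigma>\<^esup>)\<close>; between \<open>\<eta>\<close> and \<open>2\<close> the
  power of \<open>y\<close> is bounded and the translates of the bump have finite integral, although they need not be
  bounded; beyond \<open>2\<close> the function vanishes because \<open>|z + k y| \<ge> 2 - |z| > 1\<close>.
\<close>
lemma cut_diff_mellin_bound:
  assumes "\<beta> > -1" "0 \<le> q" "q < 1" "m > 0" "\<sigma> < real m"
  obtains K where "K \<ge> 0"
    "\<And>z. \<bar>z\<bar> \<le> q \<Longrightarrow> (\<integral>\<^sup>+y\<in>{0<..}. ennreal (\<bar>cut_diff m \<beta> z y\<bar> * y powr (-1 - 2 * \<sigma>)) \<partial>lborel) \<le> ennreal K"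
proof -
  obtain K1 \<eta> where \<eta>: "\<eta> > 0" "\<eta> \<le> 1" "K1 \<ge> 0"
    and T: "\<And>z y. \<bar>z\<bar> \<le> q \<Longrightarrow> 0 \<le> y \<Longrightarrow> y \<le> \<eta> \<Longrightarrow> \<bar>central_diff m \<beta> z y\<bar> \<le> K1 * y ^ (2*m)"
    using central_diff_Taylor_bound[OF assms(2,3,4)] by metis
  define \<alpha> where "\<alpha> = -1 - 2 * \<sigma>"
  define P where "P = \<eta> powr \<alpha> + 2 powr \<alpha>"
  have P: "y powr \<alpha> \<le> P" if "\<eta> \<le> y" "y \<le> 2" for y
  proof (cases "\<alpha> \<ge> 0")
    case True
    hence "y powr \<alpha> \<le> 2 powr \<alpha>" using that \<eta> by (intro powr_mono2) auto
    thus ?thesis by (simp add: P_def add_increasing)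
  next
    case False
    hence "y powr \<alpha> \<le> \<eta> powr \<alpha>" using that \<eta> by (intro powr_mono2') auto
    thus ?thesis by (simp add: P_def add_increasing2)
  qed
  have "P \<ge> 0" by (simp add: P_def)
  define M where "M = 1 + (1 - q\<^sup>2) powr \<beta>"
  have M: "bump \<beta> z \<le> M" if "\<bar>z\<bar> \<le> q" for z
    unfolding M_def using bump_le[OF that assms(3)] .
  define C where "C = (\<lambda>k::nat. \<bar>central_coeff m (int k)\<bar>)"
  define bound where "bound = (\<lambda>z y. K1 * (y powr (2 * real m + \<alpha>) * indicator {0..\<eta>} y) + C 0 * M * P * indicator {0..2} y
     + (\<Sum>k=1..m. C k * P * (bump \<beta> (z + real k * y) + bump \<beta> (z + (- real k) * y))))"
  define K where "K = K1 * (\<eta> powr (2 * real m + \<alpha> + 1) / (2 * real m + \<alpha> + 1)) + C 0 * M * P * 2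
     + (\<Sum>k=1..m. C k * P * (Beta (1 / 2) (\<beta> + 1) / real k + Beta (1 / 2) (\<beta> + 1) / real k))"
  have M0: "M \<ge> 0" by (simp add: M_def)
  have C0: "C k \<ge> 0" for k by (simp add: C_def)
  have B0: "Beta (1 / 2) (\<beta> + 1) \<ge> 0"
    using assms(1) by (simp add: Beta_def)
  have \<alpha>: "2 * real m + \<alpha> > -1" using assms by (simp add: \<alpha>_def)
  have t1: "K1 * (\<eta> powr (2 * real m + \<alpha> + 1) / (2 * real m + \<alpha> + 1)) \<ge> 0"
    using \<eta> \<alpha> by simp
  show thesis
  proof (rule that[of K])
    show "K \<ge> 0" unfolding K_def using \<eta> M0 C0 B0 \<open>P \<ge> 0\<close> \<alpha>
      by (intro t1 add_nonneg_nonneg sum_nonneg mult_nonneg_nonneg divide_nonneg_nonneg) auto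
    fix z assume z: "\<bar>z\<bar> \<le> q"
    have pt: "\<bar>cut_diff m \<beta> z y\<bar> * y powr \<alpha> * indicator {0<..} y \<le> bound z y" for y
    proof -
      have tail: "(\<Sum>k=1..m. C k * P * (bump \<beta> (z + real k * y) + bump \<beta> (z + (- real k) * y))) \<ge> 0"
        by (intro sum_nonneg mult_nonneg_nonneg add_nonneg_nonneg C0 bump_nonneg \<open>P \<ge> 0\<close>)
      consider "y \<le> 0" | "0 < y" "y < \<eta>" | "\<eta> \<le> y" "y \<le> 2" | "y > 2" by linarith
      thus ?thesis
      proof cases
        case 1
        thus ?thesis using tail \<eta> M0 C0 \<open>P \<ge> 0\<close> unfolding bound_def
          by (auto intro!: add_nonneg_nonneg mult_nonneg_nonneg)
      next
        case 2
        have "\<bar>cut_diff m \<beta> z y\<bar> * y powr \<alpha> \<le> K1 * y ^ (2 * m) * y powr \<alpha>"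
          using 2 \<eta> T[OF z, of y] by (intro mult_right_mono) (auto simp: cut_diff_def)
        also have "y ^ (2 * m) = y powr (2 * real m)" using 2 by (simp add: powr_realpow[symmetric])
        finally have "\<bar>cut_diff m \<beta> z y\<bar> * y powr \<alpha> \<le> K1 * (y powr (2 * real m + \<alpha>) * indicator {0..\<eta>} y)"
          using 2 by (simp add: powr_add mult.assoc)
        moreover have "C 0 * M * P * indicator {0..2} y \<ge> 0"
          using M0 C0 \<open>P \<ge> 0\<close> by auto
        ultimately show ?thesis using tail 2 unfolding bound_def by (auto)
      next
        case 3
        have y: "y > 0" using 3 \<eta> by simp
        have bz: "\<bar>bump \<beta> z\<bar> \<le> M" using M[OF z] bump_nonneg[of \<beta> z] by simp
        have "\<bar>cut_diff m \<beta> z y\<bar> \<le> C 0 * M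
           + (\<Sum>k=1..m. C k * (bump \<beta> (z + real k * y) + bump \<beta> (z + (- real k) * y)))"
        proof -
          have "cut_diff m \<beta> z y = (if 1 \<le> y then 0 else central_coeff m 0 * bump \<beta> z)
            + (\<Sum>k=1..m. central_coeff m (int k) * (bump \<beta> (z + real k * y) + bump \<beta> (z - real k * y)))"
            by (simp add: cut_diff_def central_diff_split)
          moreover have "\<bar>\<Sum>k=1..m. central_coeff m (int k) * (bump \<beta> (z + real k * y) + bump \<beta> (z - real k * y))\<bar>
             \<le> (\<Sum>k=1..m. C k * (bump \<beta> (z + real k * y) + bump \<beta> (z + (- real k) * y)))"
            by (rule order_trans[OF sum_abs]) (auto simp: C_def abs_mult bump_nonneg intro!: sum_mono)
          moreover have "\<bar>if 1 \<le> y then 0 else central_coeff m 0 * bump \<beta> z\<bar> \<le> C 0 * M"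
            using bz M0 by (auto simp: C_def abs_mult intro!: mult_left_mono)
          ultimately show ?thesis by linarith
        qed
        hence "\<bar>cut_diff m \<beta> z y\<bar> * y powr \<alpha> \<le> (C 0 * M
           + (\<Sum>k=1..m. C k * (bump \<beta> (z + real k * y) + bump \<beta> (z + (- real k) * y)))) * P"
          using P[OF 3] by (intro mult_mono) (auto intro!: add_nonneg_nonneg mult_nonneg_nonneg sum_nonneg C0 M0 bump_nonneg)
        also have "\<dots> = C 0 * M * P * indicator {0..2} y
           + (\<Sum>k=1..m. C k * P * (bump \<beta> (z + real k * y) + bump \<beta> (z + (- real k) * y)))"
          using 3 y by (simp add: distrib_left distrib_right sum_distrib_left sum_distrib_right mult_ac)
        also have "\<dots> \<le> bound z y" unfolding bound_def using \<eta> by auto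
        finally show ?thesis using y by simp
      next
        case 4
        have "bump \<beta> (z + real k * y) + bump \<beta> (z - real k * y) = 0" if "k \<in> {1..m}" for k
        proof -
          have "2 \<le> real k * y" using that 4 mult_mono[of 1 "real k" 2 y] by simp
          thus ?thesis using z assms by (auto simp: bump_def)
        qed
        hence "cut_diff m \<beta> z y = 0" using 4 by (simp add: cut_diff_def central_diff_split)
        thus ?thesis using tail \<eta> M0 C0 \<open>P \<ge> 0\<close> unfolding bound_def
          by (auto intro!: add_nonneg_nonneg mult_nonneg_nonneg)
      qed
    qed
    have "(\<integral>\<^sup>+y\<in>{0<..}. ennreal (\<bar>cut_diff m \<beta> z y\<bar> * y powr \<alpha>) \<partial>lborel)
        \<le> (\<integral>\<^sup>+y. ennreal (bound z y) \<partial>lborel)"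
    proof (rule nn_integral_mono)
      fix y
      show "ennreal (\<bar>cut_diff m \<beta> z y\<bar> * y powr \<alpha>) * indicator {0<..} y \<le> ennreal (bound z y)"
        using pt[of y] by (auto simp: indicator_def split: if_splits intro!: ennreal_leI)
    qed
    also have "\<dots> = (\<integral>\<^sup>+y. ennreal K1 * (ennreal (y powr (2 * real m + \<alpha>)) * indicator {0..\<eta>} y)
        + ennreal (C 0 * M * P) * indicator {0..2} y
        + (\<Sum>k=1..m. ennreal (C k * P) * (ennreal (bump \<beta> (z + real k * y)) + ennreal (bump \<beta> (z + (- real k) * y)))) \<partial>lborel)"
    proof (rule nn_integral_cong)
      fix y
      have s: "ennreal (\<Sum>k=1..m. C k * P * (bump \<beta> (z + real k * y) + bump \<beta> (z + (- real k) * y)))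
         = (\<Sum>k=1..m. ennreal (C k * P) * (ennreal (bump \<beta> (z + real k * y)) + ennreal (bump \<beta> (z + (- real k) * y))))"
        using C0 \<open>P \<ge> 0\<close> by (subst sum_ennreal[symmetric])
          (auto simp: ennreal_mult ennreal_plus[symmetric] bump_nonneg simp del: ennreal_plus intro!: mult_nonneg_nonneg sum.cong)
      show "ennreal (bound z y) = ennreal K1 * (ennreal (y powr (2 * real m + \<alpha>)) * indicator {0..\<eta>} y)
        + ennreal (C 0 * M * P) * indicator {0..2} y
        + (\<Sum>k=1..m. ennreal (C k * P) * (ennreal (bump \<beta> (z + real k * y)) + ennreal (bump \<beta> (z + (- real k) * y))))"
        unfolding bound_def s[symmetric] using \<eta> M0 C0 \<open>P \<ge> 0\<close>
        by (subst ennreal_plus) (auto simp: ennreal_mult indicator_def bump_nonneg intro!: sum_nonneg add_nonneg_nonneg mult_nonneg_nonneg)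
    qed
    also have "\<dots> = ennreal K1 * (\<integral>\<^sup>+y. ennreal (y powr (2 * real m + \<alpha>)) * indicator {0..\<eta>} y \<partial>lborel)
        + ennreal (C 0 * M * P) * (\<integral>\<^sup>+y. indicator {0..2::real} y \<partial>lborel)
        + (\<Sum>k=1..m. ennreal (C k * P) * ((\<integral>\<^sup>+y. ennreal (bump \<beta> (z + real k * y)) \<partial>lborel)
            + (\<integral>\<^sup>+y. ennreal (bump \<beta> (z + (- real k) * y)) \<partial>lborel)))"
      by (subst nn_integral_add, simp, simp, subst nn_integral_add, simp, simp, subst nn_integral_sum, simp)
         (simp add: nn_integral_cmult nn_integral_add)
    also have "\<dots> = ennreal K"
    proof -
      have *: "(\<Sum>k=1..m. ennreal (C k * P) * ((\<integral>\<^sup>+y. ennreal (bump \<beta> (z + real k * y)) \<partial>lborel)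
            + (\<integral>\<^sup>+y. ennreal (bump \<beta> (z + (- real k) * y)) \<partial>lborel)))
         = ennreal (\<Sum>k=1..m. C k * P * (Beta (1 / 2) (\<beta> + 1) / real k + Beta (1 / 2) (\<beta> + 1) / real k))"
      proof -
        have "ennreal (C k * P) * ((\<integral>\<^sup>+y. ennreal (bump \<beta> (z + real k * y)) \<partial>lborel)
              + (\<integral>\<^sup>+y. ennreal (bump \<beta> (z + (- real k) * y)) \<partial>lborel))
            = ennreal (C k * P * (Beta (1 / 2) (\<beta> + 1) / real k + Beta (1 / 2) (\<beta> + 1) / real k))"
          if "k \<in> {1..m}" for k
        proof -
          have t: "(\<integral>\<^sup>+y. ennreal (bump \<beta> (z + real k * y)) \<partial>lborel) = ennreal (Beta (1 / 2) (\<beta> + 1) / real k)"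
               "(\<integral>\<^sup>+y. ennreal (bump \<beta> (z + (- real k) * y)) \<partial>lborel) = ennreal (Beta (1 / 2) (\<beta> + 1) / real k)"
            using that nn_integral_bump_translate[OF assms(1), of "real k" z]
              nn_integral_bump_translate[OF assms(1), of "- real k" z] by simp_all
          show ?thesis unfolding t using C0[of k] \<open>P \<ge> 0\<close> B0
            by (subst ennreal_plus[symmetric], simp, simp, subst ennreal_mult[symmetric]) auto
        qed
        thus ?thesis using C0 \<open>P \<ge> 0\<close> B0
          by (subst sum_ennreal[symmetric]) (auto intro!: mult_nonneg_nonneg sum.cong)
      qed
      have gen: "ennreal a * ennreal b + ennreal c * ennreal d + ennreal e = ennreal (a * b + c * d + e)"
        if "a \<ge> 0" "b \<ge> 0" "c \<ge> 0" "d \<ge> 0" "e \<ge> 0" for a b c d e :: real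
        using that by (simp add: ennreal_mult)
      have **: "(\<integral>\<^sup>+y. indicator {0..2::real} y \<partial>lborel) = ennreal 2" by simp
      show ?thesis unfolding * ** K_def nn_integral_powr_0[OF \<alpha> less_imp_le[OF \<eta>(1)]]
        using \<eta> M0 C0 B0 \<open>P \<ge> 0\<close> \<alpha>
        by (intro gen sum_nonneg mult_nonneg_nonneg add_nonneg_nonneg) auto
    qed
    finally show "(\<integral>\<^sup>+y\<in>{0<..}. ennreal (\<bar>cut_diff m \<beta> z y\<bar> * y powr (-1 - 2 * \<sigma>)) \<partial>lborel) \<le> ennreal K"
      by (simp add: \<alpha>_def)
  qed
qed

lemma set_integral_eq_nn_integral:
  assumes [measurable]: "A \<in> sets M" "f \<in> borel_measurable M"
    and "\<And>x. x \<in> A \<Longrightarrow> 0 \<le> f x" "c \<ge> 0"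
    and "(\<integral>\<^sup>+x\<in>A. ennreal (f x) \<partial>M) = ennreal c"
  shows "set_integrable M A f" and "(LINT x:A|M. f x) = c"
proof -
  have eq: "(\<integral>\<^sup>+x. ennreal (indicator A x *\<^sub>R f x) \<partial>M) = ennreal c"
    unfolding assms(5)[symmetric] by (intro nn_integral_cong) (auto simp: indicator_def)
  have nn: "AE x in M. 0 \<le> indicator A x *\<^sub>R f x"
    using assms(3) by (auto simp: indicator_def)
  show "set_integrable M A f"
    unfolding set_integrable_def using nn eq by (intro integrableI_nonneg) auto
  show "(LINT x:A|M. f x) = c"
    unfolding set_lebesgue_integral_def using nn eq assms(4) by (simp add: integral_eq_nn_integral)
qed

lemma set_integrable_cut_diff:
  assumes "\<beta> > -1" "\<bar>z\<bar> < 1" "m > 0" "\<sigma> < real m"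
  shows "set_integrable lborel {0<..} (\<lambda>y. cut_diff m \<beta> z y * y powr (-1 - 2 * \<sigma>))"
proof -
  obtain K where "K \<ge> 0" and K: "\<And>w. \<bar>w\<bar> \<le> \<bar>z\<bar> \<Longrightarrow>
      (\<integral>\<^sup>+y\<in>{0<..}. ennreal (\<bar>cut_diff m \<beta> w y\<bar> * y powr (-1 - 2 * \<sigma>)) \<partial>lborel) \<le> ennreal K"
    by (rule cut_diff_mellin_bound[OF assms(1) abs_ge_zero assms(2,3,4)], rule that)
  show ?thesis unfolding set_integrable_def
  proof (rule integrableI_bounded)
    have "(\<integral>\<^sup>+y. ennreal (norm (indicator {0<..} y *\<^sub>R (cut_diff m \<beta> z y * y powr (-1 - 2 * \<sigma>)))) \<partial>lborel)
       = (\<integral>\<^sup>+y\<in>{0<..}. ennreal (\<bar>cut_diff m \<beta> z y\<bar> * y powr (-1 - 2 * \<sigma>)) \<partial>lborel)"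
      by (intro nn_integral_cong) (auto simp: indicator_def abs_mult)
    also have "\<dots> \<le> ennreal K" by (rule K) simp
    also have "\<dots> < \<infinity>" by simp
    finally show "(\<integral>\<^sup>+y. ennreal (norm (indicator {0<..} y *\<^sub>R (cut_diff m \<beta> z y * y powr (-1 - 2 * \<sigma>)))) \<partial>lborel) < \<infinity>" .
  qed measurable
qed

lemma set_integral_powr_0_1:
  assumes "s < 0"
  shows "set_integrable lborel {0<..} (\<lambda>y::real. (if 1 \<le> y then 0 else 1) * y powr (-1 - 2 * s))"
    and "(LINT y:{0<..}|lborel. (if 1 \<le> y then 0 else 1) * y powr (-1 - 2 * s)) = - 1 / (2 * s)"
proof -
  have "(\<integral>\<^sup>+y\<in>{0<..}. ennreal ((if 1 \<le> y then 0 else 1) * y powr (-1 - 2 * s)) \<partial>lborel)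
     = (\<integral>\<^sup>+y\<in>{0..1}. ennreal (y powr (-1 - 2 * s)) \<partial>lborel)"
  proof (rule nn_integral_cong_AE)
    show "AE y in lborel. ennreal ((if 1 \<le> y then 0 else 1) * y powr (-1 - 2 * s)) * indicator {0<..} y
      = ennreal (y powr (-1 - 2 * s)) * indicator {0..1} y"
      using AE_lborel_singleton[of "1::real"] by eventually_elim (auto simp: indicator_def)
  qed
  also have "\<dots> = ennreal (- 1 / (2 * s))"
    using assms by (subst nn_integral_powr_0) auto
  finally have *: "(\<integral>\<^sup>+y\<in>{0<..}. ennreal ((if 1 \<le> y then 0 else 1) * y powr (-1 - 2 * s)) \<partial>lborel) = ennreal (- 1 / (2 * s))" .
  have c: "- 1 / (2 * s) \<ge> 0" using assms by (simp add: divide_nonneg_neg field_simps)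
  show "set_integrable lborel {0<..} (\<lambda>y::real. (if 1 \<le> y then 0 else 1) * y powr (-1 - 2 * s))"
    by (rule set_integral_eq_nn_integral(1)[OF _ _ _ c *]) auto
  show "(LINT y:{0<..}|lborel. (if 1 \<le> y then 0 else 1) * y powr (-1 - 2 * s)) = - 1 / (2 * s)"
    by (rule set_integral_eq_nn_integral(2)[OF _ _ _ c *]) auto
qed

lemma nn_integral_powr_1_inf:
  assumes "s > 0"
  shows "(\<integral>\<^sup>+y\<in>{0<..}. ennreal ((if 1 \<le> y then 1 else 0) * y powr (-1 - 2 * s)) \<partial>lborel) = ennreal (1 / (2 * s))"
proof -
  have "(\<integral>\<^sup>+y\<in>{0<..}. ennreal ((if 1 \<le> y then 1 else 0) * y powr (-1 - 2 * s)) \<partial>lborel)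
     = (\<integral>\<^sup>+y. ennreal (y powr (-1 - 2 * s)) * indicator {1..} y \<partial>lborel)"
    by (intro nn_integral_cong) (auto simp: indicator_def)
  also have "\<dots> = ennreal (1 / (2 * s))"
    using nn_integral_has_integral_lebesgue'[OF _ has_integral_powr_to_inf[of "-1 - 2 * s" 1]] assms
    by simp
  finally show ?thesis .
qed

lemma set_integral_powr_1_inf:
  assumes "s > 0"
  shows "set_integrable lborel {0<..} (\<lambda>y::real. (if 1 \<le> y then 1 else 0) * y powr (-1 - 2 * s))"
    and "(LINT y:{0<..}|lborel. (if 1 \<le> y then 1 else 0) * y powr (-1 - 2 * s)) = 1 / (2 * s)"
proof -
  have c: "1 / (2 * s) \<ge> 0" using assms by simp
  show "set_integrable lborel {0<..} (\<lambda>y::real. (if 1 \<le> y then 1 else 0) * y powr (-1 - 2 * s))"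
    by (rule set_integral_eq_nn_integral(1)[OF _ _ _ c nn_integral_powr_1_inf[OF assms]]) auto
  show "(LINT y:{0<..}|lborel. (if 1 \<le> y then 1 else 0) * y powr (-1 - 2 * s)) = 1 / (2 * s)"
    by (rule set_integral_eq_nn_integral(2)[OF _ _ _ c nn_integral_powr_1_inf[OF assms]]) auto
qed

text \<open>
  The terms \<open>k\<close> and \<open>-k\<close> together form the integral over the whole line of one scaled bump, which is a
  multiple of the Riesz potential.
\<close>
lemma set_integral_bump_pair:
  assumes "\<beta> > -1" "s < 0" "\<bar>z\<bar> < 1" "k > 0"
  defines "w \<equiv> Beta (- s) (\<beta> + 1) * hyp2F1 (s + 1 / 2) (s - \<beta>) (1 / 2) (z\<^sup>2)"
  shows "set_integrable lborel {0<..} (\<lambda>y. (bump \<beta> (z + k * y) + bump \<beta> (z - k * y)) * y powr (-1 - 2 * s))"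
    and "(LINT y:{0<..}|lborel. (bump \<beta> (z + k * y) + bump \<beta> (z - k * y)) * y powr (-1 - 2 * s)) = k powr (2 * s) * w"
proof -
  define \<alpha> where "\<alpha> = -1 - 2 * s"
  have w: "w \<ge> 0" "(\<integral>\<^sup>+t. ennreal (bump \<beta> (z + t) * \<bar>t\<bar> powr \<alpha>) \<partial>lborel) = ennreal w"
    unfolding w_def \<alpha>_def using riesz_potential_bump[OF assms(1-3)] by auto
  have scale: "(\<integral>\<^sup>+y. ennreal (bump \<beta> (z + c * y) * \<bar>y\<bar> powr \<alpha>) \<partial>lborel) = ennreal (k powr (2 * s) * w)" if "\<bar>c\<bar> = k" for c
  proof -
    have c: "c \<noteq> 0" using that assms by auto
    have "ennreal w = \<bar>c\<bar> * (\<integral>\<^sup>+y. ennreal (bump \<beta> (z + (0 + c * y)) * \<bar>0 + c * y\<bar> powr \<alpha>) \<partial>lborel)"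
      unfolding w(2)[symmetric] using c by (intro nn_integral_real_affine) auto
    also have "(\<integral>\<^sup>+y. ennreal (bump \<beta> (z + (0 + c * y)) * \<bar>0 + c * y\<bar> powr \<alpha>) \<partial>lborel)
       = (\<integral>\<^sup>+y. ennreal (k powr \<alpha>) * ennreal (bump \<beta> (z + c * y) * \<bar>y\<bar> powr \<alpha>) \<partial>lborel)"
      using that assms by (intro nn_integral_cong)
        (auto simp: abs_mult powr_mult bump_nonneg ennreal_mult[symmetric] mult_ac)
    also have "\<dots> = ennreal (k powr \<alpha>) * (\<integral>\<^sup>+y. ennreal (bump \<beta> (z + c * y) * \<bar>y\<bar> powr \<alpha>) \<partial>lborel)"
      by (intro nn_integral_cmult) auto
    finally have "ennreal (k powr (2 * s)) * ennreal w = ennreal (k powr (2 * s)) * (ennreal k * ennreal (k powr \<alpha>)) * (\<integral>\<^sup>+y. ennreal (bump \<beta> (z + c * y) * \<bar>y\<bar> powr \<alpha>) \<partial>lborel)"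
      using that by (simp add: mult.assoc)
    also have "ennreal (k powr (2 * s)) * (ennreal k * ennreal (k powr \<alpha>)) = ennreal (k powr (2 * s) * (k * k powr \<alpha>))"
      using assms by (simp add: ennreal_mult)
    also have "k powr (2 * s) * (k * k powr \<alpha>) = 1"
    proof -
      have "k powr (2 * s) * (k powr 1 * k powr \<alpha>) = k powr 0"
        unfolding powr_add[symmetric] by (simp add: \<alpha>_def)
      thus ?thesis using assms by simp
    qed
    finally show ?thesis using w(1) by (simp only: ennreal_1 mult_1 ennreal_mult'')
  qed
  define f where "f = (\<lambda>y. (bump \<beta> (z + k * y) + bump \<beta> (z - k * y)) * y powr \<alpha>)"
  have "2 * (\<integral>\<^sup>+y\<in>{0<..}. ennreal (f y) \<partial>lborel)
      = 2 * (\<integral>\<^sup>+y\<in>{0<..}. ennreal ((bump \<beta> (z + k * y) + bump \<beta> (z - k * y)) * \<bar>y\<bar> powr \<alpha>) \<partial>lborel)"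
    by (intro arg_cong[of _ _ "\<lambda>x. 2 * x"] nn_integral_cong) (auto simp: f_def indicator_def)
  also have "\<dots> = (\<integral>\<^sup>+y. ennreal ((bump \<beta> (z + k * y) + bump \<beta> (z - k * y)) * \<bar>y\<bar> powr \<alpha>) \<partial>lborel)"
    by (intro nn_integral_even[symmetric]) (auto simp: add.commute)
  also have "\<dots> = (\<integral>\<^sup>+y. ennreal (bump \<beta> (z + k * y) * \<bar>y\<bar> powr \<alpha>) + ennreal (bump \<beta> (z + (- k) * y) * \<bar>y\<bar> powr \<alpha>) \<partial>lborel)"
    by (intro nn_integral_cong) (auto simp: bump_nonneg distrib_right ennreal_plus[symmetric] simp del: ennreal_plus)
  also have "\<dots> = (\<integral>\<^sup>+y. ennreal (bump \<beta> (z + k * y) * \<bar>y\<bar> powr \<alpha>) \<partial>lborel) + (\<integral>\<^sup>+y. ennreal (bump \<beta> (z + (- k) * y) * \<bar>y\<bar> powr \<alpha>) \<partial>lborel)"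
    by (intro nn_integral_add) auto
  also have "\<dots> = 2 * ennreal (k powr (2 * s) * w)"
  proof -
    have "(\<integral>\<^sup>+y. ennreal (bump \<beta> (z + k * y) * \<bar>y\<bar> powr \<alpha>) \<partial>lborel) = ennreal (k powr (2 * s) * w)"
      "(\<integral>\<^sup>+y. ennreal (bump \<beta> (z + (- k) * y) * \<bar>y\<bar> powr \<alpha>) \<partial>lborel) = ennreal (k powr (2 * s) * w)"
      by (rule scale, use assms(4) in simp)+
    thus ?thesis by (simp only: mult_2)
  qed
  finally have *: "(\<integral>\<^sup>+y\<in>{0<..}. ennreal (f y) \<partial>lborel) = ennreal (k powr (2 * s) * w)"
    by (subst (asm) ennreal_mult_cancel_left) auto
  have c: "k powr (2 * s) * w \<ge> 0" using w by simp
  show "set_integrable lborel {0<..} (\<lambda>y. (bump \<beta> (z + k * y) + bump \<beta> (z - k * y)) * y powr (-1 - 2 * s))"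
    unfolding \<alpha>_def[symmetric]
    by (rule set_integral_eq_nn_integral(1)[OF _ _ _ c *[unfolded f_def]]) (auto simp: bump_nonneg)
  show "(LINT y:{0<..}|lborel. (bump \<beta> (z + k * y) + bump \<beta> (z - k * y)) * y powr (-1 - 2 * s)) = k powr (2 * s) * w"
    unfolding \<alpha>_def[symmetric]
    by (rule set_integral_eq_nn_integral(2)[OF _ _ _ c *[unfolded f_def]]) (auto simp: bump_nonneg)
qed

lemma set_integral_sum:
  fixes f :: "'b \<Rightarrow> 'a \<Rightarrow> real"
  assumes "\<And>i. i \<in> I \<Longrightarrow> set_integrable M A (f i)"
  shows "(LINT x:A|M. (\<Sum>i\<in>I. f i x)) = (\<Sum>i\<in>I. LINT x:A|M. f i x)"
    and "set_integrable M A (\<lambda>x. \<Sum>i\<in>I. f i x)"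
  using assms unfolding set_lebesgue_integral_def set_integrable_def
  by (auto simp: sum_distrib_left intro!: Bochner_Integration.integral_sum Bochner_Integration.integrable_sum)

text \<open>
  For \<open>s < 0\<close> each term of the central difference is integrable at the origin by itself. The term
  \<open>k = 0\<close>, cut off at \<open>1\<close>, gives the multiple of \<open>1 / s\<close>.
\<close>
lemma cut_diff_mellin_negative:
  assumes "\<beta> > -1" "s < 0" "\<bar>z\<bar> < 1"
  shows "(LINT y:{0<..}|lborel. cut_diff m \<beta> z y * y powr (-1 - 2 * s))
    = - central_coeff m 0 * bump \<beta> z / (2 * s)
      + half_moment m s * (Beta (- s) (\<beta> + 1) * hyp2F1 (s + 1 / 2) (s - \<beta>) (1 / 2) (z\<^sup>2))"
proof -
  define w where "w = Beta (- s) (\<beta> + 1) * hyp2F1 (s + 1 / 2) (s - \<beta>) (1 / 2) (z\<^sup>2)"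
  define f where "f = (\<lambda>k y. central_coeff m (int k) * ((bump \<beta> (z + real k * y) + bump \<beta> (z - real k * y)) * y powr (-1 - 2 * s)))"
  have f: "set_integrable lborel {0<..} (f k)"
     "(LINT y:{0<..}|lborel. f k y) = central_coeff m (int k) * (real k powr (2 * s) * w)" if "k \<in> {1..m}" for k
    using set_integral_bump_pair[OF assms, of "real k"] that unfolding f_def w_def by auto
  have "(LINT y:{0<..}|lborel. cut_diff m \<beta> z y * y powr (-1 - 2 * s))
      = (LINT y:{0<..}|lborel. central_coeff m 0 * bump \<beta> z * ((if 1 \<le> y then 0 else 1) * y powr (-1 - 2 * s)) + (\<Sum>k=1..m. f k y))"
    unfolding cut_diff_def central_diff_split f_def
    by (intro arg_cong[of _ _ "set_lebesgue_integral lborel {0<..}"] ext)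
       (simp add: distrib_right left_diff_distrib sum_distrib_right mult.assoc)
  also have "\<dots> = (LINT y:{0<..}|lborel. central_coeff m 0 * bump \<beta> z * ((if 1 \<le> y then 0 else 1) * y powr (-1 - 2 * s))) + (LINT y:{0<..}|lborel. \<Sum>k=1..m. f k y)"
    using set_integral_powr_0_1(1)[OF assms(2)] f(1) by (intro set_integral_add(2) set_integral_sum(2) set_integrable_mult_right) auto
  also have "(LINT y:{0<..}|lborel. \<Sum>k=1..m. f k y) = (\<Sum>k=1..m. LINT y:{0<..}|lborel. f k y)"
    using f(1) by (intro set_integral_sum(1)) auto
  also have "\<dots> = half_moment m s * w"
    unfolding half_moment_def sum_distrib_right
    by (intro sum.cong refl) (simp add: f(2) central_coeff_nat mult.assoc)
  also have "(LINT y:{0<..}|lborel. central_coeff m 0 * bump \<beta> z * ((if 1 \<le> y then 0 else 1) * y powr (-1 - 2 * s)))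
      = central_coeff m 0 * bump \<beta> z * (- 1 / (2 * s))"
    by (subst set_integral_mult_right, subst set_integral_powr_0_1(2)[OF assms(2)]) simp
  finally show ?thesis by (simp add: w_def)
qed

text \<open>
  The part that was cut off is put back; for \<open>s > 0\<close> it contributes the opposite of the term in \<open>1 / s\<close> from
  the preceding lemma, so that the two cancel after analytic continuation.
\<close>
lemma central_diff_mellin:
  assumes "\<beta> > -1" "0 < s" "s < real m" "\<bar>z\<bar> < 1"
  shows "set_integrable lborel {0<..} (\<lambda>y. central_diff m \<beta> z y * y powr (-1 - 2 * s))"
    and "(LINT y:{0<..}|lborel. central_diff m \<beta> z y * y powr (-1 - 2 * s))
       = (LINT y:{0<..}|lborel. cut_diff m \<beta> z y * y powr (-1 - 2 * s)) + central_coeff m 0 * bump \<beta> z / (2 * s)"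
proof -
  have m: "m > 0" using assms by (intro gr0I) auto
  have eq: "central_diff m \<beta> z y * y powr (-1 - 2 * s) = cut_diff m \<beta> z y * y powr (-1 - 2 * s)
      + central_coeff m 0 * bump \<beta> z * ((if 1 \<le> y then 1 else 0) * y powr (-1 - 2 * s))" for y
    by (simp add: cut_diff_def algebra_simps)
  note int = set_integrable_cut_diff[OF assms(1,4) m assms(3)]
  note int' = set_integrable_mult_right[of "central_coeff m 0 * bump \<beta> z", OF set_integral_powr_1_inf(1)[OF assms(2)]]
  show "set_integrable lborel {0<..} (\<lambda>y. central_diff m \<beta> z y * y powr (-1 - 2 * s))"
    unfolding eq using int int' by (intro set_integral_add(1)) auto
  show "(LINT y:{0<..}|lborel. central_diff m \<beta> z y * y powr (-1 - 2 * s))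
       = (LINT y:{0<..}|lborel. cut_diff m \<beta> z y * y powr (-1 - 2 * s)) + central_coeff m 0 * bump \<beta> z / (2 * s)"
    unfolding eq by (subst set_integral_add(2)[OF int int'], subst set_integral_mult_right,
      subst set_integral_powr_1_inf(2)[OF assms(2)]) simp
qed

text \<open>
  Uniformity in \<open>z\<close> means uniformity in the direction \<open>\<theta>\<close>, which makes the integral over the whole space
  absolutely convergent.
\<close>
lemma central_diff_mellin_bound:
  assumes "\<beta> > -1" "0 \<le> q" "q < 1" "0 < s" "s < real m"
  obtains K where "K \<ge> 0"
    "\<And>z. \<bar>z\<bar> \<le> q \<Longrightarrow> (\<integral>\<^sup>+y\<in>{0<..}. ennreal (\<bar>central_diff m \<beta> z y\<bar> * y powr (-1 - 2 * s)) \<partial>lborel) \<le> ennreal K"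
proof -
  have m: "m > 0" using assms by (intro gr0I) auto
  obtain K where K: "K \<ge> 0"
    "\<And>z. \<bar>z\<bar> \<le> q \<Longrightarrow> (\<integral>\<^sup>+y\<in>{0<..}. ennreal (\<bar>cut_diff m \<beta> z y\<bar> * y powr (-1 - 2 * s)) \<partial>lborel) \<le> ennreal K"
    by (rule cut_diff_mellin_bound[OF assms(1,2,3) m assms(5)], rule that)
  define M where "M = 1 + (1 - q\<^sup>2) powr \<beta>"
  define C where "C = central_coeff m 0"
  have C: "C \<ge> 0" by (simp add: C_def central_coeff_0_nonneg)
  have M: "M \<ge> 0" by (simp add: M_def)
  show thesis
  proof (rule that)
    show "K + C * M * (1 / (2 * s)) \<ge> 0" using K C M assms by simp
    fix z assume z: "\<bar>z\<bar> \<le> q"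
    let ?e = "\<lambda>y::real. (if 1 \<le> y then 1 else 0) * y powr (-1 - 2 * s)"
    have "\<bar>central_diff m \<beta> z y\<bar> \<le> \<bar>cut_diff m \<beta> z y\<bar> + C * M * (if 1 \<le> y then 1 else 0)" for y
    proof -
      have "C * bump \<beta> z \<le> C * M" unfolding M_def
        by (intro mult_left_mono bump_le z assms C)
      moreover have "C * bump \<beta> z \<ge> 0" using C by (simp add: bump_nonneg)
      moreover have "cut_diff m \<beta> z y = central_diff m \<beta> z y - (if 1 \<le> y then C * bump \<beta> z else 0)"
        by (simp only: cut_diff_def C_def)
      ultimately show ?thesis by (cases "1 \<le> y") (simp; linarith)+
    qed
    note le = this
    have "ennreal (\<bar>central_diff m \<beta> z y\<bar> * y powr (-1 - 2 * s))
       \<le> ennreal (\<bar>cut_diff m \<beta> z y\<bar> * y powr (-1 - 2 * s)) + ennreal (C * M) * ennreal (?e y)" for y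
    proof -
      have "\<bar>central_diff m \<beta> z y\<bar> * y powr (-1 - 2 * s)
          \<le> (\<bar>cut_diff m \<beta> z y\<bar> + C * M * (if 1 \<le> y then 1 else 0)) * y powr (-1 - 2 * s)"
        by (rule mult_right_mono[OF le]) simp
      also have "\<dots> = \<bar>cut_diff m \<beta> z y\<bar> * y powr (-1 - 2 * s) + (C * M) * ?e y"
        by (simp only: distrib_right mult.assoc)
      finally have "ennreal (\<bar>central_diff m \<beta> z y\<bar> * y powr (-1 - 2 * s)) \<le> ennreal (\<dots>)"
        by (rule ennreal_leI)
      also have "\<dots> = ennreal (\<bar>cut_diff m \<beta> z y\<bar> * y powr (-1 - 2 * s)) + ennreal ((C * M) * ?e y)"
        using C M by (intro ennreal_plus) auto
      also have "ennreal ((C * M) * ?e y) = ennreal (C * M) * ennreal (?e y)"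
        using C M by (intro ennreal_mult) auto
      finally show ?thesis .
    qed
    hence "(\<integral>\<^sup>+y\<in>{0<..}. ennreal (\<bar>central_diff m \<beta> z y\<bar> * y powr (-1 - 2 * s)) \<partial>lborel)
      \<le> (\<integral>\<^sup>+y. (ennreal (\<bar>cut_diff m \<beta> z y\<bar> * y powr (-1 - 2 * s)) + ennreal (C * M) * ennreal (?e y)) * indicator {0<..} y \<partial>lborel)"
      by (intro nn_integral_mono mult_right_mono) auto
    also have "\<dots> = (\<integral>\<^sup>+y. ennreal (\<bar>cut_diff m \<beta> z y\<bar> * y powr (-1 - 2 * s)) * indicator {0<..} y
           + ennreal (C * M) * (ennreal (?e y) * indicator {0<..} y) \<partial>lborel)"
      by (simp only: distrib_right mult.assoc)
    also have "\<dots> = (\<integral>\<^sup>+y\<in>{0<..}. ennreal (\<bar>cut_diff m \<beta> z y\<bar> * y powr (-1 - 2 * s)) \<partial>lborel)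
        + ennreal (C * M) * (\<integral>\<^sup>+y\<in>{0<..}. ennreal (?e y) \<partial>lborel)"
      by (subst nn_integral_add, simp, simp, subst nn_integral_cmult) auto
    also have "\<dots> \<le> ennreal K + ennreal (C * M) * ennreal (1 / (2 * s))"
      unfolding nn_integral_powr_1_inf[OF assms(4)] by (intro add_right_mono K(2) z)
    also have "\<dots> = ennreal (K + C * M * (1 / (2 * s)))"
      using K(1) C M assms by (subst ennreal_mult[symmetric], simp, simp, subst ennreal_plus[symmetric]) auto
    finally show "(\<integral>\<^sup>+y\<in>{0<..}. ennreal (\<bar>central_diff m \<beta> z y\<bar> * y powr (-1 - 2 * s)) \<partial>lborel)
        \<le> ennreal (K + C * M * (1 / (2 * s)))" .
  qed
qed

section \<open>Analytic continuation in the order\<close>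

lemma norm_pochhammer_le:
  fixes a :: "'a::{real_normed_field}"
  assumes "norm a \<le> r"
  shows "norm (pochhammer a k) \<le> pochhammer r k"
proof (induction k)
  case (Suc k)
  have "norm (a + of_nat k) \<le> r + real k"
    using norm_triangle_ineq[of a "of_nat k"] assms by simp
  moreover have "pochhammer r k \<ge> 0" using order_trans[OF norm_ge_zero Suc] .
  ultimately show ?case using Suc by (simp add: pochhammer_Suc norm_mult mult_mono)
qed simp

text \<open>
  The hypergeometric factor as a function of a complex order \<open>s\<close>.
\<close>
definition hyp2F1_complex :: "real \<Rightarrow> real \<Rightarrow> complex \<Rightarrow> complex" where
  "hyp2F1_complex \<beta> x s = (\<Sum>k. pochhammer (s + 1 / 2) k * pochhammer (s - of_real \<beta>) k
      / (pochhammer (1 / 2) k * fact k) * of_real x ^ k)"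

lemma hyp2F1_complex_of_real:
  assumes "\<bar>x\<bar> < 1"
  shows "hyp2F1_complex \<beta> x (of_real s) = of_real (hyp2F1 (s + 1 / 2) (s - \<beta>) (1 / 2) x)"
proof -
  have half: "pochhammer (complex_of_real s + 1 / 2) k = of_real (pochhammer (s + 1 / 2) k)"
     "pochhammer (complex_of_real s - of_real \<beta>) k = of_real (pochhammer (s - \<beta>) k)"
     "pochhammer (1 / 2 :: complex) k = of_real (pochhammer (1 / 2) k)" for k
    using pochhammer_of_real[of "s + 1/2" k, where 'a = complex] pochhammer_of_real[of "1/2" k, where 'a = complex]
      pochhammer_of_real[of "s - \<beta>" k, where 'a = complex]
    by simp_all
  have "(\<lambda>k. complex_of_real (pochhammer (s + 1 / 2) k * pochhammer (s - \<beta>) k / (pochhammer (1 / 2) k * fact k) * x ^ k))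
      sums of_real (hyp2F1 (s + 1 / 2) (s - \<beta>) (1 / 2) x)"
    by (intro sums_of_real hyp2F1_sums assms) simp
  also have "(\<lambda>k. complex_of_real (pochhammer (s + 1 / 2) k * pochhammer (s - \<beta>) k / (pochhammer (1 / 2) k * fact k) * x ^ k))
     = (\<lambda>k. pochhammer (of_real s + 1 / 2) k * pochhammer (of_real s - of_real \<beta>) k
      / (pochhammer (1 / 2) k * fact k) * of_real x ^ k)"
    by (simp add: half)
  finally show ?thesis by (simp add: hyp2F1_complex_def sums_iff)
qed

text \<open>
  On a disc the parameters are bounded by some \<open>r\<close>, and the series with both parameters equal to \<open>r\<close> is a
  convergent majorant.
\<close>
lemma hyp2F1_complex_holomorphic:
  assumes "\<bar>x\<bar> < 1"
  shows "hyp2F1_complex \<beta> x holomorphic_on UNIV"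
proof (rule holomorphic_uniform_sequence)
  let ?f = "\<lambda>k s. pochhammer (s + 1 / 2) k * pochhammer (s - of_real \<beta>) k
      / (pochhammer (1 / 2) k * fact k) * complex_of_real x ^ k"
  have poch: "(\<lambda>s. pochhammer (g s) k) holomorphic_on UNIV" if "g holomorphic_on UNIV" for g :: "complex \<Rightarrow> complex" and k
    by (induction k) (auto simp: pochhammer_Suc intro!: holomorphic_intros that)
  show "(\<lambda>s. \<Sum>k<n. ?f k s) holomorphic_on UNIV" for n
  proof -
    have ne: "pochhammer (1 / 2 :: complex) k \<noteq> 0" for k
      using pochhammer_pos[of "1/2::real" k] pochhammer_of_real[of "1/2" k, where 'a = complex] by simp
    show ?thesis by (intro holomorphic_intros poch) (auto simp: ne)
  qed
  fix s0 :: complex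
  define r where "r = norm s0 + 1 + 1 / 2 + \<bar>\<beta>\<bar>"
  have ul: "uniform_limit (cball s0 1) (\<lambda>n s. \<Sum>k<n. ?f k s) (\<lambda>s. \<Sum>k. ?f k s) sequentially"
  proof (rule Weierstrass_m_test)
    show "summable (\<lambda>k. norm (pochhammer r k * pochhammer r k / (pochhammer (1 / 2) k * fact k) * x ^ k))"
      by (rule summable_hypergeometric) (use assms in auto)
    fix k and s :: complex assume "s \<in> cball s0 1"
    hence s: "norm s \<le> norm s0 + 1"
      using norm_triangle_ineq2[of s s0] by (simp add: dist_norm norm_minus_commute)
    have "norm (s + 1 / 2) \<le> r" "norm (s - of_real \<beta>) \<le> r"
      using s norm_triangle_ineq[of s "1/2"] norm_triangle_ineq4[of s "of_real \<beta>"] by (auto simp: r_def)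
    hence "norm (pochhammer (s + 1 / 2) k) * norm (pochhammer (s - of_real \<beta>) k) \<le> pochhammer r k * pochhammer r k"
      by (intro mult_mono norm_pochhammer_le order_trans[OF norm_ge_zero norm_pochhammer_le]) auto
    moreover have p: "pochhammer (1 / 2 :: real) k > 0" by (intro pochhammer_pos) simp
    moreover have "norm (pochhammer (1 / 2 :: complex) k) = pochhammer (1 / 2) k"
      using pochhammer_of_real[of "1/2" k, where 'a = complex] p by simp
    moreover have "norm (fact k :: complex) = fact k" by (metis norm_fact)
    moreover have "norm (?f k s) = norm (pochhammer (s + 1 / 2) k) * norm (pochhammer (s - of_real \<beta>) k)
        / (norm (pochhammer (1 / 2 :: complex) k) * norm (fact k :: complex)) * \<bar>x\<bar> ^ k"
      by (simp only: norm_mult norm_divide norm_power norm_of_real real_norm_def)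
    ultimately have "norm (?f k s) \<le> pochhammer r k * pochhammer r k / (pochhammer (1 / 2) k * fact k) * \<bar>x\<bar> ^ k"
      by (simp only:) (intro mult_right_mono divide_right_mono, auto)
    also have "\<dots> \<le> norm (pochhammer r k * pochhammer r k / (pochhammer (1 / 2) k * fact k) * x ^ k)"
      using p by (simp add: abs_mult power_abs mult_right_mono divide_right_mono)
    finally show "norm (?f k s) \<le> norm (pochhammer r k * pochhammer r k / (pochhammer (1 / 2) k * fact k) * x ^ k)" .
  qed
  show "\<exists>d>0. cball s0 d \<subseteq> UNIV \<and> uniform_limit (cball s0 d) (\<lambda>n s. \<Sum>k<n. ?f k s) (hyp2F1_complex \<beta> x) sequentially"
    using ul by (intro exI[of _ 1]) (auto simp: hyp2F1_complex_def[abs_def])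
qed auto

definition half_moment_complex :: "nat \<Rightarrow> complex \<Rightarrow> complex" where
  "half_moment_complex m s = (\<Sum>k=1..m. (-1) ^ k * of_nat ((2 * m) choose (m - k)) * of_nat k powr (2 * s))"

lemma half_moment_complex_of_real: "half_moment_complex m (of_real s) = of_real (half_moment m s)"
proof -
  have "complex_of_nat k powr (2 * of_real s) = of_real (real k powr (2 * s))" for k
    using powr_of_real[of "real k" "2 * s"] by simp
  thus ?thesis by (simp add: half_moment_complex_def half_moment_def)
qed

lemma half_moment_complex_has_derivative:
  "(half_moment_complex m has_field_derivative
     (\<Sum>k=1..m. (-1) ^ k * of_nat ((2 * m) choose (m - k)) * (2 * of_real (ln (real k)) * of_nat k powr (2 * s)))) (at s)"
  unfolding half_moment_complex_def[abs_def]
proof (intro DERIV_sum DERIV_cmult)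
  fix k assume "k \<in> {1..m}"
  hence k: "complex_of_nat k \<noteq> 0" "Ln (of_nat k) = of_real (ln (real k))" by (auto simp: Ln_of_nat)
  have "((\<lambda>s. 2 * s) has_field_derivative 2) (at s)" by (auto intro!: derivative_eq_intros)
  from DERIV_chain2[OF has_field_derivative_powr_right[OF k(1)] this]
  show "((\<lambda>s. of_nat k powr (2 * s)) has_field_derivative 2 * of_real (ln (real k)) * of_nat k powr (2 * s)) (at s)"
    unfolding k(2) by (simp add: mult_ac)
qed

lemma half_moment_complex_holomorphic: "half_moment_complex m holomorphic_on A"
  unfolding holomorphic_on_def field_differentiable_def
  using has_field_derivative_at_within[OF half_moment_complex_has_derivative] by blast

text \<open>
  Both sides are holomorphic for \<open>Re s < m\<close> and agree for real \<open>s < 0\<close>. The factors \<open>2 s\<close> and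
  \<open>rGamma (1 - s)\<close> remove the singularities: of \<open>1 / s\<close> at the origin, and of \<open>Gamma (- s)\<close> at the
  non-negative integers.
\<close>
lemma mellin_identity:
  assumes "\<beta> > -1" "\<bar>z\<bar> < 1" "m > 0" "Re s < real m"
  shows "rGamma (1 - s) * (2 * s * mellin (cut_diff m \<beta> z) s + of_real (central_coeff m 0 * bump \<beta> z))
    = - 2 * half_moment_complex m s * of_real (Gamma (1 + \<beta>)) * rGamma (of_real (1 + \<beta>) - s) * hyp2F1_complex \<beta> (z\<^sup>2) s"
    (is "?L s = ?R s")
proof -
  have z2: "\<bar>z\<^sup>2\<bar> < 1" using assms(2) by (simp add: abs_square_less_1)
  let ?H = "{s. Re s < real m}"
  have "?L s - ?R s = 0"
  proof (rule analytic_continuation[of "\<lambda>s. ?L s - ?R s" ?H "of_real ` {..<0}" "-1"])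
    have "mellin (cut_diff m \<beta> z) holomorphic_on ?H"
      using assms by (intro mellin_holomorphic set_integrable_cut_diff) auto
    moreover have "hyp2F1_complex \<beta> (z\<^sup>2) holomorphic_on ?H"
      by (rule holomorphic_on_subset[OF hyp2F1_complex_holomorphic[OF z2] subset_UNIV])
    ultimately show "(\<lambda>s. ?L s - ?R s) holomorphic_on ?H"
      by (intro holomorphic_intros half_moment_complex_holomorphic)
    show "open ?H" by (rule open_halfspace_Re_lt)
    show "connected ?H" by (intro convex_connected convex_halfspace_Re_lt)
    show "of_real ` {..<0} \<subseteq> ?H" by auto
    show "(-1::complex) islimpt of_real ` {..<0}"
      unfolding islimpt_approachable
    proof (intro allI impI)
      fix e :: real assume "e > 0"
      hence "complex_of_real (-1 - e / 2) \<noteq> - 1" "dist (complex_of_real (-1 - e / 2)) (- 1) < e"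
        by (simp_all add: dist_norm norm_divide)
      moreover have "complex_of_real (-1 - e / 2) \<in> complex_of_real ` {..<0}" using \<open>e > 0\<close> by (intro imageI) simp
      ultimately show "\<exists>x'\<in>complex_of_real ` {..<0}. x' \<noteq> - 1 \<and> dist x' (- 1) < e" by blast
    qed
    show "s \<in> ?H" using assms by simp
    fix w :: complex assume "w \<in> of_real ` {..<0}"
    then obtain t where t: "w = of_real t" "t < 0" by auto
    define F where "F = hyp2F1 (t + 1 / 2) (t - \<beta>) (1 / 2) (z\<^sup>2)"
    define I where "I = (LINT y:{0<..}|lborel. cut_diff m \<beta> z y * y powr (-1 - 2 * t))"
    have I: "2 * t * I + central_coeff m 0 * bump \<beta> z = 2 * t * half_moment m t * (Beta (- t) (\<beta> + 1) * F)"
    proof -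
      have "2 * t * (- c / (2 * t) + h * v) + c = 2 * t * h * v" for c h v
        using t(2) by (simp add: field_simps)
      thus ?thesis unfolding I_def cut_diff_mellin_negative[OF assms(1) t(2) assms(2)] F_def[symmetric]
        by (simp only: mult_minus_left)
    qed
    have rG: "rGamma (1 - t) * (t * Gamma (- t)) = - 1"
    proof -
      have "rGamma (- t) = (- t) * rGamma (1 - t)" using rGamma_plus1[of "- t"] by simp
      moreover have "Gamma (- t) > 0" using t by (intro Gamma_real_pos) simp
      hence "rGamma (- t) * Gamma (- t) = 1" by (simp add: rGamma_inverse_Gamma)
      ultimately have "(- t) * rGamma (1 - t) * Gamma (- t) = 1" by (simp only:)
      thus ?thesis by (simp add: mult_ac)
    qed
    have B: "Beta (- t) (\<beta> + 1) = Gamma (- t) * Gamma (\<beta> + 1) * rGamma (1 + \<beta> - t)"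
      by (simp add: Beta_def rGamma_inverse_Gamma divide_inverse algebra_simps)
    have "rGamma (1 - t) * (2 * t * I + central_coeff m 0 * bump \<beta> z)
       = 2 * (rGamma (1 - t) * (t * Gamma (- t))) * half_moment m t * Gamma (\<beta> + 1) * rGamma (1 + \<beta> - t) * F"
      unfolding I B by (simp only: mult_ac)
    also have "\<dots> = - 2 * half_moment m t * Gamma (1 + \<beta>) * rGamma (1 + \<beta> - t) * F"
      unfolding rG by (simp add: add.commute)
    finally have eq: "complex_of_real (rGamma (1 - t) * (2 * t * I + central_coeff m 0 * bump \<beta> z))
      = of_real (- 2 * half_moment m t * Gamma (1 + \<beta>) * rGamma (1 + \<beta> - t) * F)"
      by (rule arg_cong)
    have r1: "rGamma (1 - complex_of_real t) = of_real (rGamma (1 - t))"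
      and r2: "rGamma (complex_of_real (1 + \<beta>) - of_real t) = of_real (rGamma (1 + \<beta> - t))"
      using rGamma_complex_of_real[of "1 - t"] rGamma_complex_of_real[of "1 + \<beta> - t"] by simp_all
    have "?L w = complex_of_real (rGamma (1 - t) * (2 * t * I + central_coeff m 0 * bump \<beta> z))"
      unfolding t(1) mellin_of_real r1 I_def[symmetric] by simp
    moreover have "?R w = of_real (- 2 * half_moment m t * Gamma (1 + \<beta>) * rGamma (1 + \<beta> - t) * F)"
      unfolding t(1) half_moment_complex_of_real r2 hyp2F1_complex_of_real[OF z2] F_def by simp
    ultimately show "?L w - ?R w = 0" using eq by simp
  next
    show "- 1 \<in> ?H" using assms(3) by simp
  qed
  thus ?thesis by (rule right_minus_eq[THEN iffD1])
qed

text \<open>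
  This and the next lemma extract from the one-dimensional normalising constant the number that
  multiplies the hypergeometric function in the Mellin transform.
\<close>
lemma frac_const_1_nonint:
  assumes "s \<notin> \<nat>" "s > 0"
  shows "2 powr (2 * s) * Gamma (1 / 2 + s) / (Gamma (1 / 2) * frac_const 1 m s) = half_moment m s * Gamma (- s)"
proof -
  have "Gamma (1 / 2 + s) > 0" using assms by (intro Gamma_real_pos) simp
  moreover have "4 powr s = 2 powr (2 * s)"
    using powr_powr[of 2 2 s] by simp
  moreover have "Gamma (1 / 2) = pi powr (1 / 2)" by (simp add: Gamma_one_half_real powr_half_sqrt)
  moreover have "pi powr (1 / 2) > 0" "(2::real) powr (2 * s) > 0" by simp_all
  moreover have "P * G / (q * (P * G / (q * g) * inverse S)) = S * g"
    if "P > 0" "G > 0" "q > 0" for P G q g S :: real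
    using that by (cases "S = 0"; cases "g = 0") (simp_all add: field_simps)
  ultimately show ?thesis using assms(1)
    unfolding frac_const_def half_moment_def by (simp add: add.commute)
qed

text \<open>
  The last sum is the derivative of \<open>half_moment m\<close> at \<open>j\<close>. The term \<open>k = 1\<close> may be included in it
  because \<open>ln 1 = 0\<close>.
\<close>
lemma frac_const_1_int:
  assumes "j \<ge> 1" "s = real j"
  shows "2 powr (2 * s) * Gamma (1 / 2 + s) / (Gamma (1 / 2) * frac_const 1 m s)
    = (-1) ^ (j + 1) / fact j * (\<Sum>k=1..m. (-1) ^ k * real ((2 * m) choose (m - k)) * (2 * ln (real k) * real k powr (2 * s)))"
    (is "_ = _ * ?D")
proof -
  define L where "L = (\<Sum>k=2..m. (-1) powi (int k - \<lfloor>s\<rfloor> + 1) * real ((2 * m) choose (m - k)) *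
                   real k powr (2 * s) * ln (real k))"
  have "2 * ((-1) ^ (j + 1) * L) = (\<Sum>k=2..m. (-1) ^ k * real ((2 * m) choose (m - k)) * (2 * ln (real k) * real k powr (2 * s)))"
    unfolding L_def sum_distrib_left
  proof (intro sum.cong refl)
    fix k
    have "int k - int j + 1 = int (k + 1) - int j" by simp
    hence "(-1::real) powi (int k - int j + 1) = (-1) powi int (k + 1) / (-1) powi int j"
      by (simp only:) (subst power_int_diff, auto)
    hence "(-1::real) powi (int k - int j + 1) = (-1) ^ (k + 1) / (-1) ^ j"
      by (simp only: power_int_of_nat)
    hence "(-1::real) powi (int k - int j + 1) = (-1) ^ k * (-1) ^ (j + 1)"
      by (cases "even j") simp_all
    thus "2 * ((-1) ^ (j + 1) * ((-1) powi (int k - \<lfloor>s\<rfloor> + 1) * real (2 * m choose (m - k)) * real k powr (2 * s) * ln (real k)))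
      = (-1) ^ k * real (2 * m choose (m - k)) * (2 * ln (real k) * real k powr (2 * s))"
      using assms by (simp add: mult_ac flip: power_mult_distrib)
  qed
  also have "\<dots> = ?D"
  proof (rule sum.mono_neutral_left)
    show "\<forall>k\<in>{1..m} - {2..m}. (-1) ^ k * real (2 * m choose (m - k)) * (2 * ln (real k) * real k powr (2 * s)) = 0"
    proof
      fix k assume "k \<in> {1..m} - {2..m}"
      hence "k = 1" by auto
      thus "(-1) ^ k * real (2 * m choose (m - k)) * (2 * ln (real k) * real k powr (2 * s)) = 0" by simp
    qed
  qed auto
  finally have L2: "2 * ((-1) ^ (j + 1) * L) = ?D" .
  have "L = (-1) ^ (j + 1) * D / 2" if "2 * ((-1) ^ (j + 1) * L) = D" for D
    using that by (cases "even j") auto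
  from this[OF L2] have L: "L = (-1) ^ (j + 1) * ?D / 2" .
  have "Gamma (1 / 2 + s) > 0" using assms by (intro Gamma_real_pos) simp
  moreover have "4 powr s = 2 powr (2 * s)"
    using powr_powr[of 2 2 s] by simp
  moreover have "Gamma (1 / 2) = pi powr (1 / 2)" by (simp add: Gamma_one_half_real powr_half_sqrt)
  moreover have "pi powr (1 / 2) > 0" "(2::real) powr (2 * s) > 0" by simp_all
  moreover have "s \<in> \<nat>" "nat \<lfloor>s\<rfloor> = j" using assms by auto
  moreover have "P * G / (q * (P * G * f / (2 * q) * inverse L)) = 2 * L / f"
    if "P > 0" "G > 0" "q > 0" "f > 0" for P G q f L :: real
    using that by (cases "L = 0") (simp_all add: field_simps)
  ultimately have "2 powr (2 * s) * Gamma (1 / 2 + s) / (Gamma (1 / 2) * frac_const 1 m s) = 2 * L / fact j"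
    unfolding frac_const_def L_def[symmetric] by simp
  thus ?thesis unfolding L by simp
qed

text \<open>
  For non-integer \<open>s\<close> divide the continued identity by \<open>rGamma (1 - s)\<close>. If \<open>s = j\<close> is an integer, both
  \<open>rGamma (1 - s)\<close> and \<open>half_moment m s\<close> have a zero at \<open>j\<close>, and comparing the derivatives of the two sides
  replaces them by \<open>(-1)\<^sup>j (j - 1)!\<close> and by the logarithmic sum.
\<close>
lemma central_diff_mellin_value:
  assumes "\<beta> > -1" "0 < s" "s < real m" "\<bar>z\<bar> < 1"
  shows "(LINT y:{0<..}|lborel. central_diff m \<beta> z y * y powr (-1 - 2 * s))
     = 2 powr (2 * s) * Gamma (1 / 2 + s) / (Gamma (1 / 2) * frac_const 1 m s)
       * (Gamma (1 + \<beta>) * rGamma (1 + \<beta> - s) * hyp2F1 (s + 1 / 2) (s - \<beta>) (1 / 2) (z\<^sup>2))"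
proof -
  have m: "m > 0" using assms by (intro gr0I) auto
  have z2: "\<bar>z\<^sup>2\<bar> < 1" using assms(4) by (simp add: abs_square_less_1)
  define H where "H = (LINT y:{0<..}|lborel. central_diff m \<beta> z y * y powr (-1 - 2 * s))"
  define I where "I = (LINT y:{0<..}|lborel. cut_diff m \<beta> z y * y powr (-1 - 2 * s))"
  define T where "T = Gamma (1 + \<beta>) * rGamma (1 + \<beta> - s) * hyp2F1 (s + 1 / 2) (s - \<beta>) (1 / 2) (z\<^sup>2)"
  define Q where "Q = (\<lambda>w. 2 * w * mellin (cut_diff m \<beta> z) w + of_real (central_coeff m 0 * bump \<beta> z))"
  define K where "K = (\<lambda>w. of_real (Gamma (1 + \<beta>)) * rGamma (of_real (1 + \<beta>) - w) * hyp2F1_complex \<beta> (z\<^sup>2) w)"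
  have ident: "rGamma (1 - w) * Q w = - 2 * half_moment_complex m w * K w" if "Re w < real m" for w
    using mellin_identity[OF assms(1,4) m that] by (simp add: Q_def K_def mult.assoc)
  have Qs: "Q (of_real s) = of_real (2 * s * H)"
  proof -
    have "H = I + central_coeff m 0 * bump \<beta> z / (2 * s)"
      unfolding H_def I_def by (rule central_diff_mellin(2)[OF assms])
    hence "2 * s * H = 2 * s * I + central_coeff m 0 * bump \<beta> z" using assms(2) by (simp add: field_simps)
    thus ?thesis by (simp add: Q_def mellin_of_real I_def)
  qed
  have Ks: "K (of_real s) = of_real T"
    using rGamma_complex_of_real[of "1 + \<beta> - s"]
    by (simp add: K_def T_def hyp2F1_complex_of_real[OF z2])
  have "H = 2 powr (2 * s) * Gamma (1 / 2 + s) / (Gamma (1 / 2) * frac_const 1 m s) * T"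
  proof (cases "s \<in> \<nat>")
    case False
    have "rGamma (1 - complex_of_real s) = of_real (rGamma (1 - s))"
      using rGamma_complex_of_real[of "1 - s"] by simp
    hence "of_real (rGamma (1 - s)) * of_real (2 * s * H) = - 2 * of_real (half_moment m s) * complex_of_real T"
      using ident[of "of_real s"] assms(3) by (simp only: Qs Ks half_moment_complex_of_real Re_complex_of_real)
    hence "complex_of_real (rGamma (1 - s) * (2 * s * H)) = of_real (- 2 * half_moment m s * T)"
      by (simp only: of_real_mult of_real_minus of_real_numeral)
    hence eq: "rGamma (1 - s) * (2 * s * H) = - 2 * half_moment m s * T"
      by (subst (asm) of_real_eq_iff)
    have "- s \<notin> \<int>\<^sub>\<le>\<^sub>0"
    proof
      assume "- s \<in> \<int>\<^sub>\<le>\<^sub>0"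
      then obtain n where "- s = - real n" by (elim nonpos_Ints_cases')
      hence "s = real n" by simp
      thus False using False by simp
    qed
    hence G: "rGamma (- s) \<noteq> 0" by (simp only: rGamma_eq_zero_iff not_False_eq_True)
    have r: "rGamma (- s) = - s * rGamma (1 - s)" using rGamma_plus1[of "- s"] by simp
    have "Gamma (- s) * rGamma (- s) = 1" using G by (simp add: rGamma_inverse_Gamma)
    hence "H = Gamma (- s) * (- s * rGamma (1 - s)) * H" unfolding r[symmetric] by simp
    also have "\<dots> = Gamma (- s) * (rGamma (1 - s) * (2 * s * H)) * (- 1 / 2)" by simp
    also have "\<dots> = half_moment m s * Gamma (- s) * T" unfolding eq by simp
    finally show ?thesis unfolding frac_const_1_nonint[OF False assms(2)] .
  next
    case True
    then obtain j where j: "s = real j" by (auto elim: Nats_cases)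
    have j1: "j \<ge> 1" "j < m" using assms j by auto
    define D where "D = (\<Sum>k=1..m. (-1) ^ k * real ((2 * m) choose (m - k)) * (2 * ln (real k) * real k powr (2 * s)))"
    have dS: "(half_moment_complex m has_field_derivative of_real D) (at (of_real s))"
    proof -
      have "complex_of_nat k powr (2 * of_real s) = of_real (real k powr (2 * s))" for k
        using powr_of_real[of "real k" "2 * s"] by simp
      thus ?thesis using half_moment_complex_has_derivative[of m "of_real s"] by (simp add: D_def)
    qed
    have S0: "half_moment_complex m (of_real s) = 0"
    proof -
      have "half_moment m s = 0" using half_moment_nat_zero[OF j1] j by simp
      thus ?thesis by (simp only: half_moment_complex_of_real of_real_0)
    qed
    have sj: "1 - complex_of_real s = - of_nat (j - 1)" using j j1 by (simp add: of_nat_diff)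
    have r0: "rGamma (1 - complex_of_real s) = 0" unfolding sj by (simp add: rGamma_eq_zero_iff)
    have dr: "((\<lambda>w. rGamma (1 - w)) has_field_derivative (-1) ^ j * fact (j - 1)) (at (complex_of_real s))"
    proof -
      have "(rGamma has_field_derivative (-1) ^ (j - 1) * fact (j - 1)) (at (1 - complex_of_real s))"
        unfolding sj by (rule has_field_derivative_rGamma_nonpos_int)
      moreover have "((\<lambda>w. 1 - w) has_field_derivative - 1) (at (complex_of_real s))"
        by (auto intro!: derivative_eq_intros)
      ultimately have "((\<lambda>w. rGamma (1 - w)) has_field_derivative (-1) ^ (j - 1) * fact (j - 1) * (- 1)) (at (complex_of_real s))"
        by (rule DERIV_chain2)
      moreover have "(-1) ^ (j - 1) * fact (j - 1) * (- 1) = ((-1) ^ j * fact (j - 1) :: complex)"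
        using j1 by (cases j) auto
      ultimately show ?thesis by simp
    qed
    have hs: "Re (complex_of_real s) < real m" using assms by simp
    obtain Q' where dQ: "(Q has_field_derivative Q') (at (of_real s))"
    proof -
      have "\<exists>M'. (mellin (cut_diff m \<beta> z) has_field_derivative M') (at (of_real s))"
        by (rule mellin_has_derivative[OF borel_measurable_cut_diff _ hs], rule set_integrable_cut_diff[OF assms(1,4) m])
      then obtain M' where "(mellin (cut_diff m \<beta> z) has_field_derivative M') (at (of_real s))" by (elim exE)
      moreover have "((\<lambda>w. 2 * w) has_field_derivative 2) (at (complex_of_real s))"
        by (auto intro!: derivative_eq_intros)
      ultimately have "(Q has_field_derivative (2 * mellin (cut_diff m \<beta> z) (of_real s) + M' * (2 * of_real s) + 0)) (at (of_real s))"
        unfolding Q_def by (intro DERIV_add DERIV_mult DERIV_const)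
      thus ?thesis by (rule that)
    qed
    obtain K' where dK: "(K has_field_derivative K') (at (of_real s))"
    proof -
      have "K holomorphic_on UNIV" unfolding K_def
        by (intro holomorphic_intros hyp2F1_complex_holomorphic z2)
      hence "K field_differentiable at (of_real s)"
        by (rule holomorphic_on_imp_differentiable_at) auto
      then obtain K' where "(K has_field_derivative K') (at (of_real s))"
        unfolding field_differentiable_def by (rule exE)
      thus ?thesis by (rule that)
    qed
    have "((\<lambda>w. rGamma (1 - w) * Q w) has_field_derivative
         (-1) ^ j * fact (j - 1) * Q (of_real s) + Q' * rGamma (1 - of_real s)) (at (of_real s))"
      by (rule DERIV_mult[OF dr dQ])
    hence "((\<lambda>w. - 2 * half_moment_complex m w * K w) has_field_derivative
         (-1) ^ j * fact (j - 1) * Q (of_real s) + Q' * rGamma (1 - of_real s)) (at (of_real s))"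
    proof (rule has_field_derivative_transform_within_open)
      show "open {w. Re w < real m}" by (rule open_halfspace_Re_lt)
    qed (use hs ident in auto)
    note dL = this
    have dR: "((\<lambda>w. - 2 * half_moment_complex m w * K w) has_field_derivative
         (- 2 * of_real D) * K (of_real s) + K' * (- 2 * half_moment_complex m (of_real s))) (at (of_real s))"
      by (intro DERIV_mult DERIV_cmult dS dK)
    have "(-1) ^ j * fact (j - 1) * Q (of_real s) = (- 2 * of_real D) * K (of_real s)"
      using DERIV_unique[OF dL dR] by (simp only: r0 S0 mult_zero_right add_0_right)
    hence "complex_of_real ((-1) ^ j * fact (j - 1) * (2 * s * H)) = of_real (- 2 * D * T)"
      unfolding Qs Ks by simp
    hence "(-1) ^ j * fact (j - 1) * (2 * s * H) = - 2 * D * T" by (subst (asm) of_real_eq_iff)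
    moreover have "fact j = real j * fact (j - 1)" using j1 by (intro fact_reduce) auto
    ultimately have "(-1) ^ j * (fact j * H) = - D * T" unfolding j by (simp add: mult_ac)
    hence "(-1) ^ j * ((-1) ^ j * (fact j * H)) = (-1) ^ j * (- D * T)" by (rule arg_cong)
    moreover have "(-1) ^ j * (-1) ^ j = (1::real)" by (simp flip: power_mult_distrib)
    ultimately have "fact j * H = (-1) ^ (j + 1) * D * T"
      by (simp add: mult.assoc[symmetric])
    hence "H = (-1) ^ (j + 1) / fact j * D * T" by (simp add: field_simps)
    thus ?thesis unfolding frac_const_1_int[OF j1(1) j] D_def .
  qed
  thus ?thesis unfolding H_def T_def .
qed

section \<open>The norm of the ellipsoid\<close>

lemma diag_matrix_mult_nth: "(diag_matrix a *v x) $ i = a $ i * x $ i"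
proof -
  have "(diag_matrix a *v x) $ i = (\<Sum>j\<in>UNIV. (if i = j then a $ i else 0) * x $ j)"
    by (simp add: matrix_vector_mult_def diag_matrix_def)
  also have "\<dots> = (\<Sum>j\<in>UNIV. if i = j then a $ i * x $ j else 0)"
    by (intro sum.cong) auto
  finally show ?thesis by simp
qed

lemma inner_a_eq_sum: "inner_a a x y = (\<Sum>i\<in>UNIV. a $ i * x $ i * y $ i)"
  by (simp add: inner_a_def inner_vec_def diag_matrix_mult_nth)

lemma norm_a_square:
  assumes "\<And>i. a $ i > 0"
  shows "(norm_a a x)\<^sup>2 = (\<Sum>i\<in>UNIV. a $ i * (x $ i)\<^sup>2)"
proof -
  have "(\<Sum>i\<in>UNIV. a $ i * x $ i * x $ i) \<ge> 0"
    using assms by (intro sum_nonneg) (simp add: less_imp_le mult.assoc)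
  thus ?thesis by (simp add: norm_a_def inner_a_eq_sum power2_eq_square mult.assoc)
qed

lemma norm_a_nonneg: "(\<And>i. a $ i > 0) \<Longrightarrow> norm_a a x \<ge> 0"
  unfolding norm_a_def inner_a_eq_sum
  by (intro real_sqrt_ge_zero sum_nonneg) (simp add: less_imp_le mult.assoc)

lemma norm_a_scaleR: "norm_a a (r *\<^sub>R x) = \<bar>r\<bar> * norm_a a x"
proof -
  have "inner_a a (r *\<^sub>R x) (r *\<^sub>R x) = r\<^sup>2 * inner_a a x x"
    by (simp add: inner_a_eq_sum sum_distrib_left power2_eq_square mult_ac)
  thus ?thesis by (simp add: norm_a_def real_sqrt_mult)
qed

lemma norm_a_eq_0_iff:
  assumes "\<And>i. a $ i > 0"
  shows "norm_a a x = 0 \<longleftrightarrow> x = 0"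
proof -
  have "norm_a a x = 0 \<longleftrightarrow> (norm_a a x)\<^sup>2 = 0" by simp
  also have "\<dots> \<longleftrightarrow> (\<forall>i. a $ i * (x $ i)\<^sup>2 = 0)"
    unfolding norm_a_square[OF assms] using assms
    by (subst sum_nonneg_eq_0_iff) (auto simp: less_imp_le)
  also have "\<dots> \<longleftrightarrow> x = 0" using assms by (auto simp: vec_eq_iff less_le)
  finally show ?thesis .
qed

lemma continuous_on_norm_a: "continuous_on A (norm_a a)"
  unfolding norm_a_def inner_a_def by (intro continuous_intros)

lemma borel_measurable_norm_a [measurable]: "norm_a a \<in> borel_measurable borel"
  by (intro borel_measurable_continuous_onI continuous_on_norm_a)

lemma frontier_ellipsoid:
  assumes a: "\<And>i. a $ i > 0"
  shows "frontier (ellipsoid a) = {x. norm_a a x = 1}"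
proof (intro equalityI subsetI)
  fix x assume "x \<in> frontier (ellipsoid a)"
  have op: "open (ellipsoid a)" unfolding ellipsoid_def
    by (intro open_Collect_less continuous_on_norm_a continuous_intros)
  have "closed {x. norm_a a x \<le> 1}"
    by (intro closed_Collect_le continuous_on_norm_a continuous_intros)
  hence "closure (ellipsoid a) \<subseteq> {x. norm_a a x \<le> 1}"
    by (intro closure_minimal) (auto simp: ellipsoid_def)
  thus "x \<in> {x. norm_a a x = 1}"
    using \<open>x \<in> frontier (ellipsoid a)\<close> op by (auto simp: frontier_def interior_open ellipsoid_def)
next
  fix x assume x: "x \<in> {x. norm_a a x = 1}"
  have "x \<in> closure (ellipsoid a)"
    unfolding closure_approachable
  proof (intro allI impI)
    fix e :: real assume "e > 0"
    define r where "r = max 0 (1 - e / (2 * (norm x + 1)))"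
    have r: "0 \<le> r" "r < 1" using \<open>e > 0\<close> by (auto simp: r_def add_nonneg_pos)
    have "1 - r \<le> e / (2 * (norm x + 1))" by (simp add: r_def)
    hence "(1 - r) * norm x \<le> e / (2 * (norm x + 1)) * norm x" by (intro mult_right_mono) auto
    also have "\<dots> < e"
    proof -
      have "norm x < 2 * (norm x + 1)" using norm_ge_zero[of x] by (smt (verit))
      hence "e * norm x < e * (2 * (norm x + 1))" using \<open>e > 0\<close> by (intro mult_strict_left_mono)
      moreover have "0 < 2 * (norm x + 1)" using norm_ge_zero[of x] by (smt (verit))
      ultimately show ?thesis by (simp only: times_divide_eq_left pos_divide_less_eq)
    qed
    also have "(1 - r) * norm x = norm ((r - 1) *\<^sub>R x)" using r by simp
    also have "\<dots> = dist (r *\<^sub>R x) x" by (simp add: dist_norm scaleR_left_diff_distrib)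
    finally have "dist (r *\<^sub>R x) x < e" .
    moreover have "r *\<^sub>R x \<in> ellipsoid a" using x r by (simp add: ellipsoid_def norm_a_scaleR)
    ultimately show "\<exists>y\<in>ellipsoid a. dist y x < e" by blast
  qed
  moreover have "x \<notin> interior (ellipsoid a)" using x interior_subset by (force simp: ellipsoid_def)
  ultimately show "x \<in> frontier (ellipsoid a)" by (simp add: frontier_def)
qed

lemma norm_diag_matrix_pos:
  assumes "\<And>i. a $ i > 0" "x \<noteq> 0"
  shows "norm (diag_matrix a *v x) > 0"
proof -
  obtain i where i: "x $ i \<noteq> 0" using assms(2) by (auto simp: vec_eq_iff)
  hence "(diag_matrix a *v x) $ i \<noteq> 0" using assms(1)[of i] by (simp add: diag_matrix_mult_nth)
  hence "diag_matrix a *v x \<noteq> 0" by (metis zero_index)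
  thus ?thesis by simp
qed

section \<open>Slicing by a coordinate hyperplane\<close>

lemma Basis_vec_real: "(Basis :: (real^'n) set) = range (\<lambda>i. axis i 1)"
  by (auto simp: Basis_vec_def)

lemma borel_measurable_vec_lambda_nth:
  fixes f :: "'a \<Rightarrow> 'n::finite \<Rightarrow> real"
  assumes "\<And>i. (\<lambda>x. f x i) \<in> borel_measurable M"
  shows "(\<lambda>x. \<chi> i. f x i) \<in> borel_measurable M"
  by (subst borel_measurable_euclidean_space) (auto simp: Basis_vec_real inner_axis assms)

lemma borel_measurable_vec_nth_component [measurable]: "(\<lambda>x::real^'n. x $ i) \<in> borel_measurable borel"
  by (intro borel_measurable_continuous_onI continuous_intros)

lemma lborel_vec_eq_distr:
  "(lborel :: (real^'n) measure) = distr (\<Pi>\<^sub>M i\<in>UNIV. (lborel :: real measure)) borel (\<lambda>f. \<chi> i. f i)"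
proof (rule lborel_eqI)
  interpret product_sigma_finite "\<lambda>_::'n. lborel :: real measure" ..
  have m: "(\<lambda>f. \<chi> i. f i) \<in> measurable (\<Pi>\<^sub>M i\<in>(UNIV::'n set). (lborel :: real measure)) borel"
    by (intro borel_measurable_vec_lambda_nth) simp
  fix l u :: "real^'n" assume le: "\<And>b. b \<in> Basis \<Longrightarrow> l \<bullet> b \<le> u \<bullet> b"
  have le': "l $ i \<le> u $ i" for i using le[of "axis i 1"] by (simp add: inner_axis)
  have "emeasure (distr (\<Pi>\<^sub>M i\<in>UNIV. (lborel :: real measure)) borel (\<lambda>f. \<chi> i. f i)) (box l u)
    = emeasure (\<Pi>\<^sub>M i\<in>(UNIV::'n set). (lborel :: real measure)) (Pi\<^sub>E UNIV (\<lambda>i. {l $ i<..<u $ i}))"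
    using m by (subst emeasure_distr) (auto simp: space_PiM mem_box_cart PiE_iff intro!: arg_cong2[of _ _ _ _ emeasure])
  also have "\<dots> = (\<Prod>i\<in>UNIV. emeasure lborel {l $ i<..<u $ i})"
    by (intro emeasure_PiM) auto
  also have "\<dots> = (\<Prod>i\<in>UNIV. ennreal (u $ i - l $ i))" by (simp add: le')
  also have "\<dots> = ennreal (\<Prod>i\<in>UNIV. u $ i - l $ i)" by (intro prod_ennreal) (simp add: le')
  also have "(\<Prod>i\<in>UNIV. u $ i - l $ i) = (\<Prod>b\<in>Basis. (u - l) \<bullet> b)"
    unfolding Basis_vec_real by (subst prod.reindex) (auto simp: inner_axis inj_on_def axis_eq_axis)
  finally show "emeasure (distr (\<Pi>\<^sub>M i\<in>UNIV. (lborel :: real measure)) borel (\<lambda>f. \<chi> i. f i)) (box l u) = (\<Prod>b\<in>Basis. (u - l) \<bullet> b)" .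
qed simp

lemma hyperplane_embed_measurable [measurable]:
  "(\<lambda>f. \<chi> i. if i = k then 0 else f i) \<in> borel_measurable (\<Pi>\<^sub>M i\<in>UNIV - {k}. (lborel :: real measure))"
proof (rule borel_measurable_vec_lambda_nth)
  fix i show "(\<lambda>f. if i = k then 0 else f i) \<in> borel_measurable (\<Pi>\<^sub>M i\<in>UNIV - {k}. (lborel :: real measure))"
    by (cases "i = k") auto
qed

lemma sets_hyperplane_lborel [simp, measurable_cong]: "sets (hyperplane_lborel k) = sets borel"
  by (simp add: hyperplane_lborel_def)

lemma nn_integral_hyperplane:
  assumes "f \<in> borel_measurable borel"
  shows "(\<integral>\<^sup>+z. f z \<partial>hyperplane_lborel k)
    = (\<integral>\<^sup>+w. f (\<chi> i. if i = k then 0 else w i) \<partial>(\<Pi>\<^sub>M i\<in>UNIV - {k}. (lborel :: real measure)))"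
  unfolding hyperplane_lborel_def using assms by (subst nn_integral_distr) auto

lemma AE_hyperplane: "AE z in hyperplane_lborel k. z $ k = 0"
  unfolding hyperplane_lborel_def by (subst AE_distr_iff) auto

lemma nn_integral_hyperplane_cong:
  assumes "\<And>z. z $ k = 0 \<Longrightarrow> f z = g z"
  shows "(\<integral>\<^sup>+z. f z \<partial>hyperplane_lborel k) = (\<integral>\<^sup>+z. g z \<partial>hyperplane_lborel k)"
  using AE_hyperplane[of k] by (intro nn_integral_cong_AE) (auto elim!: eventually_mono simp: assms)

lemma nn_integral_lborel_hyperplane:
  fixes f :: "real^'n \<Rightarrow> ennreal"
  assumes [measurable]: "f \<in> borel_measurable borel"
  shows "(\<integral>\<^sup>+x. f x \<partial>lborel) = (\<integral>\<^sup>+z. (\<integral>\<^sup>+t. f (z + t *\<^sub>R axis k 1) \<partial>lborel) \<partial>hyperplane_lborel k)"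
proof -
  interpret product_sigma_finite "\<lambda>_::'n. lborel :: real measure" ..
  have m: "(\<lambda>f. \<chi> i. f i) \<in> measurable (\<Pi>\<^sub>M i\<in>(UNIV::'n set). (lborel :: real measure)) borel"
    by (intro borel_measurable_vec_lambda_nth) simp
  have U: "insert k (UNIV - {k}) = (UNIV :: 'n set)" by auto
  have "(\<integral>\<^sup>+x. f x \<partial>lborel) = (\<integral>\<^sup>+w. f (\<chi> i. w i) \<partial>(\<Pi>\<^sub>M i\<in>UNIV. (lborel :: real measure)))"
    by (subst lborel_vec_eq_distr, subst nn_integral_distr[OF m]) auto
  also have "\<dots> = (\<integral>\<^sup>+w. f (\<chi> i. w i) \<partial>(\<Pi>\<^sub>M i\<in>insert k (UNIV - {k}). (lborel :: real measure)))"
    unfolding U ..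
  also have "\<dots> = (\<integral>\<^sup>+w. (\<integral>\<^sup>+t. f (\<chi> i. (w(k := t)) i) \<partial>lborel) \<partial>(\<Pi>\<^sub>M i\<in>UNIV - {k}. (lborel :: real measure)))"
    using measurable_compose[OF m assms] by (intro product_nn_integral_insert) (auto simp: U)
  also have "(\<lambda>w t. f (\<chi> i. (w(k := t)) i)) = (\<lambda>w t. f ((\<chi> i. if i = k then 0 else w i) + t *\<^sub>R axis k 1))"
    by (intro ext arg_cong[of _ _ f]) (auto simp: vec_eq_iff axis_def)
  also have "(\<integral>\<^sup>+w. (\<integral>\<^sup>+t. f ((\<chi> i. if i = k then 0 else w i) + t *\<^sub>R axis k 1) \<partial>lborel) \<partial>(\<Pi>\<^sub>M i\<in>UNIV - {k}. (lborel :: real measure)))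
     = (\<integral>\<^sup>+z. (\<integral>\<^sup>+t. f (z + t *\<^sub>R axis k 1) \<partial>lborel) \<partial>hyperplane_lborel k)"
    by (rule nn_integral_hyperplane[symmetric]) measurable
  finally show ?thesis .
qed

text \<open>
  \<open>hyperplane_lborel\<close> is the image of a product of finitely many copies of Lebesgue measure, hence
  sigma-finite before embedding; Fubini's theorem is applied there.
\<close>
lemma nn_integral_hyperplane_swap:
  fixes F :: "real^'n \<Rightarrow> real \<Rightarrow> ennreal"
  assumes [measurable]: "(\<lambda>(z, r). F z r) \<in> borel_measurable (borel \<Otimes>\<^sub>M borel)"
  shows "(\<integral>\<^sup>+z. (\<integral>\<^sup>+r. F z r \<partial>lborel) \<partial>hyperplane_lborel k)
     = (\<integral>\<^sup>+r. (\<integral>\<^sup>+z. F z r \<partial>hyperplane_lborel k) \<partial>lborel)"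
proof -
  interpret product_sigma_finite "\<lambda>_::'n. lborel :: real measure" ..
  interpret P: sigma_finite_measure "\<Pi>\<^sub>M i\<in>UNIV - {k}. (lborel :: real measure)"
    by (rule sigma_finite) simp
  interpret pair_sigma_finite "\<Pi>\<^sub>M i\<in>UNIV - {k}. (lborel :: real measure)" "lborel :: real measure" ..
  have "(\<integral>\<^sup>+z. (\<integral>\<^sup>+r. F z r \<partial>lborel) \<partial>hyperplane_lborel k)
     = (\<integral>\<^sup>+w. (\<integral>\<^sup>+r. F (\<chi> i. if i = k then 0 else w i) r \<partial>lborel) \<partial>(\<Pi>\<^sub>M i\<in>UNIV - {k}. (lborel :: real measure)))"
    by (rule nn_integral_hyperplane) measurable
  also have "\<dots> = (\<integral>\<^sup>+r. (\<integral>\<^sup>+w. F (\<chi> i. if i = k then 0 else w i) r \<partial>(\<Pi>\<^sub>M i\<in>UNIV - {k}. (lborel :: real measure))) \<partial>lborel)"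
    by (rule Fubini'[symmetric]) measurable
  also have "\<dots> = (\<integral>\<^sup>+r. (\<integral>\<^sup>+z. F z r \<partial>hyperplane_lborel k) \<partial>lborel)"
    by (intro nn_integral_cong nn_integral_hyperplane[symmetric]) measurable
  finally show ?thesis .
qed

lemma nn_integral_lborel_scaleR:
  fixes f :: "real^'n \<Rightarrow> ennreal"
  assumes [measurable]: "f \<in> borel_measurable borel" and "r > 0"
  shows "(\<integral>\<^sup>+x. f x \<partial>lborel) = ennreal (r ^ CARD('n)) * (\<integral>\<^sup>+x. f (r *\<^sub>R x) \<partial>lborel)"
  using assms(2) by (subst lborel_affine[of r 0])
    (auto simp: nn_integral_density nn_integral_distr nn_integral_cmult)

text \<open>
  Thicken the hyperplane to a slab of width \<open>1\<close> and use the scaling of Lebesgue measure on the whole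
  space; the width accounts for one factor \<open>r\<close>. The exponent \<open>CARD('n) - 1\<close> is \<open>0\<close> in dimension one.
\<close>
lemma nn_integral_hyperplane_scaleR:
  fixes f :: "real^'n \<Rightarrow> ennreal"
  assumes [measurable]: "f \<in> borel_measurable borel" and "r > 0"
  shows "(\<integral>\<^sup>+z. f z \<partial>hyperplane_lborel k)
    = ennreal (r ^ (CARD('n) - 1)) * (\<integral>\<^sup>+z. f (r *\<^sub>R z) \<partial>hyperplane_lborel k)"
proof -
  define F where "F = (\<lambda>x::real^'n. f (x - (x $ k) *\<^sub>R axis k 1) * indicator {0<..<1} (x $ k))"
  have [measurable]: "F \<in> borel_measurable borel" unfolding F_def by measurable
  have scal: "(\<integral>\<^sup>+x. F (c *\<^sub>R x) \<partial>lborel) = ennreal (1 / c) * (\<integral>\<^sup>+z. f (c *\<^sub>R z) \<partial>hyperplane_lborel k)" if "c > 0" for c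
  proof -
    have "(\<integral>\<^sup>+x. F (c *\<^sub>R x) \<partial>lborel) = (\<integral>\<^sup>+z. (\<integral>\<^sup>+t. F (c *\<^sub>R (z + t *\<^sub>R axis k 1)) \<partial>lborel) \<partial>hyperplane_lborel k)"
      by (rule nn_integral_lborel_hyperplane) measurable
    also have "\<dots> = (\<integral>\<^sup>+z. f (c *\<^sub>R z) * ennreal (1 / c) \<partial>hyperplane_lborel k)"
    proof (rule nn_integral_hyperplane_cong)
      fix z :: "real^'n" assume z: "z $ k = 0"
      have "F (c *\<^sub>R (z + t *\<^sub>R axis k 1)) = f (c *\<^sub>R z) * indicator {0<..<1 / c} t" for t
        using z that by (auto simp: F_def scaleR_add_right indicator_def field_simps zero_less_mult_iff)
      hence "(\<integral>\<^sup>+t. F (c *\<^sub>R (z + t *\<^sub>R axis k 1)) \<partial>lborel) = f (c *\<^sub>R z) * (\<integral>\<^sup>+t. indicator {0<..<1 / c} t \<partial>lborel)"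
        by (simp add: nn_integral_cmult)
      also have "(\<integral>\<^sup>+t. indicator {0<..<1 / c} t \<partial>lborel) = ennreal (1 / c)"
        using that by simp
      finally show "(\<integral>\<^sup>+t. F (c *\<^sub>R (z + t *\<^sub>R axis k 1)) \<partial>lborel) = f (c *\<^sub>R z) * ennreal (1 / c)" .
    qed
    also have "\<dots> = ennreal (1 / c) * (\<integral>\<^sup>+z. f (c *\<^sub>R z) \<partial>hyperplane_lborel k)"
      by (subst nn_integral_multc) (auto simp: mult.commute)
    finally show ?thesis .
  qed
  have "(\<integral>\<^sup>+z. f z \<partial>hyperplane_lborel k) = (\<integral>\<^sup>+x. F x \<partial>lborel)" using scal[of 1] by simp
  also have "\<dots> = ennreal (r ^ CARD('n)) * (\<integral>\<^sup>+x. F (r *\<^sub>R x) \<partial>lborel)"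
    using assms(2) by (intro nn_integral_lborel_scaleR) auto
  also have "\<dots> = (ennreal (r ^ CARD('n)) * ennreal (1 / r)) * (\<integral>\<^sup>+z. f (r *\<^sub>R z) \<partial>hyperplane_lborel k)"
    unfolding scal[OF assms(2)] by (simp add: mult.assoc)
  also have "ennreal (r ^ CARD('n)) * ennreal (1 / r) = ennreal (r ^ (CARD('n) - 1))"
    using assms(2) zero_less_card_finite[where 'a = 'n]
    by (subst ennreal_mult[symmetric]) (auto simp: power_diff)
  finally show ?thesis .
qed

section \<open>The surface measure of the ellipsoid\<close>

text \<open>
  The change of variables formula for absolute integrals, restated for non-negative functions. Finiteness
  on the image side makes the function integrable there, which the formula transports to \<open>T\<close>.
\<close>
lemma nn_integral_image_real:
  fixes f g h :: "real \<Rightarrow> real"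
  assumes [measurable]: "T \<in> sets borel" "g ` T \<in> sets borel" "f \<in> borel_measurable borel"
    and der: "\<And>x. x \<in> T \<Longrightarrow> (g has_field_derivative h x) (at x within T)"
    and inj: "inj_on g T"
    and nn: "\<And>x. 0 \<le> f x"
    and fin: "(\<integral>\<^sup>+x\<in>g ` T. ennreal (f x) \<partial>lborel) < \<infinity>"
  shows "(\<integral>\<^sup>+x\<in>g ` T. ennreal (f x) \<partial>lborel) = (\<integral>\<^sup>+x\<in>T. ennreal (\<bar>h x\<bar> * f (g x)) \<partial>lborel)"
proof -
  have "set_integrable lborel (g ` T) f"
    unfolding set_integrable_def
  proof (rule integrableI_nonneg)
    have "(\<integral>\<^sup>+x. ennreal (indicator (g ` T) x *\<^sub>R f x) \<partial>lborel) = (\<integral>\<^sup>+x\<in>g ` T. ennreal (f x) \<partial>lborel)"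
      by (intro nn_integral_cong) (auto simp: indicator_def)
    thus "(\<integral>\<^sup>+x. ennreal (indicator (g ` T) x *\<^sub>R f x) \<partial>lborel) < \<infinity>" using fin by simp
  qed (auto simp: nn)
  hence f: "f absolutely_integrable_on g ` T"
    unfolding set_integrable_def by (subst integrable_completion) auto
  define b where "b = integral (g ` T) f"
  have "T \<in> sets lebesgue" by auto
  from has_absolute_integral_change_of_variables_1'[OF this der inj, of f b] f
  have h: "(\<lambda>x. \<bar>h x\<bar> * f (g x)) absolutely_integrable_on T" "integral T (\<lambda>x. \<bar>h x\<bar> * f (g x)) = b"
    by (auto simp: b_def)
  have "((\<lambda>x. \<bar>h x\<bar> * f (g x)) has_integral b) T"
    using integrable_integral[OF set_lebesgue_integral_eq_integral(1)[OF h(1)]] h(2) by simp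
  hence "(\<integral>\<^sup>+x\<in>T. ennreal (\<bar>h x\<bar> * f (g x)) \<partial>lborel) = ennreal b"
    by (intro nn_integral_has_integral_lebesgue') (auto simp: nn)
  moreover have "(f has_integral b) (g ` T)"
    unfolding b_def by (rule integrable_integral[OF set_lebesgue_integral_eq_integral(1)[OF f]])
  hence "(\<integral>\<^sup>+x\<in>g ` T. ennreal (f x) \<partial>lborel) = ennreal b"
    by (intro nn_integral_has_integral_lebesgue') (auto simp: nn)
  ultimately show ?thesis by simp
qed

text \<open>
  The cone measure multiplied by \<open>|A \<theta>|\<close>, the reciprocal of \<open>\<theta> \<cdot> \<nu>\<close>: the image of Lebesgue measure on
  the ellipsoid without its centre under the radial projection, with the weight transported back along
  the projection.
\<close>
definition cone_surface_measure :: "real^'n \<Rightarrow> (real^'n) measure" where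
  "cone_surface_measure a = distr
     (density lborel (\<lambda>y. ennreal (real CARD('n) * norm (diag_matrix a *v (y /\<^sub>R norm_a a y)))
                          * indicator {y. 0 < norm_a a y \<and> norm_a a y < 1} y))
     borel (\<lambda>y. y /\<^sub>R norm_a a y)"

lemma borel_measurable_matrix_vector_mult [measurable]:
  fixes A :: "real^'n^'m"
  assumes [measurable]: "f \<in> borel_measurable M"
  shows "(\<lambda>x. A *v f x) \<in> borel_measurable M"
  by (rule borel_measurable_continuous_on[of "\<lambda>v. A *v v"]) (auto intro: continuous_intros)

lemma nn_integral_cone_surface_measure:
  fixes a :: "real^'n"
  assumes [measurable]: "f \<in> borel_measurable borel"
  shows "(\<integral>\<^sup>+\<theta>. f \<theta> \<partial>cone_surface_measure a)
    = (\<integral>\<^sup>+y. ennreal (real CARD('n) * norm (diag_matrix a *v (y /\<^sub>R norm_a a y)))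
         * indicator {y. 0 < norm_a a y \<and> norm_a a y < 1} y * f (y /\<^sub>R norm_a a y) \<partial>lborel)"
  unfolding cone_surface_measure_def
  by (subst nn_integral_distr, measurable, subst nn_integral_density) auto

lemma sets_cone_surface_measure [simp, measurable_cong]: "sets (cone_surface_measure a) = sets borel"
  by (simp add: cone_surface_measure_def)

text \<open>
  Differentiate \<open>|v + g(v) e\<^sub>k|\<^sub>a\<^sup>2 = 1\<close> in the direction \<open>e\<^sub>i\<close>, which stays within the hyperplane because
  \<open>i \<noteq> k\<close>.
\<close>
lemma graph_on_ellipsoid_gradient:
  fixes a :: "real^'n" and g :: "real^'n \<Rightarrow> real" and D :: "real^'n \<Rightarrow> real^'n"
  assumes a: "\<And>i. a $ i > 0" and U: "open U"
    and g: "\<And>x. x \<in> U \<Longrightarrow> (g has_derivative (\<lambda>h. D x \<bullet> h)) (at x)"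
    and S: "\<And>x. x \<in> U \<Longrightarrow> x $ k = 0 \<Longrightarrow> norm_a a (x + g x *\<^sub>R axis k 1) = 1"
    and v: "v \<in> U" "v $ k = 0" and i: "i \<noteq> k"
  shows "a $ i * v $ i = - (a $ k * g v * D v $ i)"
proof -
  define x where "x = (\<lambda>\<tau>::real. v + \<tau> *\<^sub>R axis i 1)"
  have cont: "continuous_on UNIV x" unfolding x_def by (intro continuous_intros)
  have op: "open (x -` U)" by (rule open_vimage[OF U cont])
  have x0: "x 0 = v" by (simp add: x_def)
  have gx: "((\<lambda>\<tau>. g (x \<tau>)) has_real_derivative D v $ i) (at 0)"
  proof -
    have "(x has_derivative (\<lambda>t. t *\<^sub>R axis i 1)) (at 0)"
      unfolding x_def by (auto intro!: derivative_eq_intros)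
    hence "((\<lambda>\<tau>. g (x \<tau>)) has_derivative (\<lambda>t. D (x 0) \<bullet> (t *\<^sub>R axis i 1))) (at 0)"
      by (rule has_derivative_compose) (use g v x0 in auto)
    thus ?thesis by (simp add: has_field_derivative_def x0 inner_axis mult.commute[of "D v $ i"] mult_commute_abs)
  qed
  define q where "q = (\<lambda>\<tau>. \<Sum>j\<in>UNIV. a $ j * (x \<tau> $ j + g (x \<tau>) * axis k 1 $ j)\<^sup>2)"
  have q1: "q \<tau> = 1" if "\<tau> \<in> x -` U" for \<tau>
  proof -
    have "x \<tau> $ k = 0" using v i by (simp add: x_def axis_def)
    hence "(norm_a a (x \<tau> + g (x \<tau>) *\<^sub>R axis k 1))\<^sup>2 = 1" using S[of "x \<tau>"] that by simp
    thus ?thesis by (simp add: norm_a_square[OF a] q_def)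
  qed
  have "(q has_real_derivative (\<Sum>j\<in>UNIV. a $ j * (2 * (v $ j + g v * axis k 1 $ j) * (axis i 1 $ j + D v $ i * axis k 1 $ j)))) (at 0)"
    unfolding q_def
  proof (rule DERIV_sum)
    fix j
    have "((\<lambda>\<tau>. x \<tau> $ j) has_real_derivative axis i 1 $ j) (at 0)"
      unfolding x_def by (auto intro!: derivative_eq_intros)
    thus "((\<lambda>\<tau>. a $ j * (x \<tau> $ j + g (x \<tau>) * axis k 1 $ j)\<^sup>2) has_real_derivative
      a $ j * (2 * (v $ j + g v * axis k 1 $ j) * (axis i 1 $ j + D v $ i * axis k 1 $ j))) (at 0)"
      using gx by (auto intro!: derivative_eq_intros simp: x0)
  qed
  moreover have "(q has_real_derivative 0) (at 0)"
  proof (rule has_field_derivative_transform_within_open[of "\<lambda>_. 1" _ _ "x -` U"])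
    show "open (x -` U)" by fact
    show "0 \<in> x -` U" using v x0 by simp
  qed (use q1 in auto)
  ultimately have "(\<Sum>j\<in>UNIV. a $ j * (2 * (v $ j + g v * axis k 1 $ j) * (axis i 1 $ j + D v $ i * axis k 1 $ j))) = 0"
    by (rule DERIV_unique)
  also have "(\<Sum>j\<in>UNIV. a $ j * (2 * (v $ j + g v * axis k 1 $ j) * (axis i 1 $ j + D v $ i * axis k 1 $ j)))
     = (\<Sum>j\<in>UNIV. (if j = i then 2 * (a $ i * v $ i) else 0) + (if j = k then 2 * (a $ k * g v * D v $ i) else 0))"
    using v i by (intro sum.cong refl) (auto simp: axis_def)
  also have "\<dots> = 2 * (a $ i * v $ i) + 2 * (a $ k * g v * D v $ i)"
    by (simp add: sum.distrib)
  finally show ?thesis by simp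
qed

text \<open>
  The left factor \<open>J = g - D \<cdot> v\<close> is the Jacobian of \<open>(v, r) \<mapsto> r (v + g(v) e\<^sub>k)\<close> up to a power of \<open>r\<close>. The
  gradient equation turns the equation of the ellipsoid into \<open>a\<^sub>k g J = 1\<close> and \<open>|A (v + g e\<^sub>k)|\<close> into
  \<open>|a\<^sub>k g|\<close> times the surface element.
\<close>
lemma graph_on_ellipsoid_jacobian:
  fixes a :: "real^'n" and g :: "real^'n \<Rightarrow> real" and D :: "real^'n \<Rightarrow> real^'n"
  assumes a: "\<And>i. a $ i > 0" and U: "open U"
    and g: "\<And>x. x \<in> U \<Longrightarrow> (g has_derivative (\<lambda>h. D x \<bullet> h)) (at x)"
    and S: "\<And>x. x \<in> U \<Longrightarrow> x $ k = 0 \<Longrightarrow> norm_a a (x + g x *\<^sub>R axis k 1) = 1"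
    and v: "v \<in> U" "v $ k = 0"
  shows "\<bar>g v - D v \<bullet> v\<bar> * norm (diag_matrix a *v (v + g v *\<^sub>R axis k 1))
    = sqrt (1 + (\<Sum>i\<in>UNIV - {k}. (D v $ i)\<^sup>2))"
proof -
  have grad: "a $ i * v $ i = - (a $ k * g v * D v $ i)" if "i \<noteq> k" for i
    by (rule graph_on_ellipsoid_gradient[where a = a and U = U and g = g and D = D and k = k])
       (fact a U g S v that)+
  have "1 = (norm_a a (v + g v *\<^sub>R axis k 1))\<^sup>2" using S v by simp
  also have "\<dots> = a $ k * (g v)\<^sup>2 + (\<Sum>i\<in>UNIV - {k}. a $ i * (v $ i)\<^sup>2)"
  proof -
    have "(\<Sum>i\<in>UNIV - {k}. a $ i * ((v + g v *\<^sub>R axis k 1) $ i)\<^sup>2) = (\<Sum>i\<in>UNIV - {k}. a $ i * (v $ i)\<^sup>2)"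
      by (intro sum.cong refl) (auto simp: axis_def)
    thus ?thesis unfolding norm_a_square[OF a]
      using v sum.remove[of UNIV k "\<lambda>i. a $ i * ((v + g v *\<^sub>R axis k 1) $ i)\<^sup>2"] by simp
  qed
  also have "(\<Sum>i\<in>UNIV - {k}. a $ i * (v $ i)\<^sup>2) = (\<Sum>i\<in>UNIV - {k}. - (a $ k * g v) * (D v $ i * v $ i))"
  proof (intro sum.cong refl)
    fix i assume "i \<in> UNIV - {k}"
    hence "i \<noteq> k" by simp
    hence e: "a $ i * v $ i = - (a $ k * g v * D v $ i)" by (rule grad)
    have "a $ i * (v $ i)\<^sup>2 = (a $ i * v $ i) * v $ i" by (simp add: power2_eq_square)
    also have "\<dots> = - (a $ k * g v) * (D v $ i * v $ i)" unfolding e by simp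
    finally show "a $ i * (v $ i)\<^sup>2 = - (a $ k * g v) * (D v $ i * v $ i)" .
  qed
  also have "\<dots> = - (a $ k * g v) * (\<Sum>i\<in>UNIV - {k}. D v $ i * v $ i)"
    by (rule sum_distrib_left[symmetric])
  also have "(\<Sum>i\<in>UNIV - {k}. D v $ i * v $ i) = D v \<bullet> v"
    unfolding inner_vec_def using v sum.remove[of UNIV k "\<lambda>i. D v $ i * v $ i"] by simp
  also have "a $ k * (g v)\<^sup>2 + - (a $ k * g v) * (D v \<bullet> v) = a $ k * g v * (g v - D v \<bullet> v)"
    by (simp add: algebra_simps power2_eq_square)
  finally have 1: "a $ k * g v * (g v - D v \<bullet> v) = 1" by (rule sym)
  have "(norm (diag_matrix a *v (v + g v *\<^sub>R axis k 1)))\<^sup>2 = (\<Sum>i\<in>UNIV. (a $ i * (v + g v *\<^sub>R axis k 1) $ i)\<^sup>2)"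
    unfolding power2_norm_eq_inner inner_vec_def diag_matrix_mult_nth by (simp add: power2_eq_square)
  also have "\<dots> = (a $ k * g v)\<^sup>2 + (\<Sum>i\<in>UNIV - {k}. (a $ i * v $ i)\<^sup>2)"
  proof -
    have "(\<Sum>i\<in>UNIV - {k}. (a $ i * (v + g v *\<^sub>R axis k 1) $ i)\<^sup>2) = (\<Sum>i\<in>UNIV - {k}. (a $ i * v $ i)\<^sup>2)"
      by (intro sum.cong refl) (auto simp: axis_def)
    thus ?thesis
      using v sum.remove[of UNIV k "\<lambda>i. (a $ i * (v + g v *\<^sub>R axis k 1) $ i)\<^sup>2"] by simp
  qed
  also have "(\<Sum>i\<in>UNIV - {k}. (a $ i * v $ i)\<^sup>2) = (\<Sum>i\<in>UNIV - {k}. (a $ k * g v)\<^sup>2 * (D v $ i)\<^sup>2)"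
  proof (intro sum.cong refl)
    fix i assume "i \<in> UNIV - {k}"
    hence "i \<noteq> k" by simp
    hence "a $ i * v $ i = - (a $ k * g v * D v $ i)" by (rule grad)
    thus "(a $ i * v $ i)\<^sup>2 = (a $ k * g v)\<^sup>2 * (D v $ i)\<^sup>2" by (simp only: power_mult_distrib power2_minus)
  qed
  also have "(a $ k * g v)\<^sup>2 + \<dots> = (a $ k * g v)\<^sup>2 * (1 + (\<Sum>i\<in>UNIV - {k}. (D v $ i)\<^sup>2))"
    by (simp add: distrib_left sum_distrib_left)
  finally have "sqrt ((norm (diag_matrix a *v (v + g v *\<^sub>R axis k 1)))\<^sup>2)
    = sqrt ((a $ k * g v)\<^sup>2 * (1 + (\<Sum>i\<in>UNIV - {k}. (D v $ i)\<^sup>2)))" by (rule arg_cong)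
  hence 2: "norm (diag_matrix a *v (v + g v *\<^sub>R axis k 1)) = \<bar>a $ k * g v\<bar> * sqrt (1 + (\<Sum>i\<in>UNIV - {k}. (D v $ i)\<^sup>2))"
    by (simp only: real_sqrt_mult real_sqrt_abs abs_norm_cancel)
  have "\<bar>g v - D v \<bullet> v\<bar> * \<bar>a $ k * g v\<bar> = 1"
    unfolding abs_mult[symmetric] using 1 by (simp add: mult.commute)
  thus ?thesis unfolding 2 by (simp only: mult.assoc[symmetric] mult_1)
qed

lemma norm_diag_matrix_le:
  assumes a: "\<And>i. a $ i > 0" and "norm_a a x = 1"
  shows "norm (diag_matrix a *v x) \<le> sqrt (\<Sum>i\<in>UNIV. a $ i)"
proof (rule real_le_rsqrt)
  have "(norm (diag_matrix a *v x))\<^sup>2 = (\<Sum>i\<in>UNIV. a $ i * (a $ i * (x $ i)\<^sup>2))"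
    unfolding power2_norm_eq_inner inner_vec_def diag_matrix_mult_nth by (simp add: power2_eq_square mult_ac)
  also have "\<dots> \<le> (\<Sum>i\<in>UNIV. (\<Sum>j\<in>UNIV. a $ j) * (a $ i * (x $ i)\<^sup>2))"
  proof (rule sum_mono)
    fix i
    have "a $ i \<le> (\<Sum>j\<in>UNIV. a $ j)"
      using a by (intro member_le_sum) (auto simp: less_imp_le)
    thus "a $ i * (a $ i * (x $ i)\<^sup>2) \<le> (\<Sum>j\<in>UNIV. a $ j) * (a $ i * (x $ i)\<^sup>2)"
      using a[of i] by (intro mult_right_mono) (auto simp: less_imp_le)
  qed
  also have "\<dots> = (\<Sum>j\<in>UNIV. a $ j) * (norm_a a x)\<^sup>2"
    unfolding norm_a_square[OF a] by (rule sum_distrib_left[symmetric])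
  finally show "(norm (diag_matrix a *v x))\<^sup>2 \<le> (\<Sum>i\<in>UNIV. a $ i)" using assms(2) by simp
qed

text \<open>
  A vertical line over \<open>z\<close> in the hyperplane meets the cone over the graph in the points
  \<open>r (v + g(v) e\<^sub>k)\<close> with \<open>v = z / r \<in> V\<close> and \<open>0 < r < 1\<close>. The radius \<open>r\<close> is the value of \<open>norm_a\<close>, hence
  determined by the point, and serves as a coordinate on the line: the height is \<open>\<phi>(r) = r g(z / r)\<close>, with
  derivative \<open>g(v) - D(v) \<cdot> v\<close>. So a one-dimensional substitution suffices and no determinant appears.
\<close>
lemma nn_integral_cone_slice:
  fixes a z :: "real^'n" and g :: "real^'n \<Rightarrow> real" and D :: "real^'n \<Rightarrow> real^'n"
  assumes a: "\<And>i. a $ i > 0" and U: "open U"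
    and g: "\<And>x. x \<in> U \<Longrightarrow> (g has_derivative (\<lambda>h. D x \<bullet> h)) (at x)"
    and S: "\<And>x. x \<in> U \<Longrightarrow> x $ k = 0 \<Longrightarrow> norm_a a (x + g x *\<^sub>R axis k 1) = 1"
    and V: "V \<in> sets borel" "V \<subseteq> U \<inter> {x. x $ k = 0}"
    and z: "z $ k = 0"
  defines "G \<equiv> \<lambda>x. x + g x *\<^sub>R axis k 1"
  assumes B: "G ` V \<in> sets borel"
  shows "(\<integral>\<^sup>+t. ennreal (real CARD('n) * norm (diag_matrix a *v ((z + t *\<^sub>R axis k 1) /\<^sub>R norm_a a (z + t *\<^sub>R axis k 1))))
           * indicator {y. 0 < norm_a a y \<and> norm_a a y < 1} (z + t *\<^sub>R axis k 1)
           * indicator (G ` V) ((z + t *\<^sub>R axis k 1) /\<^sub>R norm_a a (z + t *\<^sub>R axis k 1)) \<partial>lborel)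
     = (\<integral>\<^sup>+r. indicator {0<..<1} r * ennreal (real CARD('n)) *
           (indicator V (z /\<^sub>R r) * ennreal (sqrt (1 + (\<Sum>i\<in>UNIV - {k}. (D (z /\<^sub>R r) $ i)\<^sup>2)))) \<partial>lborel)"
proof -
  define e where "e = (axis k 1 :: real^'n)"
  define \<phi> where "\<phi> = (\<lambda>r. r * g (z /\<^sub>R r))"
  define T where "T = {r. 0 < r \<and> r < 1 \<and> z /\<^sub>R r \<in> V}"
  define f where "f = (\<lambda>t. real CARD('n) * norm (diag_matrix a *v ((z + t *\<^sub>R e) /\<^sub>R norm_a a (z + t *\<^sub>R e))))"
  define J where "J = (\<lambda>r. g (z /\<^sub>R r) - D (z /\<^sub>R r) \<bullet> (z /\<^sub>R r))"
  note [measurable] = V(1) B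
  have T_meas: "T \<in> sets borel" unfolding T_def by measurable
  have f_meas [measurable]: "f \<in> borel_measurable borel" unfolding f_def by measurable
  have rG: "z + \<phi> r *\<^sub>R e = r *\<^sub>R G (z /\<^sub>R r)" if "r > 0" for r
    using that by (simp add: \<phi>_def G_def e_def scaleR_add_right)
  have GV: "norm_a a (G v) = 1" if "v \<in> V" for v
    using S[of v] V(2) that unfolding G_def by auto
  have norm_r: "norm_a a (z + \<phi> r *\<^sub>R e) = r" if "r \<in> T" for r
    using that GV unfolding rG[OF conjunct1[OF that[unfolded T_def mem_Collect_eq]]]
    by (simp add: norm_a_scaleR T_def)
  have quot_r: "(z + \<phi> r *\<^sub>R e) /\<^sub>R norm_a a (z + \<phi> r *\<^sub>R e) = G (z /\<^sub>R r)" if "r \<in> T" for r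
  proof -
    have "r > 0" using that by (simp add: T_def)
    thus ?thesis by (subst norm_r[OF that], subst rG) simp_all
  qed
  have image: "\<phi> ` T = {t. 0 < norm_a a (z + t *\<^sub>R e) \<and> norm_a a (z + t *\<^sub>R e) < 1 \<and>
      (z + t *\<^sub>R e) /\<^sub>R norm_a a (z + t *\<^sub>R e) \<in> G ` V}" (is "_ = ?R")
  proof (intro equalityI subsetI)
    fix t assume "t \<in> \<phi> ` T"
    then obtain r where r: "t = \<phi> r" "r \<in> T" by auto
    have "(z + t *\<^sub>R e) /\<^sub>R norm_a a (z + t *\<^sub>R e) \<in> G ` V"
      unfolding r(1) quot_r[OF r(2)] using r(2) by (auto simp: T_def)
    moreover have "norm_a a (z + t *\<^sub>R e) = r" unfolding r(1) by (rule norm_r[OF r(2)])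
    ultimately show "t \<in> ?R" using r(2) by (simp add: T_def)
  next
    fix t assume t: "t \<in> ?R"
    define \<rho> where "\<rho> = norm_a a (z + t *\<^sub>R e)"
    obtain v where v: "v \<in> V" "(z + t *\<^sub>R e) /\<^sub>R \<rho> = v + g v *\<^sub>R e"
      using t by (auto simp: \<rho>_def G_def e_def)
    have \<rho>: "0 < \<rho>" "\<rho> < 1" using t by (auto simp: \<rho>_def)
    have vk: "v $ k = 0" using v V(2) by auto
    have "((z + t *\<^sub>R e) /\<^sub>R \<rho>) $ k = (v + g v *\<^sub>R e) $ k" using v(2) by simp
    hence tk: "t / \<rho> = g v" using z vk by (simp add: e_def divide_inverse mult.commute)
    have "z /\<^sub>R \<rho> + (t / \<rho>) *\<^sub>R e = v + g v *\<^sub>R e"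
      using v(2) by (simp add: scaleR_add_right divide_inverse mult.commute)
    hence zv: "z /\<^sub>R \<rho> = v" unfolding tk by simp
    have "t = \<phi> \<rho>" unfolding \<phi>_def zv using tk \<rho> by (simp add: field_simps)
    moreover have "\<rho> \<in> T" using \<rho> zv v(1) by (simp add: T_def)
    ultimately show "t \<in> \<phi> ` T" by blast
  qed
  have img_meas: "\<phi> ` T \<in> sets borel" unfolding image by measurable
  have inj: "inj_on \<phi> T"
  proof (rule inj_onI)
    fix r r' assume r: "r \<in> T" "r' \<in> T" "\<phi> r = \<phi> r'"
    have "r = norm_a a (z + \<phi> r *\<^sub>R e)" by (rule norm_r[OF r(1), symmetric])
    also have "\<dots> = r'" unfolding r(3) by (rule norm_r[OF r(2)])
    finally show "r = r'" .
  qed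
  have der: "(\<phi> has_field_derivative J r) (at r within T)" if "r \<in> T" for r
  proof -
    have r: "r > 0" and zU: "z /\<^sub>R r \<in> U" using that V(2) by (auto simp: T_def)
    have "((\<lambda>r. z /\<^sub>R r) has_derivative (\<lambda>h. (- (inverse r * h * inverse r)) *\<^sub>R z)) (at r)"
      using r by (intro has_derivative_scaleR_left has_derivative_inverse') simp
    from has_derivative_compose[OF this g[OF zU]]
    have "((\<lambda>r. g (z /\<^sub>R r)) has_derivative (\<lambda>h. D (z /\<^sub>R r) \<bullet> ((- (inverse r * h * inverse r)) *\<^sub>R z))) (at r)" .
    moreover have "(\<lambda>h. D (z /\<^sub>R r) \<bullet> ((- (inverse r * h * inverse r)) *\<^sub>R z))
       = (*) (- (inverse r * inverse r * (D (z /\<^sub>R r) \<bullet> z)))"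
      by (rule ext) simp
    ultimately have "((\<lambda>r. g (z /\<^sub>R r)) has_field_derivative (- (inverse r * inverse r * (D (z /\<^sub>R r) \<bullet> z)))) (at r)"
      unfolding has_field_derivative_def by (simp only:)
    from DERIV_mult[OF DERIV_ident this]
    have "(\<phi> has_field_derivative (1 * g (z /\<^sub>R r) + - (inverse r * inverse r * (D (z /\<^sub>R r) \<bullet> z)) * r)) (at r)"
      unfolding \<phi>_def .
    moreover have "1 * g (z /\<^sub>R r) + - (inverse r * inverse r * (D (z /\<^sub>R r) \<bullet> z)) * r = J r"
      using r by (simp add: J_def)
    ultimately show ?thesis by (simp add: has_field_derivative_at_within)
  qed
  have f_nonneg: "f t \<ge> 0" for t by (simp add: f_def)
  \<comment> \<open>the slice lies in a bounded interval, and the weight is bounded on the ellipsoid\<close>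
  have fin: "(\<integral>\<^sup>+t\<in>\<phi> ` T. ennreal (f t) \<partial>lborel) < \<infinity>"
  proof -
    define C where "C = real CARD('n) * sqrt (\<Sum>i\<in>UNIV. a $ i)"
    define c where "c = 1 / sqrt (a $ k)"
    have "(\<integral>\<^sup>+t\<in>\<phi> ` T. ennreal (f t) \<partial>lborel) \<le> (\<integral>\<^sup>+t. ennreal C * indicator {-c..c} t \<partial>lborel)"
    proof (intro nn_integral_mono)
      fix t
      show "ennreal (f t) * indicator (\<phi> ` T) t \<le> ennreal C * indicator {-c..c} t"
      proof (cases "t \<in> \<phi> ` T")
        case True
        then obtain r where r: "t = \<phi> r" "r \<in> T" by auto
        have "f t \<le> C" unfolding f_def C_def r(1) quot_r[OF r(2)]
          using r(2) by (intro mult_left_mono norm_diag_matrix_le a GV) (auto simp: T_def)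
        moreover have "t \<in> {-c..c}"
        proof -
          have "a $ k * t\<^sup>2 = a $ k * ((z + t *\<^sub>R e) $ k)\<^sup>2" using z by (simp add: e_def)
          also have "\<dots> \<le> (norm_a a (z + t *\<^sub>R e))\<^sup>2"
            unfolding norm_a_square[OF a] using a
            by (intro member_le_sum[of k UNIV "\<lambda>i. a $ i * ((z + t *\<^sub>R e) $ i)\<^sup>2"]) (auto simp: less_imp_le)
          also have "\<dots> \<le> 1" using norm_r[OF r(2)] r by (auto simp: T_def power_le_one)
          finally have "t\<^sup>2 \<le> 1 / a $ k" using a[of k] by (simp add: field_simps)
          hence "sqrt (t\<^sup>2) \<le> sqrt (1 / a $ k)" by (rule real_sqrt_le_mono)
          hence "\<bar>t\<bar> \<le> c" by (simp add: c_def real_sqrt_divide)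
          thus ?thesis by (auto simp: abs_le_iff)
        qed
        ultimately show ?thesis using True by (simp add: ennreal_leI)
      qed simp
    qed
    also have "\<dots> = ennreal C * ennreal (2 * c)"
    proof -
      have "c \<ge> 0" using a[of k] by (simp add: c_def)
      thus ?thesis by (simp add: nn_integral_cmult)
    qed
    also have "\<dots> < \<infinity>" by (simp add: ennreal_mult_less_top)
    finally show ?thesis .
  qed
  have "(\<integral>\<^sup>+t. ennreal (real CARD('n) * norm (diag_matrix a *v ((z + t *\<^sub>R axis k 1) /\<^sub>R norm_a a (z + t *\<^sub>R axis k 1))))
           * indicator {y. 0 < norm_a a y \<and> norm_a a y < 1} (z + t *\<^sub>R axis k 1)
           * indicator (G ` V) ((z + t *\<^sub>R axis k 1) /\<^sub>R norm_a a (z + t *\<^sub>R axis k 1)) \<partial>lborel)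
     = (\<integral>\<^sup>+t\<in>\<phi> ` T. ennreal (f t) \<partial>lborel)"
    unfolding image f_def e_def by (intro nn_integral_cong) (auto simp: indicator_def)
  also have "\<dots> = (\<integral>\<^sup>+r\<in>T. ennreal (\<bar>J r\<bar> * f (\<phi> r)) \<partial>lborel)"
    by (rule nn_integral_image_real[OF T_meas img_meas f_meas der inj f_nonneg fin])
  also have "\<dots> = (\<integral>\<^sup>+r. indicator {0<..<1} r * ennreal (real CARD('n)) *
           (indicator V (z /\<^sub>R r) * ennreal (sqrt (1 + (\<Sum>i\<in>UNIV - {k}. (D (z /\<^sub>R r) $ i)\<^sup>2)))) \<partial>lborel)"
  proof (intro nn_integral_cong)
    fix r :: real
    show "ennreal (\<bar>J r\<bar> * f (\<phi> r)) * indicator T r = indicator {0<..<1} r * ennreal (real CARD('n)) *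
           (indicator V (z /\<^sub>R r) * ennreal (sqrt (1 + (\<Sum>i\<in>UNIV - {k}. (D (z /\<^sub>R r) $ i)\<^sup>2))))"
    proof (cases "r \<in> T")
      case True
      hence zU: "z /\<^sub>R r \<in> U" "(z /\<^sub>R r) $ k = 0" using V(2) z by (auto simp: T_def)
      have "\<bar>J r\<bar> * norm (diag_matrix a *v G (z /\<^sub>R r)) = sqrt (1 + (\<Sum>i\<in>UNIV - {k}. (D (z /\<^sub>R r) $ i)\<^sup>2))"
        unfolding J_def G_def
        by (rule graph_on_ellipsoid_jacobian[where a = a and U = U and g = g and D = D and k = k]) (fact a U g S zU)+
      hence "real CARD('n) * (\<bar>J r\<bar> * norm (diag_matrix a *v G (z /\<^sub>R r)))
          = real CARD('n) * sqrt (1 + (\<Sum>i\<in>UNIV - {k}. (D (z /\<^sub>R r) $ i)\<^sup>2))" by (rule arg_cong)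
      hence "\<bar>J r\<bar> * f (\<phi> r) = real CARD('n) * sqrt (1 + (\<Sum>i\<in>UNIV - {k}. (D (z /\<^sub>R r) $ i)\<^sup>2))"
        unfolding f_def quot_r[OF True] by (simp only: mult.left_commute[of "\<bar>J r\<bar>"])
      thus ?thesis using True by (simp add: T_def ennreal_mult' indicator_def)
    qed (auto simp: T_def indicator_def)
  qed
  finally show ?thesis .
qed

text \<open>
  After slicing, exchange the integrals over \<open>z\<close> and \<open>r\<close>. Scaling the hyperplane by \<open>r\<close> produces
  \<open>r\<^bsup>n-1\<^esup>\<close>, and \<open>\<integral>\<^sub>0\<^sup>1 n r\<^bsup>n-1\<^esup> dr = 1\<close> disposes of the radial variable.
\<close>
lemma emeasure_cone_surface_measure_graph:
  fixes a :: "real^'n" and g :: "real^'n \<Rightarrow> real" and D :: "real^'n \<Rightarrow> real^'n"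
  assumes a: "\<And>i. a $ i > 0" and U: "open U"
    and g: "\<And>x. x \<in> U \<Longrightarrow> (g has_derivative (\<lambda>h. D x \<bullet> h)) (at x)"
    and D: "continuous_on U D"
    and S: "\<And>x. x \<in> U \<Longrightarrow> x $ k = 0 \<Longrightarrow> norm_a a (x + g x *\<^sub>R axis k 1) = 1"
    and V: "V \<in> sets borel" "V \<subseteq> U \<inter> {x. x $ k = 0}"
  defines "G \<equiv> \<lambda>x. x + g x *\<^sub>R axis k 1"
  shows "emeasure (cone_surface_measure a) (G ` V)
    = (\<integral>\<^sup>+x\<in>V. ennreal (sqrt (1 + (\<Sum>i\<in>UNIV - {k}. (D x $ i)\<^sup>2))) \<partial>hyperplane_lborel k)"
proof -
  define n where "n = CARD('n)"
  have n: "n > 0" by (simp add: n_def)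
  \<comment> \<open>\<open>g\<close> and \<open>D\<close> are arbitrary outside \<open>U\<close>; these versions are Borel measurable on the whole space\<close>
  define g' where "g' = (\<lambda>x. if x \<in> U then g x else 0)"
  define D' where "D' = (\<lambda>x. if x \<in> U then D x else 0)"
  have U_meas: "U \<in> sets borel" using U by simp
  have "continuous_on U g"
    using has_derivative_continuous[OF g] by (intro continuous_at_imp_continuous_on) auto
  hence [measurable]: "g' \<in> borel_measurable borel"
    unfolding g'_def using U_meas by (intro borel_measurable_continuous_on_if continuous_on_const)
  have [measurable]: "D' \<in> borel_measurable borel"
    unfolding D'_def using U_meas D by (intro borel_measurable_continuous_on_if continuous_on_const)
  note [measurable] = V(1)
  have B_eq: "G ` V = {\<theta>. \<theta> - (\<theta> $ k) *\<^sub>R axis k 1 \<in> V \<and> \<theta> $ k = g' (\<theta> - (\<theta> $ k) *\<^sub>R axis k 1)}" (is "_ = ?R")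
  proof (intro equalityI subsetI)
    fix \<theta> assume "\<theta> \<in> G ` V"
    then obtain v where v: "v \<in> V" "\<theta> = v + g v *\<^sub>R axis k 1" by (auto simp: G_def)
    hence "v \<in> U" "v $ k = 0" using V(2) by auto
    thus "\<theta> \<in> ?R" using v by (simp add: g'_def)
  next
    fix \<theta> assume \<theta>: "\<theta> \<in> ?R"
    define v where "v = \<theta> - (\<theta> $ k) *\<^sub>R axis k 1"
    have vV: "v \<in> V" using \<theta> by (simp add: v_def)
    hence "v \<in> U" using V(2) by auto
    hence gv: "\<theta> $ k = g v" using \<theta> unfolding mem_Collect_eq v_def[symmetric] g'_def by simp
    have "\<theta> = v + (\<theta> $ k) *\<^sub>R axis k 1" by (simp add: v_def)
    hence "\<theta> = G v" unfolding G_def gv .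
    thus "\<theta> \<in> G ` V" using vV by blast
  qed
  have B_meas [measurable]: "G ` V \<in> sets borel" unfolding B_eq by measurable
  define w where "w = (\<lambda>x. indicator V x * ennreal (sqrt (1 + (\<Sum>i\<in>UNIV - {k}. (D' x $ i)\<^sup>2))))"
  have w_meas [measurable]: "w \<in> borel_measurable borel" unfolding w_def by measurable
  have w_eq: "indicator V x * ennreal (sqrt (1 + (\<Sum>i\<in>UNIV - {k}. (D x $ i)\<^sup>2))) = w x" for x
    using V(2) by (auto simp: w_def D'_def indicator_def)
  define h where "h = (\<lambda>y. ennreal (real CARD('n) * norm (diag_matrix a *v (y /\<^sub>R norm_a a y)))
         * indicator {y. 0 < norm_a a y \<and> norm_a a y < 1} y * indicator (G ` V) (y /\<^sub>R norm_a a y))"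
  have h_meas: "h \<in> borel_measurable borel" unfolding h_def by measurable
  have "emeasure (cone_surface_measure a) (G ` V) = (\<integral>\<^sup>+\<theta>. indicator (G ` V) \<theta> \<partial>cone_surface_measure a)"
    by (subst nn_integral_indicator) auto
  also have "\<dots> = (\<integral>\<^sup>+y. h y \<partial>lborel)"
    unfolding h_def by (rule nn_integral_cone_surface_measure) measurable
  also have "\<dots> = (\<integral>\<^sup>+z. (\<integral>\<^sup>+t. h (z + t *\<^sub>R axis k 1) \<partial>lborel) \<partial>hyperplane_lborel k)"
    by (rule nn_integral_lborel_hyperplane[OF h_meas])
  also have "\<dots> = (\<integral>\<^sup>+z. (\<integral>\<^sup>+r. indicator {0<..<1} r * ennreal (real n) * w (z /\<^sub>R r) \<partial>lborel) \<partial>hyperplane_lborel k)"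
  proof (rule nn_integral_hyperplane_cong)
    fix z :: "real^'n" assume z: "z $ k = 0"
    show "(\<integral>\<^sup>+t. h (z + t *\<^sub>R axis k 1) \<partial>lborel)
       = (\<integral>\<^sup>+r. indicator {0<..<1} r * ennreal (real n) * w (z /\<^sub>R r) \<partial>lborel)"
      unfolding h_def n_def w_eq[symmetric] G_def
      by (rule nn_integral_cone_slice[where a = a and U = U and g = g and D = D and k = k and V = V and z = z]) (fact a U g S V z B_meas[unfolded G_def])+
  qed
  also have "\<dots> = (\<integral>\<^sup>+r. (\<integral>\<^sup>+z. indicator {0<..<1} r * ennreal (real n) * w (z /\<^sub>R r) \<partial>hyperplane_lborel k) \<partial>lborel)"
    by (rule nn_integral_hyperplane_swap) measurable
  also have "\<dots> = (\<integral>\<^sup>+r. ennreal (real n) * (ennreal (r powr (real n - 1)) * indicator {0..1} r) * (\<integral>\<^sup>+z. w z \<partial>hyperplane_lborel k) \<partial>lborel)"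
  proof (rule nn_integral_cong_AE)
    have "(\<integral>\<^sup>+z. indicator {0<..<1} r * ennreal (real n) * w (z /\<^sub>R r) \<partial>hyperplane_lborel k)
      = ennreal (real n) * (ennreal (r powr (real n - 1)) * indicator {0..1} r) * (\<integral>\<^sup>+z. w z \<partial>hyperplane_lborel k)"
      if r: "0 < r" "r < 1" for r :: real
    proof -
      have "(\<integral>\<^sup>+z. w (z /\<^sub>R r) \<partial>hyperplane_lborel k) = ennreal (r ^ (n - 1)) * (\<integral>\<^sup>+z. w z \<partial>hyperplane_lborel k)"
        using nn_integral_hyperplane_scaleR[of "\<lambda>z. w (z /\<^sub>R r)" r k] r by (simp add: n_def)
      moreover have "r ^ (n - 1) = r powr (real n - 1)"
        using r n by (simp add: powr_realpow[symmetric] of_nat_diff)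
      moreover have "(\<integral>\<^sup>+z. ennreal (real n) * w (z /\<^sub>R r) \<partial>hyperplane_lborel k)
          = ennreal (real n) * (\<integral>\<^sup>+z. w (z /\<^sub>R r) \<partial>hyperplane_lborel k)"
        by (rule nn_integral_cmult) measurable
      moreover have "indicator {0<..<1} r = (1::ennreal)" "indicator {0..1} r = (1::ennreal)" using r by simp_all
      ultimately show ?thesis by (simp only: mult_1_left mult_1_right mult.assoc)
    qed
    note key = this
    show "AE r in lborel. (\<integral>\<^sup>+z. indicator {0<..<1} r * ennreal (real n) * w (z /\<^sub>R r) \<partial>hyperplane_lborel k)
      = ennreal (real n) * (ennreal (r powr (real n - 1)) * indicator {0..1} r) * (\<integral>\<^sup>+z. w z \<partial>hyperplane_lborel k)"
      using AE_lborel_singleton[of "0::real"] AE_lborel_singleton[of "1::real"]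
    proof eventually_elim
      case (elim r)
      show ?case using key[of r] elim by (cases "0 < r \<and> r < 1") (auto simp: indicator_def)
    qed
  qed
  also have "\<dots> = ennreal (real n) * (\<integral>\<^sup>+r\<in>{0..1}. ennreal (r powr (real n - 1)) \<partial>lborel) * (\<integral>\<^sup>+z. w z \<partial>hyperplane_lborel k)"
    by (subst nn_integral_multc, measurable, subst nn_integral_cmult) auto
  also have "ennreal (real n) * (\<integral>\<^sup>+r\<in>{0..1}. ennreal (r powr (real n - 1)) \<partial>lborel) = 1"
    using n by (subst nn_integral_powr_0) (auto simp: ennreal_mult[symmetric])
  finally have "emeasure (cone_surface_measure a) (G ` V) = (\<integral>\<^sup>+z. w z \<partial>hyperplane_lborel k)" by simp
  also have "\<dots> = (\<integral>\<^sup>+x\<in>V. ennreal (sqrt (1 + (\<Sum>i\<in>UNIV - {k}. (D x $ i)\<^sup>2))) \<partial>hyperplane_lborel k)"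
    by (simp add: w_eq[symmetric] mult.commute)
  finally show ?thesis .
qed

lemma is_surface_measure_cone:
  assumes a: "\<And>i. a $ i > 0"
  shows "is_surface_measure {x. norm_a a x = 1} (cone_surface_measure a)"
  unfolding is_surface_measure_def Let_def
proof (intro conjI allI impI ballI)
  show "sets (cone_surface_measure a) = sets borel" by simp
  have [measurable]: "- {x. norm_a a x = 1} \<in> sets borel" by measurable
  have "emeasure (cone_surface_measure a) (- {x. norm_a a x = 1})
     = (\<integral>\<^sup>+\<theta>. indicator (- {x. norm_a a x = 1}) \<theta> \<partial>cone_surface_measure a)"
    by (subst nn_integral_indicator) auto
  also have "\<dots> = (\<integral>\<^sup>+y. 0 \<partial>(lborel :: (real^'a) measure))"
  proof (subst nn_integral_cone_surface_measure, measurable, intro nn_integral_cong)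
    fix y :: "real^'a"
    have "norm_a a (y /\<^sub>R norm_a a y) = 1" if "0 < norm_a a y"
      using that by (simp add: norm_a_scaleR)
    thus "ennreal (real CARD('a) * norm (diag_matrix a *v (y /\<^sub>R norm_a a y))) *
        indicator {y. 0 < norm_a a y \<and> norm_a a y < 1} y * indicator (- {x. norm_a a x = 1}) (y /\<^sub>R norm_a a y) = 0"
      by (auto simp: indicator_def)
  qed
  finally show "emeasure (cone_surface_measure a) (- {x. norm_a a x = 1}) = 0" by simp
next
  fix k U g D V
  assume *: "open U" "\<forall>x\<in>U. (g has_derivative (\<lambda>h. D x \<bullet> h)) (at x)" "continuous_on U D"
    "\<forall>x\<in>U. x $ k = 0 \<longrightarrow> x + g x *\<^sub>R axis k 1 \<in> {x. norm_a a x = 1}"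
    "V \<in> sets borel" "V \<subseteq> U \<inter> {x. x $ k = 0}"
  show "emeasure (cone_surface_measure a) ((\<lambda>x. x + g x *\<^sub>R axis k 1) ` V)
    = (\<integral>\<^sup>+x\<in>V. ennreal (sqrt (1 + (\<Sum>i\<in>UNIV - {k}. (D x $ i)\<^sup>2))) \<partial>hyperplane_lborel k)"
    by (rule emeasure_cone_surface_measure_graph[where U = U and D = D]) (use a * in auto)
qed

text \<open>
  The part of the surface where \<open>\<theta>\<^sub>k\<close> has the sign \<open>\<epsilon>\<close> is the graph of \<open>\<epsilon> sqrt Q\<close>, where \<open>Q\<close> comes from solving
  the equation of the ellipsoid for \<open>\<theta>\<^sub>k\<^sup>2\<close>. Every Borel subset is the graph over a Borel set, so the defining
  property prescribes its measure.
\<close>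
lemma emeasure_surface_patch:
  fixes a :: "real^'n" and B :: "(real^'n) set"
  assumes a: "\<And>i. a $ i > 0" and \<epsilon>: "\<epsilon> = 1 \<or> \<epsilon> = (-1::real)"
    and B: "B \<in> sets borel" "B \<subseteq> {\<theta>. norm_a a \<theta> = 1 \<and> \<epsilon> * \<theta> $ k > 0}"
    and "is_surface_measure {x. norm_a a x = 1} \<sigma>\<^sub>1"
    and "is_surface_measure {x. norm_a a x = 1} \<sigma>\<^sub>2"
  shows "emeasure \<sigma>\<^sub>1 B = emeasure \<sigma>\<^sub>2 B"
proof -
  have \<epsilon>2: "\<epsilon> * \<epsilon> = 1" using \<epsilon> by auto
  define Q where "Q = (\<lambda>x::real^'n. (1 - (\<Sum>i\<in>UNIV - {k}. a $ i * (x $ i)\<^sup>2)) / a $ k)"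
  define g where "g = (\<lambda>x. \<epsilon> * sqrt (Q x))"
  define U where "U = {x. 0 < Q x}"
  define c where "c = (\<lambda>x. \<epsilon> * inverse (a $ k) * inverse (sqrt (Q x)))"
  define D where "D = (\<lambda>x::real^'n. (\<chi> i. if i = k then 0 else - c x * (a $ i * x $ i)))"
  define G where "G = (\<lambda>x. x + g x *\<^sub>R axis k 1)"
  define V where "V = {x. x \<in> U \<and> x $ k = 0 \<and> G x \<in> B}"
  note [measurable] = B(1)
  have Q_cont: "continuous_on A Q" for A
    unfolding Q_def using a[of k] by (intro continuous_intros) auto
  have [measurable]: "Q \<in> borel_measurable borel" by (intro borel_measurable_continuous_onI Q_cont)
  have U_open: "open U" unfolding U_def by (intro open_Collect_less continuous_on_const Q_cont)
  have der: "(g has_derivative (\<lambda>h. D x \<bullet> h)) (at x)" if "x \<in> U" for x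
  proof -
    have "(Q has_derivative (\<lambda>h. - (\<Sum>i\<in>UNIV - {k}. a $ i * (2 * (x $ i * h $ i))) / a $ k)) (at x)"
    proof -
      have "((\<lambda>x. x $ i) has_derivative (\<lambda>h. h $ i)) (at x)" for i
        by (rule bounded_linear_imp_has_derivative[OF bounded_linear_vec_nth])
      hence "((\<lambda>x. (x $ i)\<^sup>2) has_derivative (\<lambda>h. 2 * (x $ i * h $ i))) (at x)" for i
        by (auto intro!: derivative_eq_intros)
      hence "((\<lambda>x. \<Sum>i\<in>UNIV - {k}. a $ i * (x $ i)\<^sup>2) has_derivative
          (\<lambda>h. \<Sum>i\<in>UNIV - {k}. a $ i * (2 * (x $ i * h $ i)))) (at x)"
        by (intro has_derivative_sum has_derivative_mult_right)
      from has_derivative_mult_left[OF has_derivative_diff[OF has_derivative_const this], of 1 "inverse (a $ k)"]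
      show ?thesis unfolding Q_def divide_inverse by simp
    qed
    moreover have "Q x > 0" using that by (simp add: U_def)
    ultimately have "((\<lambda>x. sqrt (Q x)) has_derivative
        (\<lambda>h. (- (\<Sum>i\<in>UNIV - {k}. a $ i * (2 * (x $ i * h $ i))) / a $ k) * (inverse (sqrt (Q x)) / 2))) (at x)"
      by (intro DERIV_compose_FDERIV DERIV_real_sqrt)
    hence "(g has_derivative (\<lambda>h. \<epsilon> * ((- (\<Sum>i\<in>UNIV - {k}. a $ i * (2 * (x $ i * h $ i))) / a $ k) * (inverse (sqrt (Q x)) / 2)))) (at x)"
      unfolding g_def by (rule has_derivative_mult_right)
    moreover have "\<epsilon> * ((- (\<Sum>i\<in>UNIV - {k}. a $ i * (2 * (x $ i * h $ i))) / a $ k) * (inverse (sqrt (Q x)) / 2)) = D x \<bullet> h" for h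
    proof -
      have "(\<Sum>i\<in>UNIV - {k}. a $ i * (2 * (x $ i * h $ i))) = 2 * (\<Sum>i\<in>UNIV - {k}. a $ i * x $ i * h $ i)"
        by (simp add: sum_distrib_left mult_ac)
      hence "\<epsilon> * ((- (\<Sum>i\<in>UNIV - {k}. a $ i * (2 * (x $ i * h $ i))) / a $ k) * (inverse (sqrt (Q x)) / 2))
          = - c x * (\<Sum>i\<in>UNIV - {k}. a $ i * x $ i * h $ i)"
        unfolding c_def using a[of k] by (simp add: field_simps)
      also have "\<dots> = (\<Sum>i\<in>UNIV - {k}. D x $ i * h $ i)"
        unfolding sum_distrib_left D_def by (intro sum.cong refl) simp
      also have "\<dots> = D x \<bullet> h"
        unfolding inner_vec_def using sum.remove[of UNIV k "\<lambda>i. D x $ i * h $ i"] by (simp add: D_def)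
      finally show ?thesis .
    qed
    ultimately show ?thesis by (simp only:)
  qed
  have D_cont: "continuous_on U D"
    unfolding D_def
  proof (rule continuous_on_vec_lambda)
    fix i
    have "continuous_on U c" unfolding c_def using a[of k]
      by (intro continuous_intros Q_cont) (auto simp: U_def)
    hence "continuous_on U (\<lambda>x. - c x * (a $ i * x $ i))" by (intro continuous_intros)
    thus "continuous_on U (\<lambda>x. if i = k then 0 else - c x * (a $ i * x $ i))" by (cases "i = k") auto
  qed
  have sq: "(norm_a a \<theta>)\<^sup>2 = a $ k * (\<theta> $ k)\<^sup>2 + (\<Sum>i\<in>UNIV - {k}. a $ i * (\<theta> $ i)\<^sup>2)" for \<theta>
    unfolding norm_a_square[OF a] using sum.remove[of UNIV k "\<lambda>i. a $ i * (\<theta> $ i)\<^sup>2"] by simp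
  have GS: "norm_a a (G x) = 1" if "x \<in> U" "x $ k = 0" for x
  proof -
    have Qx: "Q x > 0" using that by (simp add: U_def)
    have "(g x)\<^sup>2 = (\<epsilon> * \<epsilon>) * (sqrt (Q x))\<^sup>2" by (simp add: g_def power2_eq_square)
    hence gk: "(g x)\<^sup>2 = Q x" using Qx \<epsilon>2 by simp
    have "(\<Sum>i\<in>UNIV - {k}. a $ i * (G x $ i)\<^sup>2) = (\<Sum>i\<in>UNIV - {k}. a $ i * (x $ i)\<^sup>2)"
      by (intro sum.cong refl) (auto simp: G_def axis_def)
    moreover have "G x $ k = g x" using that by (simp add: G_def)
    ultimately have "(norm_a a (G x))\<^sup>2 = a $ k * Q x + (\<Sum>i\<in>UNIV - {k}. a $ i * (x $ i)\<^sup>2)"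
      unfolding sq by (simp only: gk)
    also have "\<dots> = 1" using a[of k] by (simp add: Q_def)
    finally show ?thesis using norm_a_nonneg[OF a, of "G x"] by (simp add: power2_eq_1_iff)
  qed
  have GV: "G ` V = B"
  proof (intro equalityI subsetI)
    fix \<theta> assume \<theta>: "\<theta> \<in> B"
    hence 1: "norm_a a \<theta> = 1" "\<epsilon> * \<theta> $ k > 0" using B(2) by auto
    define v where "v = \<theta> - (\<theta> $ k) *\<^sub>R axis k 1"
    have vk: "v $ k = 0" by (simp add: v_def)
    have "(\<Sum>i\<in>UNIV - {k}. a $ i * (v $ i)\<^sup>2) = (\<Sum>i\<in>UNIV - {k}. a $ i * (\<theta> $ i)\<^sup>2)"
      by (intro sum.cong refl) (auto simp: v_def axis_def)
    also have "\<dots> = 1 - a $ k * (\<theta> $ k)\<^sup>2" using sq[of \<theta>] 1(1) by simp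
    finally have Qv: "Q v = (\<theta> $ k)\<^sup>2" using a[of k] by (simp add: Q_def)
    have "\<theta> $ k \<noteq> 0" using 1(2) by auto
    hence vU: "v \<in> U" by (simp add: U_def Qv)
    have "g v = \<theta> $ k" using 1(2) \<epsilon> by (auto simp: g_def Qv)
    hence "G v = v + (\<theta> $ k) *\<^sub>R axis k 1" unfolding G_def by (rule arg_cong)
    hence "G v = \<theta>" by (simp add: v_def)
    thus "\<theta> \<in> G ` V" using vU vk \<theta> by (intro image_eqI[of _ _ v]) (auto simp: V_def)
  qed (auto simp: V_def)
  have V_meas: "V \<in> sets borel" unfolding V_def U_def G_def g_def by measurable
  have "emeasure \<sigma> B = (\<integral>\<^sup>+x\<in>V. ennreal (sqrt (1 + (\<Sum>i\<in>UNIV - {k}. (D x $ i)\<^sup>2))) \<partial>hyperplane_lborel k)"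
    if \<sigma>: "is_surface_measure {x. norm_a a x = 1} \<sigma>" for \<sigma>
  proof -
    note m = conjunct2[OF conjunct2[OF \<sigma>[unfolded is_surface_measure_def Let_def]], rule_format]
    have "emeasure \<sigma> ((\<lambda>x. x + g x *\<^sub>R axis k 1) ` V)
        = (\<integral>\<^sup>+x\<in>V. ennreal (sqrt (1 + (\<Sum>i\<in>UNIV - {k}. (D x $ i)\<^sup>2))) \<partial>hyperplane_lborel k)"
      by (rule m[OF U_open]) (use der D_cont GS V_meas in \<open>auto simp: G_def V_def\<close>)
    thus ?thesis unfolding G_def[symmetric] GV .
  qed
  thus ?thesis using assms by simp
qed

text \<open>
  The \<open>2 n\<close> patches cover the surface because no point of it is the origin; a Borel set is cut along the
  patches one after the other.
\<close>
lemma is_surface_measure_unique: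
  fixes a :: "real^'n"
  assumes a: "\<And>i. a $ i > 0"
    and \<sigma>1: "is_surface_measure {x. norm_a a x = 1} \<sigma>\<^sub>1"
    and \<sigma>2: "is_surface_measure {x. norm_a a x = 1} \<sigma>\<^sub>2"
  shows "\<sigma>\<^sub>1 = \<sigma>\<^sub>2"
proof (rule measure_eqI)
  have sets: "sets \<sigma>\<^sub>1 = sets borel" "sets \<sigma>\<^sub>2 = sets borel"
    and null: "emeasure \<sigma>\<^sub>1 (- {x. norm_a a x = 1}) = 0" "emeasure \<sigma>\<^sub>2 (- {x. norm_a a x = 1}) = 0"
    using \<sigma>1 \<sigma>2 unfolding is_surface_measure_def by auto
  show "sets \<sigma>\<^sub>1 = sets \<sigma>\<^sub>2" by (simp add: sets)
  define P where "P = (\<lambda>(k::'n, \<epsilon>::real). {\<theta>. norm_a a \<theta> = 1 \<and> \<epsilon> * \<theta> $ k > 0})"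
  have P_meas: "P p \<in> sets borel" for p
    unfolding P_def by (cases p) simp
  have patches: "emeasure \<sigma>\<^sub>1 B = emeasure \<sigma>\<^sub>2 B"
    if "finite F" "F \<subseteq> UNIV \<times> {1, -1}" "B \<in> sets borel" "B \<subseteq> (\<Union>p\<in>F. P p)" for F B
    using that
  proof (induction F arbitrary: B rule: finite_induct)
    case (insert p F)
    obtain k \<epsilon> where p: "p = (k, \<epsilon>)" by (cases p)
    have "B \<inter> P p \<in> sets borel" "B - P p \<in> sets borel" using insert.prems P_meas by auto
    note m = this
    have "emeasure \<sigma>\<^sub>1 (B \<inter> P p) = emeasure \<sigma>\<^sub>2 (B \<inter> P p)"
      by (rule emeasure_surface_patch[OF a _ m(1) _ \<sigma>1 \<sigma>2, of \<epsilon> k]) (use insert.prems p in \<open>auto simp: P_def\<close>)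
    moreover have "emeasure \<sigma>\<^sub>1 (B - P p) = emeasure \<sigma>\<^sub>2 (B - P p)"
      by (rule insert.IH) (use insert.prems m in auto)
    moreover have "emeasure \<sigma> B = emeasure \<sigma> (B \<inter> P p) + emeasure \<sigma> (B - P p)"
      if "sets \<sigma> = sets borel" for \<sigma>
    proof -
      have "B \<inter> P p \<union> (B - P p) = B" "B \<inter> P p \<inter> (B - P p) = {}" by auto
      thus ?thesis using plus_emeasure[of "B \<inter> P p" \<sigma> "B - P p"] m that by auto
    qed
    ultimately show ?case using sets by simp
  qed auto
  fix B assume "B \<in> sets \<sigma>\<^sub>1"
  hence B: "B \<in> sets borel" by (simp add: sets)
  define S where "S = {x. norm_a a x = 1}"
  have S_meas: "S \<in> sets borel" unfolding S_def by measurable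
  have cover: "S \<subseteq> (\<Union>p\<in>UNIV \<times> {1, -1}. P p)"
  proof
    fix \<theta> assume \<theta>: "\<theta> \<in> S"
    hence "\<theta> \<noteq> 0" using norm_a_eq_0_iff[OF a, of \<theta>] by (auto simp: S_def)
    then obtain k where "\<theta> $ k \<noteq> 0" by (auto simp: vec_eq_iff)
    hence "\<theta> \<in> P (k, 1) \<or> \<theta> \<in> P (k, -1)" using \<theta> by (auto simp: P_def S_def)
    thus "\<theta> \<in> (\<Union>p\<in>UNIV \<times> {1, -1}. P p)" by blast
  qed
  have eq: "emeasure \<sigma>\<^sub>1 (B \<inter> S) = emeasure \<sigma>\<^sub>2 (B \<inter> S)"
    by (rule patches[of "UNIV \<times> {1, -1}"]) (use B S_meas cover in auto)
  have "emeasure \<sigma> B = emeasure \<sigma> (B \<inter> S)"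
    if s: "sets \<sigma> = sets borel" "emeasure \<sigma> (- S) = 0" for \<sigma>
  proof -
    have "emeasure \<sigma> (B - S) \<le> emeasure \<sigma> (- S)"
      using s S_meas by (intro emeasure_mono) auto
    moreover have "B \<inter> S \<union> (B - S) = B" "B \<inter> S \<inter> (B - S) = {}" by auto
    ultimately show ?thesis using plus_emeasure[of "B \<inter> S" \<sigma> "B - S"] B S_meas s by auto
  qed
  thus "emeasure \<sigma>\<^sub>1 B = emeasure \<sigma>\<^sub>2 B" using eq sets null unfolding S_def by simp
qed

lemma surface_measure_ellipsoid:
  assumes a: "\<And>i. a $ i > 0"
  shows "surface_measure (frontier (ellipsoid a)) = cone_surface_measure a"
  unfolding surface_measure_def frontier_ellipsoid[OF a]
proof (rule the_equality)
  show cone: "is_surface_measure {x. norm_a a x = 1} (cone_surface_measure a)"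
    by (rule is_surface_measure_cone[OF a])
  show "\<sigma> = cone_surface_measure a" if "is_surface_measure {x. norm_a a x = 1} \<sigma>" for \<sigma>
    by (rule is_surface_measure_unique[OF a that cone])
qed

section \<open>Polar coordinates\<close>

lemma sets_mu_measure:
  assumes "\<And>i. a $ i > 0"
  shows "sets (mu_measure a s) = sets borel"
  by (simp add: mu_measure_def surface_measure_ellipsoid[OF assms])

text \<open>
  The factors \<open>|A \<theta>|\<close> of the surface measure and \<open>1 / |A \<theta>|\<close> of \<open>\<mu>\<close> cancel, and what remains is the cone
  measure with the density \<open>|\<theta>|\<^bsup>-n-2s\<^esup>\<close>.
\<close>
lemma nn_integral_mu_measure:
  fixes a :: "real^'n"
  assumes a: "\<And>i. a $ i > 0" and [measurable]: "f \<in> borel_measurable borel"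
  shows "(\<integral>\<^sup>+\<theta>. f \<theta> \<partial>mu_measure a s)
    = (\<integral>\<^sup>+y. ennreal (real CARD('n) * norm (y /\<^sub>R norm_a a y) powr (- (real CARD('n) + 2 * s)))
         * indicator {y. 0 < norm_a a y \<and> norm_a a y < 1} y * f (y /\<^sub>R norm_a a y) \<partial>lborel)"
proof -
  let ?d = "\<lambda>\<theta>. ennreal (1 / (norm \<theta> powr (real CARD('n) + 2 * s) * norm (diag_matrix a *v \<theta>)))"
  have "(\<integral>\<^sup>+\<theta>. f \<theta> \<partial>mu_measure a s) = (\<integral>\<^sup>+\<theta>. ?d \<theta> * f \<theta> \<partial>cone_surface_measure a)"
    unfolding mu_measure_def surface_measure_ellipsoid[OF a] by (subst nn_integral_density) auto
  also have "\<dots> = (\<integral>\<^sup>+y. ennreal (real CARD('n) * norm (diag_matrix a *v (y /\<^sub>R norm_a a y)))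
         * indicator {y. 0 < norm_a a y \<and> norm_a a y < 1} y * (?d (y /\<^sub>R norm_a a y) * f (y /\<^sub>R norm_a a y)) \<partial>lborel)"
    by (rule nn_integral_cone_surface_measure) measurable
  also have "\<dots> = (\<integral>\<^sup>+y. ennreal (real CARD('n) * norm (y /\<^sub>R norm_a a y) powr (- (real CARD('n) + 2 * s)))
         * indicator {y. 0 < norm_a a y \<and> norm_a a y < 1} y * f (y /\<^sub>R norm_a a y) \<partial>lborel)"
  proof (intro nn_integral_cong)
    fix y :: "real^'n"
    define w where "w = y /\<^sub>R norm_a a y"
    have "ennreal (real CARD('n) * norm (diag_matrix a *v w)) * ?d w = ennreal (real CARD('n) * norm w powr (- (real CARD('n) + 2 * s)))"
      if "0 < norm_a a y"
    proof -
      have "y \<noteq> 0" using that norm_a_eq_0_iff[OF a, of y] by auto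
      hence "w \<noteq> 0" using that by (simp add: w_def)
      hence "norm (diag_matrix a *v w) > 0" by (rule norm_diag_matrix_pos[OF a])
      thus ?thesis unfolding powr_minus by (subst ennreal_mult[symmetric]) (auto simp: field_simps)
    qed
    thus "ennreal (real CARD('n) * norm (diag_matrix a *v (y /\<^sub>R norm_a a y)))
         * indicator {y. 0 < norm_a a y \<and> norm_a a y < 1} y * (?d (y /\<^sub>R norm_a a y) * f (y /\<^sub>R norm_a a y))
      = ennreal (real CARD('n) * norm (y /\<^sub>R norm_a a y) powr (- (real CARD('n) + 2 * s)))
         * indicator {y. 0 < norm_a a y \<and> norm_a a y < 1} y * f (y /\<^sub>R norm_a a y)"
      unfolding w_def[symmetric]
      by (cases "0 < norm_a a y \<and> norm_a a y < 1") (auto simp: mult.assoc[symmetric])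
  qed
  finally show ?thesis .
qed

lemma norm_a_le_norm:
  assumes a: "\<And>i. a $ i > 0"
  shows "norm_a a x \<le> sqrt (\<Sum>i\<in>UNIV. a $ i) * norm x"
proof -
  have "(norm_a a x)\<^sup>2 \<le> (\<Sum>i\<in>UNIV. (\<Sum>j\<in>UNIV. a $ j) * (x $ i)\<^sup>2)"
    unfolding norm_a_square[OF a] using a
    by (intro sum_mono mult_right_mono member_le_sum) (auto simp: less_imp_le)
  also have "\<dots> = (\<Sum>j\<in>UNIV. a $ j) * (norm x)\<^sup>2"
    unfolding power2_norm_eq_inner inner_vec_def by (simp add: sum_distrib_left power2_eq_square)
  finally have "sqrt ((norm_a a x)\<^sup>2) \<le> sqrt ((\<Sum>j\<in>UNIV. a $ j) * (norm x)\<^sup>2)" by (rule real_sqrt_le_mono)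
  thus ?thesis using norm_a_nonneg[OF a, of x] by (simp add: real_sqrt_mult)
qed

lemma emeasure_ellipsoid_finite:
  fixes a :: "real^'n"
  assumes a: "\<And>i. a $ i > 0"
  shows "emeasure lborel {y. norm_a a y < 1} < \<infinity>"
proof -
  have "bounded {y. norm_a a y < 1}"
  proof (rule boundedI)
    fix y assume y: "y \<in> {y. norm_a a y < 1}"
    have "(norm y)\<^sup>2 = (\<Sum>i\<in>UNIV. (1 / a $ i) * (a $ i * (y $ i)\<^sup>2))"
      unfolding power2_norm_eq_inner inner_vec_def using a
      by (intro sum.cong) (auto simp: power2_eq_square less_imp_neq[symmetric])
    also have "\<dots> \<le> (\<Sum>i\<in>UNIV. (\<Sum>j\<in>UNIV. 1 / a $ j) * (a $ i * (y $ i)\<^sup>2))"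
      using a by (intro sum_mono mult_right_mono member_le_sum) (auto simp: less_imp_le)
    also have "\<dots> = (\<Sum>j\<in>UNIV. 1 / a $ j) * (norm_a a y)\<^sup>2"
      unfolding norm_a_square[OF a] by (rule sum_distrib_left[symmetric])
    also have "\<dots> \<le> (\<Sum>j\<in>UNIV. 1 / a $ j) * 1"
      using y norm_a_nonneg[OF a, of y] a
      by (intro mult_left_mono power_le_one sum_nonneg) (auto simp: less_imp_le)
    finally show "norm y \<le> sqrt (\<Sum>j\<in>UNIV. 1 / a $ j)" by (intro real_le_rsqrt) simp
  qed
  thus ?thesis using emeasure_bounded_finite by blast
qed

lemma finite_mu_measure:
  fixes a :: "real^'n"
  assumes a: "\<And>i. a $ i > 0" and s: "s > 0"
  shows "finite_measure (mu_measure a s)"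
proof (rule finite_measureI)
  define N where "N = real CARD('n) + 2 * s"
  define c where "c = 1 / sqrt (\<Sum>i\<in>UNIV. a $ i)"
  have "(\<Sum>i\<in>UNIV. a $ i) > 0" using a by (intro sum_pos) auto
  hence c: "c > 0" by (simp add: c_def)
  have N: "N > 0" using s by (simp add: N_def add_nonneg_pos)
  have "emeasure (mu_measure a s) (space (mu_measure a s)) = (\<integral>\<^sup>+\<theta>. 1 \<partial>mu_measure a s)" by simp
  also have "\<dots> = (\<integral>\<^sup>+y. ennreal (real CARD('n) * norm (y /\<^sub>R norm_a a y) powr (- N))
         * indicator {y. 0 < norm_a a y \<and> norm_a a y < 1} y * 1 \<partial>lborel)"
    unfolding N_def by (rule nn_integral_mu_measure[OF a]) simp
  also have "\<dots> \<le> (\<integral>\<^sup>+y. ennreal (real CARD('n) * c powr (- N)) * indicator {y. norm_a a y < 1} y \<partial>lborel)"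
  proof (intro nn_integral_mono)
    fix y :: "real^'n"
    have "norm (y /\<^sub>R norm_a a y) powr (- N) \<le> c powr (- N)" if "0 < norm_a a y"
    proof -
      have "norm_a a (y /\<^sub>R norm_a a y) = 1" using that by (simp add: norm_a_scaleR)
      hence "1 \<le> sqrt (\<Sum>i\<in>UNIV. a $ i) * norm (y /\<^sub>R norm_a a y)"
        using norm_a_le_norm[OF a, of "y /\<^sub>R norm_a a y"] by simp
      hence "c \<le> norm (y /\<^sub>R norm_a a y)"
        unfolding c_def using \<open>(\<Sum>i\<in>UNIV. a $ i) > 0\<close> by (simp add: divide_le_eq mult.commute)
      thus ?thesis using c N by (intro powr_mono2') auto
    qed
    thus "ennreal (real CARD('n) * norm (y /\<^sub>R norm_a a y) powr (- N))
         * indicator {y. 0 < norm_a a y \<and> norm_a a y < 1} y * 1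
      \<le> ennreal (real CARD('n) * c powr (- N)) * indicator {y. norm_a a y < 1} y"
      by (cases "0 < norm_a a y \<and> norm_a a y < 1") (auto intro!: ennreal_leI mult_left_mono)
  qed
  also have "\<dots> = ennreal (real CARD('n) * c powr (- N)) * emeasure lborel {y. norm_a a y < 1}"
    by (rule nn_integral_cmult_indicator) measurable
  also have "\<dots> < \<infinity>" using emeasure_ellipsoid_finite[OF a] by (simp add: ennreal_mult_less_top)
  finally show "emeasure (mu_measure a s) (space (mu_measure a s)) \<noteq> \<infinity>" by simp
qed

lemma nn_integral_powr_tail:
  assumes "d > 0" "n > (0::real)"
  shows "(\<integral>\<^sup>+\<rho>. ennreal (\<rho> powr (-1 - n)) * indicator {d<..} \<rho> \<partial>lborel) = ennreal (d powr (- n) / n)"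
proof -
  have "(\<integral>\<^sup>+\<rho>. ennreal (\<rho> powr (-1 - n)) * indicator {d<..} \<rho> \<partial>lborel)
      = (\<integral>\<^sup>+\<rho>. ennreal (\<rho> powr (-1 - n)) * indicator {d..} \<rho> \<partial>lborel)"
  proof (rule nn_integral_cong_AE)
    show "AE \<rho> in lborel. ennreal (\<rho> powr (-1 - n)) * indicator {d<..} \<rho> = ennreal (\<rho> powr (-1 - n)) * indicator {d..} \<rho>"
      using AE_lborel_singleton[of d] by eventually_elim (auto simp: indicator_def)
  qed
  also have "\<dots> = ennreal (- (d powr (-1 - n + 1)) / (-1 - n + 1))"
    using assms by (intro nn_integral_has_integral_lebesgue' has_integral_powr_to_inf) auto
  finally show ?thesis using assms by simp
qed

text \<open>
  Write the outer integral on the right as an integral over the points \<open>y\<close> of the ellipsoid and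
  substitute \<open>r = \<rho> |y|\<^sub>a\<close>, so that the argument of \<open>f\<close> becomes \<open>\<rho> y\<close>. Interchange the integrals, substitute
  \<open>y = x / \<rho>\<close>, and interchange again: the \<open>\<rho>\<close>-integral is now \<open>\<integral>\<^bsub>|x|\<^sub>a\<^esub>\<^sup>\<infinity> \<rho>\<^bsup>-1-n\<^esup> d\<rho> = |x|\<^sub>a\<^bsup>-n\<^esup> / n\<close>,
  which cancels the weight. Only Fubini's theorem and scaling are used.
\<close>
lemma nn_integral_mu_polar:
  fixes a :: "real^'n" and f :: "real^'n \<Rightarrow> ennreal"
  assumes a: "\<And>i. a $ i > 0" and [measurable]: "f \<in> borel_measurable borel"
  shows "(\<integral>\<^sup>+y. ennreal (norm y powr (- (real CARD('n) + 2 * s))) * f y \<partial>lborel)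
    = (\<integral>\<^sup>+\<theta>. (\<integral>\<^sup>+r\<in>{0<..}. ennreal (r powr (-1 - 2 * s)) * f (r *\<^sub>R \<theta>) \<partial>lborel) \<partial>mu_measure a s)"
proof -
  define n where "n = real CARD('n)"
  define N where "N = n + 2 * s"
  have n: "n > 0" by (simp add: n_def)
  define K where "K = (\<lambda>\<theta>. (\<integral>\<^sup>+r\<in>{0<..}. ennreal (r powr (-1 - 2 * s)) * f (r *\<^sub>R \<theta>) \<partial>lborel))"
  have [measurable]: "K \<in> borel_measurable borel" unfolding K_def by measurable
  \<comment> \<open>the integrand before the second substitution\<close>
  define W where "W = (\<lambda>(y::real^'n) \<rho>. ennreal (n * norm_a a y powr n * norm y powr (- N) * \<rho> powr (-1 - 2 * s))
      * indicator {0<..} \<rho> * indicator {y. 0 < norm_a a y \<and> norm_a a y < 1} y * f (\<rho> *\<^sub>R y))"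
  \<comment> \<open>the integrand after the second substitution\<close>
  define Z where "Z = (\<lambda>(x::real^'n) \<rho>. ennreal (n * norm_a a x powr n * norm x powr (- N)) * f x * indicator {x. 0 < norm_a a x} x
      * (ennreal (\<rho> powr (-1 - n)) * indicator {norm_a a x<..} \<rho>))"
  have pos: "norm x > 0" if "0 < norm_a a x" for x
    using that norm_a_eq_0_iff[OF a, of x] by auto
  have [measurable]: "(\<lambda>(y, \<rho>). W y \<rho>) \<in> borel_measurable (lborel \<Otimes>\<^sub>M lborel)"
    unfolding W_def by measurable
  have [measurable]: "(\<lambda>(y, \<rho>). Z y \<rho>) \<in> borel_measurable (lborel \<Otimes>\<^sub>M lborel)"
  proof -
    have eq: "Z x \<rho> = ennreal (n * norm_a a x powr n * norm x powr (- N)) * f x * indicator {x. 0 < norm_a a x} x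
      * (ennreal (\<rho> powr (-1 - n)) * (if norm_a a x < \<rho> then 1 else 0))" for x \<rho>
      by (simp add: Z_def indicator_def)
    show ?thesis unfolding eq by measurable
  qed
  have "(\<integral>\<^sup>+\<theta>. K \<theta> \<partial>mu_measure a s) = (\<integral>\<^sup>+y. ennreal (n * norm (y /\<^sub>R norm_a a y) powr (- N))
         * indicator {y. 0 < norm_a a y \<and> norm_a a y < 1} y * K (y /\<^sub>R norm_a a y) \<partial>lborel)"
    unfolding n_def N_def by (rule nn_integral_mu_measure[OF a]) measurable
  also have "\<dots> = (\<integral>\<^sup>+y. (\<integral>\<^sup>+\<rho>. W y \<rho> \<partial>lborel) \<partial>lborel)"
  proof (intro nn_integral_cong)
    fix y :: "real^'n"
    show "ennreal (n * norm (y /\<^sub>R norm_a a y) powr (- N)) * indicator {y. 0 < norm_a a y \<and> norm_a a y < 1} y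
        * K (y /\<^sub>R norm_a a y) = (\<integral>\<^sup>+\<rho>. W y \<rho> \<partial>lborel)"
    proof (cases "0 < norm_a a y \<and> norm_a a y < 1")
      case True
      define d where "d = norm_a a y"
      have d: "d > 0" "d < 1" and y: "norm y > 0" using True pos by (auto simp: d_def)
      have "K (y /\<^sub>R d) = (\<integral>\<^sup>+\<rho>\<in>{0<..}. ennreal d * (ennreal ((d * \<rho>) powr (-1 - 2 * s)) * f ((d * \<rho>) *\<^sub>R (y /\<^sub>R d))) \<partial>lborel)"
        unfolding K_def using d by (intro nn_integral_scale_positive) auto
      hence "ennreal (n * norm (y /\<^sub>R d) powr (- N)) * K (y /\<^sub>R d)
         = (\<integral>\<^sup>+\<rho>. ennreal (n * norm (y /\<^sub>R d) powr (- N)) * (ennreal d * (ennreal ((d * \<rho>) powr (-1 - 2 * s)) * f ((d * \<rho>) *\<^sub>R (y /\<^sub>R d))) * indicator {0<..} \<rho>) \<partial>lborel)"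
        by (simp only:) (intro nn_integral_cmult[symmetric], measurable)
      also have "\<dots> = (\<integral>\<^sup>+\<rho>. W y \<rho> \<partial>lborel)"
      proof (rule nn_integral_cong)
        fix \<rho> :: real
        show "ennreal (n * norm (y /\<^sub>R d) powr (- N)) * (ennreal d * (ennreal ((d * \<rho>) powr (-1 - 2 * s)) * f ((d * \<rho>) *\<^sub>R (y /\<^sub>R d))) * indicator {0<..} \<rho>) = W y \<rho>"
        proof (cases "\<rho> > 0")
          case \<rho>: True
          have "norm (y /\<^sub>R d) = norm y / d" using d by (simp add: divide_inverse mult.commute)
          hence "norm (y /\<^sub>R d) powr (- N) = norm y powr (- N) * d powr N"
            using d y by (simp add: powr_divide powr_minus_divide)
          moreover have "(d * \<rho>) powr (-1 - 2 * s) = d powr (-1 - 2 * s) * \<rho> powr (-1 - 2 * s)"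
            using d \<rho> by (simp add: powr_mult)
          moreover have "d powr N * (d * d powr (-1 - 2 * s)) = d powr n"
          proof -
            have "d powr N * (d powr 1 * d powr (-1 - 2 * s)) = d powr n"
              unfolding powr_add[symmetric] by (simp add: N_def)
            thus ?thesis using d by simp
          qed
          ultimately have "n * norm (y /\<^sub>R d) powr (- N) * d * (d * \<rho>) powr (-1 - 2 * s)
             = n * d powr n * norm y powr (- N) * \<rho> powr (-1 - 2 * s)" by algebra
          moreover have "(d * \<rho>) *\<^sub>R (y /\<^sub>R d) = \<rho> *\<^sub>R y" using d by simp
          moreover have "ennreal (n * norm (y /\<^sub>R d) powr (- N) * d * (d * \<rho>) powr (-1 - 2 * s))
             = ennreal (n * norm (y /\<^sub>R d) powr (- N)) * ennreal d * ennreal ((d * \<rho>) powr (-1 - 2 * s))"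
            using d n by (subst ennreal_mult, simp, simp, subst ennreal_mult) auto
          ultimately have "ennreal (n * d powr n * norm y powr (- N) * \<rho> powr (-1 - 2 * s)) * f (\<rho> *\<^sub>R y)
             = ennreal (n * norm (y /\<^sub>R d) powr (- N)) * ennreal d * ennreal ((d * \<rho>) powr (-1 - 2 * s)) * f ((d * \<rho>) *\<^sub>R (y /\<^sub>R d))"
            by (simp only:)
          moreover have "indicator {0<..} \<rho> = (1::ennreal)"
             "indicator {y. 0 < norm_a a y \<and> norm_a a y < 1} y = (1::ennreal)" using d \<rho> True by simp_all
          ultimately show ?thesis unfolding W_def d_def[symmetric] by (simp only: mult_1_right mult.assoc)
        qed (simp add: W_def)
      qed
      finally show ?thesis using True by (simp add: d_def)
    qed (simp add: W_def)
  qed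
  also have "\<dots> = (\<integral>\<^sup>+\<rho>. (\<integral>\<^sup>+y. W y \<rho> \<partial>lborel) \<partial>lborel)"
    by (rule lborel_pair.Fubini'[symmetric]) measurable
  also have "\<dots> = (\<integral>\<^sup>+\<rho>. (\<integral>\<^sup>+x. Z x \<rho> \<partial>lborel) \<partial>lborel)"
  proof (rule nn_integral_cong)
    fix \<rho> :: real
    show "(\<integral>\<^sup>+y. W y \<rho> \<partial>lborel) = (\<integral>\<^sup>+x. Z x \<rho> \<partial>lborel)"
    proof (cases "\<rho> > 0")
      case \<rho>: True
      have "(\<integral>\<^sup>+y. W y \<rho> \<partial>lborel) = ennreal ((1 / \<rho>) ^ CARD('n)) * (\<integral>\<^sup>+x. W ((1 / \<rho>) *\<^sub>R x) \<rho> \<partial>lborel)"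
        using \<rho> by (intro nn_integral_lborel_scaleR) auto
      also have "\<dots> = (\<integral>\<^sup>+x. ennreal ((1 / \<rho>) ^ CARD('n)) * W ((1 / \<rho>) *\<^sub>R x) \<rho> \<partial>lborel)"
        by (intro nn_integral_cmult[symmetric]) measurable
      also have "\<dots> = (\<integral>\<^sup>+x. Z x \<rho> \<partial>lborel)"
      proof (intro nn_integral_cong)
        fix x :: "real^'n"
        show "ennreal ((1 / \<rho>) ^ CARD('n)) * W ((1 / \<rho>) *\<^sub>R x) \<rho> = Z x \<rho>"
        proof (cases "0 < norm_a a x \<and> norm_a a x < \<rho>")
          case True
          define d where "d = norm_a a x"
          have d: "d > 0" "d < \<rho>" and x: "norm x > 0" using True pos by (auto simp: d_def)
          have na: "norm_a a ((1 / \<rho>) *\<^sub>R x) = d / \<rho>" using \<rho> by (simp add: norm_a_scaleR d_def)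
          have "norm ((1 / \<rho>) *\<^sub>R x) = norm x / \<rho>" using \<rho> by simp
          hence e1: "norm ((1 / \<rho>) *\<^sub>R x) powr (- N) = norm x powr (- N) * \<rho> powr N"
            using \<rho> x by (simp add: powr_divide powr_minus_divide)
          have e2: "(d / \<rho>) powr n = d powr n * \<rho> powr (- n)"
            using d \<rho> by (simp add: powr_divide powr_minus_divide)
          have e3: "(1 / \<rho>) ^ CARD('n) = \<rho> powr (- n)"
            using \<rho> by (simp add: n_def powr_minus powr_realpow inverse_eq_divide power_one_over)
          have e4: "\<rho> powr (- n) * (\<rho> powr (- n) * (\<rho> powr N * \<rho> powr (-1 - 2 * s))) = \<rho> powr (-1 - n)"
            unfolding powr_add[symmetric] by (intro arg_cong2[where f = "(powr)"] refl) (simp add: N_def)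
          have "(1 / \<rho>) ^ CARD('n) * (n * (d / \<rho>) powr n * norm ((1 / \<rho>) *\<^sub>R x) powr (- N) * \<rho> powr (-1 - 2 * s))
             = n * d powr n * norm x powr (- N) * \<rho> powr (-1 - n)"
            unfolding e1 e2 e3 e4[symmetric] by (simp only: mult_ac)
          hence "ennreal ((1 / \<rho>) ^ CARD('n)) * ennreal (n * (d / \<rho>) powr n * norm ((1 / \<rho>) *\<^sub>R x) powr (- N) * \<rho> powr (-1 - 2 * s))
             = ennreal (n * d powr n * norm x powr (- N)) * ennreal (\<rho> powr (-1 - n))"
            using \<rho> n by (subst (1 2) ennreal_mult[symmetric]) auto
          moreover have "W ((1 / \<rho>) *\<^sub>R x) \<rho> = ennreal (n * (d / \<rho>) powr n * norm ((1 / \<rho>) *\<^sub>R x) powr (- N) * \<rho> powr (-1 - 2 * s)) * f x"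
            unfolding W_def na using \<rho> d by (simp add: na)
          moreover have "Z x \<rho> = ennreal (n * d powr n * norm x powr (- N)) * ennreal (\<rho> powr (-1 - n)) * f x"
            using True by (simp add: Z_def d_def mult_ac)
          ultimately show ?thesis by (simp only: mult.assoc[symmetric])
        next
          case False
          hence "W ((1 / \<rho>) *\<^sub>R x) \<rho> = 0" using \<rho> by (auto simp: W_def norm_a_scaleR indicator_def divide_less_eq zero_less_divide_iff)
          moreover have "Z x \<rho> = 0" using False by (auto simp: Z_def indicator_def)
          ultimately show ?thesis by simp
        qed
      qed
      finally show ?thesis .
    next
      case False
      have "Z x \<rho> = 0" for x using False norm_a_nonneg[OF a, of x] by (auto simp: Z_def indicator_def)
      thus ?thesis using False by (simp add: W_def)
    qed
  qed
  also have "\<dots> = (\<integral>\<^sup>+x. (\<integral>\<^sup>+\<rho>. Z x \<rho> \<partial>lborel) \<partial>lborel)"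
    by (rule lborel_pair.Fubini') measurable
  also have "\<dots> = (\<integral>\<^sup>+y. ennreal (norm y powr (- N)) * f y \<partial>lborel)"
  proof (rule nn_integral_cong_AE)
    have "(\<integral>\<^sup>+\<rho>. Z x \<rho> \<partial>lborel) = ennreal (norm x powr (- N)) * f x" if "x \<noteq> 0" for x
    proof -
      define d where "d = norm_a a x"
      have d: "d > 0" using that norm_a_eq_0_iff[OF a, of x] norm_a_nonneg[OF a, of x] by (simp add: d_def)
      have "(\<integral>\<^sup>+\<rho>. Z x \<rho> \<partial>lborel) = (\<integral>\<^sup>+\<rho>. (ennreal (n * d powr n * norm x powr (- N)) * f x)
            * (ennreal (\<rho> powr (-1 - n)) * indicator {d<..} \<rho>) \<partial>lborel)"
        using d by (intro nn_integral_cong) (simp add: Z_def d_def)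
      also have "\<dots> = (ennreal (n * d powr n * norm x powr (- N)) * f x) * ennreal (d powr (- n) / n)"
        unfolding nn_integral_powr_tail[OF d n, symmetric] by (intro nn_integral_cmult) measurable
      also have "\<dots> = ennreal (n * d powr n * norm x powr (- N) * (d powr (- n) / n)) * f x"
        using n by (subst ennreal_mult) (auto simp: mult_ac)
      also have "n * d powr n * norm x powr (- N) * (d powr (- n) / n) = norm x powr (- N)"
        using d n by (simp add: powr_minus field_simps)
      finally show ?thesis .
    qed
    thus "AE y in lborel. (\<integral>\<^sup>+\<rho>. Z y \<rho> \<partial>lborel) = ennreal (norm y powr (- N)) * f y"
      using AE_lborel_singleton[of "0 :: real^'n"] by (auto elim!: eventually_mono)
  qed
  finally show ?thesis by (simp add: K_def N_def n_def)
qed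

lemma AE_mu_measure:
  fixes a :: "real^'n"
  assumes a: "\<And>i. a $ i > 0"
  shows "AE \<theta> in mu_measure a s. norm_a a \<theta> = 1"
proof (rule AE_I[of _ _ "- {\<theta>. norm_a a \<theta> = 1}"])
  have [measurable]: "- {\<theta>. norm_a a \<theta> = 1} \<in> sets borel" by measurable
  show "- {\<theta>. norm_a a \<theta> = 1} \<in> sets (mu_measure a s)" by (simp add: sets_mu_measure[OF a])
  have "emeasure (mu_measure a s) (- {\<theta>. norm_a a \<theta> = 1})
      = (\<integral>\<^sup>+\<theta>. indicator (- {\<theta>. norm_a a \<theta> = 1}) \<theta> \<partial>mu_measure a s)"
    by (subst nn_integral_indicator) (auto simp: sets_mu_measure[OF a])
  also have "\<dots> = (\<integral>\<^sup>+y. 0 \<partial>(lborel :: (real^'n) measure))"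
  proof (subst nn_integral_mu_measure[OF a], measurable, intro nn_integral_cong)
    fix y :: "real^'n"
    have "norm_a a (y /\<^sub>R norm_a a y) = 1" if "0 < norm_a a y"
      using that by (simp add: norm_a_scaleR)
    thus "ennreal (real CARD('n) * norm (y /\<^sub>R norm_a a y) powr (- (real CARD('n) + 2 * s))) *
        indicator {y. 0 < norm_a a y \<and> norm_a a y < 1} y * indicator (- {x. norm_a a x = 1}) (y /\<^sub>R norm_a a y) = 0"
      by (auto simp: indicator_def)
  qed
  finally show "emeasure (mu_measure a s) (- {\<theta>. norm_a a \<theta> = 1}) = 0" by simp
qed auto

text \<open>
  Signed functions are split into positive and negative parts. The bound on the rays is uniform, so with
  \<open>\<mu>\<close> finite all integrals of the parts are finite and may be subtracted.
\<close>
lemma integral_mu_polar: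
  fixes a :: "real^'n" and h :: "real^'n \<Rightarrow> real"
  assumes a: "\<And>i. a $ i > 0" and s: "s > 0" and h [measurable]: "h \<in> borel_measurable borel"
    and bound: "\<And>\<theta>. norm_a a \<theta> = 1 \<Longrightarrow>
      (\<integral>\<^sup>+r\<in>{0<..}. ennreal (\<bar>h (r *\<^sub>R \<theta>)\<bar> * r powr (-1 - 2 * s)) \<partial>lborel) \<le> ennreal C"
  shows "integrable lborel (\<lambda>y. h y / norm y powr (real CARD('n) + 2 * s))"
    and "(\<integral>y. h y / norm y powr (real CARD('n) + 2 * s) \<partial>lborel)
      = (\<integral>\<theta>. (LINT r:{0<..}|lborel. h (r *\<^sub>R \<theta>) * r powr (-1 - 2 * s)) \<partial>mu_measure a s)"
proof -
  interpret finite_measure "mu_measure a s" by (rule finite_mu_measure[OF a s])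
  note sets_mu [measurable_cong] = sets_mu_measure[OF a, of s]
  define N where "N = real CARD('n) + 2 * s"
  \<comment> \<open>\<open>u\<close> will be the absolute value or multiplication by \<open>1\<close> or \<open>-1\<close>\<close>
  define I where "I = (\<lambda>(u::real \<Rightarrow> real) \<theta>. (\<integral>\<^sup>+r\<in>{0<..}. ennreal (r powr (-1 - 2 * s)) * ennreal (u (h (r *\<^sub>R \<theta>))) \<partial>lborel))"
  have I_meas [measurable]: "I u \<in> borel_measurable borel" if [measurable]: "u \<in> borel_measurable borel" for u
    unfolding I_def by measurable
  have polar: "(\<integral>\<^sup>+y. ennreal (norm y powr (- N)) * ennreal (u (h y)) \<partial>lborel) = (\<integral>\<^sup>+\<theta>. I u \<theta> \<partial>mu_measure a s)"
    if [measurable]: "u \<in> borel_measurable borel" for u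
    unfolding I_def N_def by (rule nn_integral_mu_polar[OF a]) measurable
  have I_abs: "I abs \<theta> \<le> ennreal C" if "norm_a a \<theta> = 1" for \<theta>
  proof -
    have "I abs \<theta> = (\<integral>\<^sup>+r\<in>{0<..}. ennreal (\<bar>h (r *\<^sub>R \<theta>)\<bar> * r powr (-1 - 2 * s)) \<partial>lborel)"
      unfolding I_def by (intro nn_integral_cong) (auto simp: ennreal_mult' indicator_def mult.commute)
    thus ?thesis using bound[OF that] by simp
  qed
  have I_le: "I u \<theta> \<le> ennreal C" if "norm_a a \<theta> = 1" "\<And>x. u x \<le> \<bar>x\<bar>" for u \<theta>
  proof -
    have "I u \<theta> \<le> I abs \<theta>" unfolding I_def
      by (intro nn_integral_mono mult_right_mono mult_left_mono ennreal_leI that) auto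
    thus ?thesis using I_abs[OF that(1)] by (rule order_trans)
  qed
  have total: "(\<integral>\<^sup>+\<theta>. I u \<theta> \<partial>mu_measure a s) < \<infinity>" if "\<And>x. u x \<le> \<bar>x\<bar>" for u
  proof -
    have "(\<integral>\<^sup>+\<theta>. I u \<theta> \<partial>mu_measure a s) \<le> (\<integral>\<^sup>+\<theta>. ennreal C \<partial>mu_measure a s)"
      using AE_mu_measure[OF a, of s] by (intro nn_integral_mono_AE) (auto elim!: eventually_mono intro: I_le that)
    also have "\<dots> < \<infinity>" using emeasure_finite[of "space (mu_measure a s)"]
      by (auto simp: ennreal_mult_eq_top_iff less_top[symmetric])
    finally show ?thesis .
  qed
  have div: "h y / norm y powr N = norm y powr (- N) * h y" for y
    by (simp add: powr_minus divide_inverse mult.commute)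
  have nn_eq: "(\<integral>\<^sup>+y. ennreal (c * (h y / norm y powr N)) \<partial>lborel) = (\<integral>\<^sup>+\<theta>. I (\<lambda>x. c * x) \<theta> \<partial>mu_measure a s)" for c
  proof -
    have "(\<integral>\<^sup>+y. ennreal (c * (h y / norm y powr N)) \<partial>lborel)
        = (\<integral>\<^sup>+y. ennreal (norm y powr (- N)) * ennreal (c * h y) \<partial>lborel)"
      unfolding div by (intro nn_integral_cong) (simp add: ennreal_mult'[symmetric] mult.left_commute)
    also have "\<dots> = (\<integral>\<^sup>+\<theta>. I (\<lambda>x. c * x) \<theta> \<partial>mu_measure a s)" by (rule polar) measurable
    finally show ?thesis .
  qed
  have integrable: "integrable lborel (\<lambda>y. h y / norm y powr N)"
  proof (rule integrableI_bounded)
    have "(\<integral>\<^sup>+y. ennreal (norm (h y / norm y powr N)) \<partial>lborel)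
        = (\<integral>\<^sup>+y. ennreal (norm y powr (- N)) * ennreal \<bar>h y\<bar> \<partial>lborel)"
      unfolding div by (intro nn_integral_cong) (simp add: ennreal_mult'[symmetric] abs_mult)
    also have "\<dots> = (\<integral>\<^sup>+\<theta>. I abs \<theta> \<partial>mu_measure a s)" by (rule polar) measurable
    also have "\<dots> < \<infinity>" by (rule total) simp
    finally show "(\<integral>\<^sup>+y. ennreal (norm (h y / norm y powr N)) \<partial>lborel) < \<infinity>" .
  qed measurable
  thus "integrable lborel (\<lambda>y. h y / norm y powr (real CARD('n) + 2 * s))" by (simp add: N_def)
  have fin: "AE \<theta> in mu_measure a s. ennreal (enn2real (I (\<lambda>x. c * x) \<theta>)) = I (\<lambda>x. c * x) \<theta>" if "\<bar>c\<bar> \<le> 1" for c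
    using AE_mu_measure[OF a, of s]
  proof eventually_elim
    case (elim \<theta>)
    have "c * x \<le> \<bar>x\<bar>" for x
    proof -
      have "c * x \<le> \<bar>c\<bar> * \<bar>x\<bar>" using abs_ge_self[of "c * x"] by (simp only: abs_mult)
      also have "\<dots> \<le> 1 * \<bar>x\<bar>" using that by (intro mult_right_mono) auto
      finally show ?thesis by simp
    qed
    from I_le[OF elim this] have "I (\<lambda>x. c * x) \<theta> < \<infinity>" using ennreal_less_top le_less_trans by (metis infinity_ennreal_def)
    thus ?case by simp
  qed
  have int: "integrable (mu_measure a s) (\<lambda>\<theta>. enn2real (I (\<lambda>x. c * x) \<theta>))"
    "(\<integral>\<theta>. enn2real (I (\<lambda>x. c * x) \<theta>) \<partial>mu_measure a s) = enn2real (\<integral>\<^sup>+\<theta>. I (\<lambda>x. c * x) \<theta> \<partial>mu_measure a s)"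
    if c: "\<bar>c\<bar> = 1" for c
  proof -
    have le: "c * x \<le> \<bar>x\<bar>" for x using c by (cases "c \<ge> 0") auto
    have eq: "(\<integral>\<^sup>+\<theta>. ennreal (enn2real (I (\<lambda>x. c * x) \<theta>)) \<partial>mu_measure a s) = (\<integral>\<^sup>+\<theta>. I (\<lambda>x. c * x) \<theta> \<partial>mu_measure a s)"
      using fin[of c] c by (intro nn_integral_cong_AE) auto
    show "integrable (mu_measure a s) (\<lambda>\<theta>. enn2real (I (\<lambda>x. c * x) \<theta>))"
      using total[of "\<lambda>x. c * x"] le eq by (intro integrableI_nonneg) auto
    show "(\<integral>\<theta>. enn2real (I (\<lambda>x. c * x) \<theta>) \<partial>mu_measure a s) = enn2real (\<integral>\<^sup>+\<theta>. I (\<lambda>x. c * x) \<theta> \<partial>mu_measure a s)"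
      using eq by (subst integral_eq_nn_integral) auto
  qed
  have "(\<integral>y. h y / norm y powr N \<partial>lborel)
     = enn2real (\<integral>\<^sup>+\<theta>. I (\<lambda>x. 1 * x) \<theta> \<partial>mu_measure a s) - enn2real (\<integral>\<^sup>+\<theta>. I (\<lambda>x. (-1) * x) \<theta> \<partial>mu_measure a s)"
    unfolding nn_eq[symmetric] real_lebesgue_integral_def[OF integrable] by simp
  also have "\<dots> = (\<integral>\<theta>. enn2real (I (\<lambda>x. 1 * x) \<theta>) - enn2real (I (\<lambda>x. (-1) * x) \<theta>) \<partial>mu_measure a s)"
    using int[of 1] int[of "-1"] by simp
  also have "\<dots> = (\<integral>\<theta>. (LINT r:{0<..}|lborel. h (r *\<^sub>R \<theta>) * r powr (-1 - 2 * s)) \<partial>mu_measure a s)"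
  proof (rule integral_cong_AE)
    show "(\<lambda>\<theta>. LINT r:{0<..}|lborel. h (r *\<^sub>R \<theta>) * r powr (-1 - 2 * s)) \<in> borel_measurable (mu_measure a s)"
      unfolding set_lebesgue_integral_def by measurable
    show "AE \<theta> in mu_measure a s. enn2real (I (\<lambda>x. 1 * x) \<theta>) - enn2real (I (\<lambda>x. (-1) * x) \<theta>)
       = (LINT r:{0<..}|lborel. h (r *\<^sub>R \<theta>) * r powr (-1 - 2 * s))"
      using AE_mu_measure[OF a, of s]
    proof eventually_elim
      case (elim \<theta>)
      define v where "v = (\<lambda>r. indicator {0<..} r *\<^sub>R (h (r *\<^sub>R \<theta>) * r powr (-1 - 2 * s)))"
      have "(\<integral>\<^sup>+r. ennreal (norm (v r)) \<partial>lborel) = I abs \<theta>"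
        unfolding I_def v_def by (intro nn_integral_cong) (auto simp: ennreal_mult' indicator_def mult.commute abs_mult)
      also have "\<dots> < \<infinity>" using I_abs[OF elim] le_less_trans[of _ "ennreal C" \<infinity>] by simp
      finally have "integrable lborel v" unfolding v_def by (intro integrableI_bounded) measurable
      from real_lebesgue_integral_def[OF this]
      have "(\<integral>r. v r \<partial>lborel) = enn2real (\<integral>\<^sup>+r. ennreal (v r) \<partial>lborel) - enn2real (\<integral>\<^sup>+r. ennreal (- v r) \<partial>lborel)" .
      moreover have v: "ennreal (c * v r) = ennreal (r powr (-1 - 2 * s)) * ennreal (c * h (r *\<^sub>R \<theta>)) * indicator {0<..} r" for c r
      proof (cases "r > 0")
        case True
        have "ennreal (c * h (r *\<^sub>R \<theta>) * r powr (-1 - 2 * s)) = ennreal (c * h (r *\<^sub>R \<theta>)) * ennreal (r powr (-1 - 2 * s))"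
          by (rule ennreal_mult'') simp
        thus ?thesis using True by (simp add: v_def mult_ac)
      qed (simp add: v_def)
      have "(\<integral>\<^sup>+r. ennreal (c * v r) \<partial>lborel) = I (\<lambda>x. c * x) \<theta>" for c
        unfolding I_def v ..
      from this[of 1] this[of "-1"]
      have "(\<integral>\<^sup>+r. ennreal (v r) \<partial>lborel) = I (\<lambda>x. 1 * x) \<theta>"
        "(\<integral>\<^sup>+r. ennreal (- v r) \<partial>lborel) = I (\<lambda>x. (-1) * x) \<theta>" by (simp_all only: mult_1_left mult_minus1)
      ultimately show ?case by (simp add: set_lebesgue_integral_def v_def)
    qed
  qed measurable
  finally show "(\<integral>y. h y / norm y powr (real CARD('n) + 2 * s) \<partial>lborel)
      = (\<integral>\<theta>. (LINT r:{0<..}|lborel. h (r *\<^sub>R \<theta>) * r powr (-1 - 2 * s)) \<partial>mu_measure a s)"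
    by (simp add: N_def)
qed

section \<open>The fractional Laplacian along lines\<close>

lemma norm_a_line:
  assumes "\<And>i. a $ i > 0"
  shows "(norm_a a (x + t *\<^sub>R \<theta>))\<^sup>2 = (norm_a a x)\<^sup>2 + 2 * t * inner_a a x \<theta> + t\<^sup>2 * (norm_a a \<theta>)\<^sup>2"
  unfolding norm_a_square[OF assms] inner_a_eq_sum
  by (simp add: sum_distrib_left sum.distrib[symmetric] power2_eq_square algebra_simps)

text \<open>
  The quadratic \<open>t \<mapsto> |x + t \<theta>|\<^sub>a\<^sup>2\<close> is non-negative at its minimum.
\<close>
lemma inner_a_Cauchy_Schwarz:
  assumes a: "\<And>i. a $ i > 0"
  shows "(inner_a a x \<theta>)\<^sup>2 \<le> (norm_a a x)\<^sup>2 * (norm_a a \<theta>)\<^sup>2"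
proof (cases "\<theta> = 0")
  case False
  define b where "b = (norm_a a \<theta>)\<^sup>2"
  define p where "p = inner_a a x \<theta>"
  have b: "b > 0" using False norm_a_eq_0_iff[OF a, of \<theta>] by (simp add: b_def)
  have "0 \<le> (norm_a a (x + (- p / b) *\<^sub>R \<theta>))\<^sup>2" by simp
  also have "\<dots> = (norm_a a x)\<^sup>2 - p\<^sup>2 / b"
    unfolding norm_a_line[OF a] p_def[symmetric] b_def[symmetric] using b
    by (simp add: field_simps power2_eq_square)
  finally show ?thesis using b by (simp add: field_simps b_def p_def)
qed (simp add: inner_a_eq_sum)

text \<open>
  Complete the square: \<open>1 - |x + t \<theta>|\<^sub>a\<^sup>2 = R\<^sup>2 - (p + t)\<^sup>2\<close>.
\<close>
lemma u_pow_line: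
  assumes a: "\<And>i. a $ i > 0" and x: "x \<in> ellipsoid a" and \<theta>: "norm_a a \<theta> = 1"
  defines "R \<equiv> sqrt (u_pow a 1 x + (inner_a a x \<theta>)\<^sup>2)"
  shows "u_pow a \<beta> (x + t *\<^sub>R \<theta>) = R powr (2 * \<beta>) * bump \<beta> ((inner_a a x \<theta> + t) / R)"
proof -
  define p where "p = inner_a a x \<theta>"
  have nx: "norm_a a x < 1" "norm_a a x \<ge> 0" using x norm_a_nonneg[OF a] by (auto simp: ellipsoid_def)
  hence n2: "(norm_a a x)\<^sup>2 < 1" by (simp add: abs_square_less_1)
  hence u1: "u_pow a 1 x = 1 - (norm_a a x)\<^sup>2" using x by (simp add: u_pow_def)
  have R2: "u_pow a 1 x + p\<^sup>2 > 0" using u1 n2 by (simp add: add_pos_nonneg)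
  hence R: "R > 0" "R\<^sup>2 = u_pow a 1 x + p\<^sup>2" by (auto simp: R_def p_def)
  have eq: "1 - (norm_a a (x + t *\<^sub>R \<theta>))\<^sup>2 = R\<^sup>2 - (p + t)\<^sup>2"
    unfolding norm_a_line[OF a] R(2) u1 \<theta> p_def[symmetric] by (simp add: power2_eq_square algebra_simps)
  have eq': "R\<^sup>2 - (p + t)\<^sup>2 = R\<^sup>2 * (1 - ((p + t) / R)\<^sup>2)"
    using R(1) by (simp add: field_simps)
  have "x + t *\<^sub>R \<theta> \<in> ellipsoid a \<longleftrightarrow> 0 < 1 - (norm_a a (x + t *\<^sub>R \<theta>))\<^sup>2"
    using norm_a_nonneg[OF a, of "x + t *\<^sub>R \<theta>"] by (auto simp: ellipsoid_def abs_square_less_1)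
  also have "\<dots> \<longleftrightarrow> \<bar>(p + t) / R\<bar> < 1"
    unfolding eq eq' using R(1) by (simp add: zero_less_mult_iff abs_square_less_1 del: abs_divide)
  finally have iff: "x + t *\<^sub>R \<theta> \<in> ellipsoid a \<longleftrightarrow> \<bar>(p + t) / R\<bar> < 1" .
  show ?thesis
  proof (cases "\<bar>(p + t) / R\<bar> < 1")
    case True
    have "((p + t) / R)\<^sup>2 < 1" using True by (simp only: abs_square_less_1)
    have "(R\<^sup>2 * (1 - ((p + t) / R)\<^sup>2)) powr \<beta> = (R\<^sup>2) powr \<beta> * (1 - ((p + t) / R)\<^sup>2) powr \<beta>"
      by (rule powr_mult)
    also have "(R\<^sup>2) powr \<beta> = R powr (2 * \<beta>)" using R(1) powr_powr[of R 2 \<beta>] by (simp add: powr_numeral)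
    finally show ?thesis using True iff unfolding p_def[symmetric] by (simp add: u_pow_def eq eq' bump_def)
  qed (use iff in \<open>auto simp: u_pow_def bump_def p_def\<close>)
qed

lemma finite_diff_line:
  assumes a: "\<And>i. a $ i > 0" and x: "x \<in> ellipsoid a" and \<theta>: "norm_a a \<theta> = 1"
  defines "R \<equiv> sqrt (u_pow a 1 x + (inner_a a x \<theta>)\<^sup>2)"
  shows "finite_diff m (u_pow a \<beta>) x (r *\<^sub>R \<theta>) = R powr (2 * \<beta>) * central_diff m \<beta> (inner_a a x \<theta> / R) (r / R)"
proof -
  have "u_pow a \<beta> (x + of_int k *\<^sub>R r *\<^sub>R \<theta>) = R powr (2 * \<beta>) * bump \<beta> (inner_a a x \<theta> / R + of_int k * (r / R))" for k
    using u_pow_line[OF a x \<theta>, of \<beta> "of_int k * r"] by (simp add: R_def add_divide_distrib)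
  thus ?thesis
    by (simp add: finite_diff_def central_diff_def central_coeff_def sum_distrib_left mult_ac)
qed

lemma borel_measurable_u_pow [measurable]: "u_pow a \<beta> \<in> borel_measurable borel"
  unfolding u_pow_def[abs_def] ellipsoid_def by measurable

lemma borel_measurable_finite_diff [measurable]:
  fixes f :: "real^'n \<Rightarrow> real"
  assumes [measurable]: "f \<in> borel_measurable borel"
  shows "finite_diff m f x \<in> borel_measurable borel"
  unfolding finite_diff_def[abs_def] by measurable

section \<open>The fractional Laplacian of the power\<close>

lemma hyp2F1_bounded:
  assumes "c > 0" "0 \<le> q" "q < 1" "\<bar>z\<bar> \<le> q"
  shows "\<bar>hyp2F1 a b c z\<bar> \<le> (\<Sum>k. norm (pochhammer a k * pochhammer b k / (pochhammer c k * fact k) * q ^ k))"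
proof -
  let ?t = "\<lambda>z k. pochhammer a k * pochhammer b k / (pochhammer c k * fact k) * z ^ k"
  have z: "\<bar>z\<bar> < 1" and q: "\<bar>q\<bar> < 1" using assms by auto
  have "\<bar>hyp2F1 a b c z\<bar> = norm (\<Sum>k. ?t z k)"
    using hyp2F1_sums[OF assms(1) z] by (simp add: sums_iff)
  also have "\<dots> \<le> (\<Sum>k. norm (?t z k))"
    by (rule summable_norm[OF summable_hypergeometric[OF assms(1) z]])
  also have "\<dots> \<le> (\<Sum>k. norm (?t q k))"
  proof (rule suminf_le[OF _ summable_hypergeometric[OF assms(1) z] summable_hypergeometric[OF assms(1) q]])
    fix k
    have "\<bar>z\<bar> ^ k \<le> \<bar>q\<bar> ^ k" using assms by (intro power_mono) auto
    thus "norm (?t z k) \<le> norm (?t q k)"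
      unfolding real_norm_def abs_mult[where b = "z ^ k"] abs_mult[where b = "q ^ k"] power_abs
      by (intro mult_left_mono) auto
  qed
  finally show ?thesis .
qed

lemma borel_measurable_hyp2F1 [measurable]: "hyp2F1 a b c \<in> borel_measurable borel"
  unfolding hyp2F1_def[abs_def] by measurable

theorem theorem3p2:
  fixes a x :: "real^'n" and s \<beta> :: real and m :: nat
  assumes "\<And>i. a $ i > 0"
    and "s > 0"
    and "\<beta> > -1"
    and "real m > s"
    and "x \<in> ellipsoid a"
  shows "let F = (\<lambda>\<theta>.
      (u_pow a 1 x + (inner_a a x \<theta>)\<^sup>2) powr (\<beta> - s) *
      hyp2F1 (s + 1/2) (- \<beta> + s) (1/2)
        ((inner_a a x \<theta>)\<^sup>2 / (u_pow a 1 x + (inner_a a x \<theta>)\<^sup>2)))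
    in
    integrable lborel (frac_laplacian_integrand m s (u_pow a \<beta>) x) \<and>
    set_integrable (mu_measure a s) (frontier (ellipsoid a)) F \<and>
    frac_laplacian m s (u_pow a \<beta>) x =
      2 powr (2 * s - 1) * Gamma (1/2 + s) * Gamma (1 + \<beta>) * frac_const CARD('n) m s *
        rGamma (1 + \<beta> - s) / (Gamma (1/2) * frac_const 1 m s) *
      (LINT \<theta>:frontier (ellipsoid a)|mu_measure a s. F \<theta>)"
proof -
  note a = assms(1)
  interpret finite_measure "mu_measure a s" by (rule finite_mu_measure[OF a assms(2)])
  note sets_mu [measurable_cong] = sets_mu_measure[OF a, of s]
  define u where "u = u_pow a 1 x"
  define q where "q = norm_a a x"
  define p where "p = inner_a a x"
  define R where "R = (\<lambda>\<theta>. sqrt (u + (p \<theta>)\<^sup>2))"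
  define z where "z = (\<lambda>\<theta>. p \<theta> / R \<theta>)"
  define F where "F = (\<lambda>\<theta>. (u + (p \<theta>)\<^sup>2) powr (\<beta> - s) *
      hyp2F1 (s + 1/2) (- \<beta> + s) (1/2) ((p \<theta>)\<^sup>2 / (u + (p \<theta>)\<^sup>2)))"
  define h where "h = finite_diff m (u_pow a \<beta>) x"
  define S where "S = frontier (ellipsoid a)"
  have S: "S = {\<theta>. norm_a a \<theta> = 1}" unfolding S_def by (rule frontier_ellipsoid[OF a])
  have S_meas [measurable]: "S \<in> sets borel" unfolding S by measurable
  have p_meas [measurable]: "p \<in> borel_measurable borel"
    unfolding p_def inner_a_def by (intro borel_measurable_continuous_onI continuous_intros)
  have h_meas [measurable]: "h \<in> borel_measurable borel" unfolding h_def by measurable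
  have q: "0 \<le> q" "q < 1" using assms(5) norm_a_nonneg[OF a] by (auto simp: q_def ellipsoid_def)
  have q2: "q\<^sup>2 < 1" using q by (simp add: abs_square_less_1)
  have u: "u = 1 - q\<^sup>2" "u > 0" using assms(5) q2 by (auto simp: u_def u_pow_def q_def)
  have R: "R \<theta> > 0" "(R \<theta>)\<^sup>2 = u + (p \<theta>)\<^sup>2" for \<theta>
    using u(2) by (auto simp: R_def add_pos_nonneg)
  have p2: "(p \<theta>)\<^sup>2 \<le> q\<^sup>2" if "\<theta> \<in> S" for \<theta>
    using inner_a_Cauchy_Schwarz[OF a, of x \<theta>] that by (simp add: S p_def q_def)
  have z2: "(z \<theta>)\<^sup>2 = (p \<theta>)\<^sup>2 / (u + (p \<theta>)\<^sup>2)" for \<theta>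
    by (simp add: z_def power_divide R(2))
  \<comment> \<open>the argument of the hypergeometric function stays in a compact subset of the unit interval\<close>
  have z2q: "(z \<theta>)\<^sup>2 \<le> q\<^sup>2" if "\<theta> \<in> S" for \<theta>
  proof -
    have "(p \<theta>)\<^sup>2 * (1 - q\<^sup>2) \<le> q\<^sup>2 * (1 - q\<^sup>2)" using p2[OF that] q2 by (intro mult_right_mono) auto
    hence "(p \<theta>)\<^sup>2 \<le> q\<^sup>2 * (u + (p \<theta>)\<^sup>2)" unfolding u(1) by (simp add: algebra_simps)
    thus ?thesis unfolding z2 using R(1)[of \<theta>] R(2)[of \<theta>] by (simp add: divide_le_eq u(2) add_pos_nonneg)
  qed
  have zq: "\<bar>z \<theta>\<bar> \<le> q" if "\<theta> \<in> S" for \<theta>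
    using z2q[OF that] q(1) by (simp add: abs_le_square_iff[symmetric])
  have powr_R: "R \<theta> powr (2 * \<beta> - 2 * s) = (u + (p \<theta>)\<^sup>2) powr (\<beta> - s)" for \<theta>
  proof -
    have "R \<theta> powr (2 * \<beta> - 2 * s) = (R \<theta> powr 2) powr (\<beta> - s)" by (simp add: powr_powr algebra_simps)
    also have "R \<theta> powr 2 = (R \<theta>)\<^sup>2" using R(1)[of \<theta>] by simp
    finally show ?thesis by (simp only: R(2))
  qed
  \<comment> \<open>\<open>R\<^sup>2\<close> lies between \<open>u\<close> and \<open>1\<close>; the two terms cover both signs of \<open>\<beta> - s\<close>\<close>
  define M where "M = 1 + u powr (\<beta> - s)"
  have M: "(u + (p \<theta>)\<^sup>2) powr (\<beta> - s) \<le> M" if "\<theta> \<in> S" for \<theta>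
  proof (cases "\<beta> - s \<ge> 0")
    case True
    have "(u + (p \<theta>)\<^sup>2) powr (\<beta> - s) \<le> 1 powr (\<beta> - s)"
      using True p2[OF that] u by (intro powr_mono2) auto
    thus ?thesis by (simp add: M_def add_increasing2)
  next
    case False
    have "(u + (p \<theta>)\<^sup>2) powr (\<beta> - s) \<le> u powr (\<beta> - s)"
      using False u by (intro powr_mono2') auto
    thus ?thesis by (simp add: M_def)
  qed
  have radial: "h (r *\<^sub>R \<theta>) = R \<theta> powr (2 * \<beta>) * central_diff m \<beta> (z \<theta>) (r / R \<theta>)" if "\<theta> \<in> S" for \<theta> r
    using finite_diff_line[OF a assms(5), of \<theta> m \<beta> r] that by (simp add: h_def S R_def z_def p_def u_def)
  have scale: "c powr (2 * \<beta>) * (c * (c * r) powr (-1 - 2 * s)) = c powr (2 * \<beta> - 2 * s) * r powr (-1 - 2 * s)"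
    if "c > 0" "r > 0" for c r :: real
  proof -
    have "c powr (2 * \<beta>) * (c powr 1 * c powr (-1 - 2 * s)) = c powr (2 * \<beta> - 2 * s)"
      unfolding powr_add[symmetric] by (intro arg_cong2[where f = "(powr)"] refl) simp
    moreover have "(c * r) powr (-1 - 2 * s) = c powr (-1 - 2 * s) * r powr (-1 - 2 * s)"
      by (rule powr_mult)
    ultimately show ?thesis using that by (simp add: mult.assoc[symmetric])
  qed
  obtain K where K: "K \<ge> 0" "\<And>z. \<bar>z\<bar> \<le> q \<Longrightarrow>
      (\<integral>\<^sup>+y\<in>{0<..}. ennreal (\<bar>central_diff m \<beta> z y\<bar> * y powr (-1 - 2 * s)) \<partial>lborel) \<le> ennreal K"
    by (rule central_diff_mellin_bound[OF assms(3) q assms(2,4)], rule that)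
  \<comment> \<open>the substitution \<open>r \<mapsto> R r\<close> on the ray through \<open>\<theta>\<close>\<close>
  have key: "R \<theta> * (h ((R \<theta> * r) *\<^sub>R \<theta>) * (R \<theta> * r) powr (-1 - 2 * s))
      = R \<theta> powr (2 * \<beta> - 2 * s) * (central_diff m \<beta> (z \<theta>) r * r powr (-1 - 2 * s))"
    if "\<theta> \<in> S" "r > 0" for \<theta> r
  proof -
    have "h ((R \<theta> * r) *\<^sub>R \<theta>) = R \<theta> powr (2 * \<beta>) * central_diff m \<beta> (z \<theta>) r"
      using radial[OF that(1), of "R \<theta> * r"] R(1)[of \<theta>] by simp
    hence "R \<theta> * (h ((R \<theta> * r) *\<^sub>R \<theta>) * (R \<theta> * r) powr (-1 - 2 * s))
        = (R \<theta> powr (2 * \<beta>) * (R \<theta> * (R \<theta> * r) powr (-1 - 2 * s))) * central_diff m \<beta> (z \<theta>) r"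
      by (simp only: mult_ac)
    also have "\<dots> = R \<theta> powr (2 * \<beta> - 2 * s) * (central_diff m \<beta> (z \<theta>) r * r powr (-1 - 2 * s))"
      unfolding scale[OF R(1) that(2)] by (simp only: mult_ac)
    finally show ?thesis .
  qed
  have bound: "(\<integral>\<^sup>+r\<in>{0<..}. ennreal (\<bar>h (r *\<^sub>R \<theta>)\<bar> * r powr (-1 - 2 * s)) \<partial>lborel) \<le> ennreal (M * K)"
    if "norm_a a \<theta> = 1" for \<theta>
  proof -
    have \<theta>: "\<theta> \<in> S" using that by (simp add: S)
    define c where "c = R \<theta>"
    have c: "c > 0" by (simp add: c_def R)
    have "(\<integral>\<^sup>+r\<in>{0<..}. ennreal (\<bar>h (r *\<^sub>R \<theta>)\<bar> * r powr (-1 - 2 * s)) \<partial>lborel)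
       = (\<integral>\<^sup>+r\<in>{0<..}. ennreal c * ennreal (\<bar>h ((c * r) *\<^sub>R \<theta>)\<bar> * (c * r) powr (-1 - 2 * s)) \<partial>lborel)"
      using c by (intro nn_integral_scale_positive) auto
    also have "\<dots> = (\<integral>\<^sup>+r. ennreal (c powr (2 * \<beta> - 2 * s)) * (ennreal (\<bar>central_diff m \<beta> (z \<theta>) r\<bar> * r powr (-1 - 2 * s)) * indicator {0<..} r) \<partial>lborel)"
    proof (rule nn_integral_cong)
      fix r :: real
      have "c * (\<bar>h ((c * r) *\<^sub>R \<theta>)\<bar> * (c * r) powr (-1 - 2 * s))
          = c powr (2 * \<beta> - 2 * s) * (\<bar>central_diff m \<beta> (z \<theta>) r\<bar> * r powr (-1 - 2 * s))" if "r > 0"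
        using arg_cong[OF key[OF \<theta> that], of abs] c by (simp add: c_def abs_mult)
      thus "ennreal c * ennreal (\<bar>h ((c * r) *\<^sub>R \<theta>)\<bar> * (c * r) powr (-1 - 2 * s)) * indicator {0<..} r
        = ennreal (c powr (2 * \<beta> - 2 * s)) * (ennreal (\<bar>central_diff m \<beta> (z \<theta>) r\<bar> * r powr (-1 - 2 * s)) * indicator {0<..} r)"
        using c by (cases "r > 0") (simp_all add: ennreal_mult[symmetric])
    qed
    also have "\<dots> = ennreal (c powr (2 * \<beta> - 2 * s)) * (\<integral>\<^sup>+r\<in>{0<..}. ennreal (\<bar>central_diff m \<beta> (z \<theta>) r\<bar> * r powr (-1 - 2 * s)) \<partial>lborel)"
      by (intro nn_integral_cmult) measurable
    also have "\<dots> \<le> ennreal M * ennreal K"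
      unfolding c_def powr_R by (intro mult_mono K(2) zq \<theta> ennreal_leI M) auto
    also have "\<dots> = ennreal (M * K)" using K(1) by (intro ennreal_mult[symmetric]) (auto simp: M_def)
    finally show ?thesis .
  qed
  note polar = integral_mu_polar[OF a assms(2) h_meas bound]
  define T where "T = 2 powr (2 * s) * Gamma (1 / 2 + s) / (Gamma (1 / 2) * frac_const 1 m s) * (Gamma (1 + \<beta>) * rGamma (1 + \<beta> - s))"
  have inner: "(LINT r:{0<..}|lborel. h (r *\<^sub>R \<theta>) * r powr (-1 - 2 * s)) = T * F \<theta>" if \<theta>: "\<theta> \<in> S" for \<theta>
  proof -
    define c where "c = R \<theta>"
    have c: "c > 0" by (simp add: c_def R)
    have "(LINT r:{0<..}|lborel. h (r *\<^sub>R \<theta>) * r powr (-1 - 2 * s))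
       = (LINT r:{0<..}|lborel. c * (h ((c * r) *\<^sub>R \<theta>) * (c * r) powr (-1 - 2 * s)))"
      by (rule set_integral_scale_positive[OF c])
    also have "\<dots> = (LINT r:{0<..}|lborel. c powr (2 * \<beta> - 2 * s) * (central_diff m \<beta> (z \<theta>) r * r powr (-1 - 2 * s)))"
      using key[OF \<theta>] unfolding c_def by (intro set_lebesgue_integral_cong) auto
    also have "\<dots> = c powr (2 * \<beta> - 2 * s) * (LINT r:{0<..}|lborel. central_diff m \<beta> (z \<theta>) r * r powr (-1 - 2 * s))"
      by (rule set_integral_mult_right)
    also have "(LINT r:{0<..}|lborel. central_diff m \<beta> (z \<theta>) r * r powr (-1 - 2 * s))
       = T * hyp2F1 (s + 1 / 2) (s - \<beta>) (1 / 2) ((z \<theta>)\<^sup>2)"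
    proof -
      have "\<bar>z \<theta>\<bar> < 1" using zq[OF \<theta>] q(2) by simp
      from central_diff_mellin_value[OF assms(3,2,4) this] show ?thesis by (simp add: T_def mult.assoc)
    qed
    also have "c powr (2 * \<beta> - 2 * s) * (T * hyp2F1 (s + 1 / 2) (s - \<beta>) (1 / 2) ((z \<theta>)\<^sup>2)) = T * F \<theta>"
      unfolding c_def powr_R z2 F_def by (simp add: mult_ac)
    finally show ?thesis .
  qed
  have F_meas [measurable]: "F \<in> borel_measurable borel" unfolding F_def by measurable
  define B where "B = (\<Sum>k. norm (pochhammer (s + 1/2) k * pochhammer (- \<beta> + s) k / (pochhammer (1/2) k * fact k) * (q\<^sup>2) ^ k))"
  have F_bound: "\<bar>F \<theta>\<bar> \<le> M * B" if "\<theta> \<in> S" for \<theta>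
  proof -
    have "\<bar>hyp2F1 (s + 1/2) (- \<beta> + s) (1/2) ((p \<theta>)\<^sup>2 / (u + (p \<theta>)\<^sup>2))\<bar> \<le> B"
      unfolding B_def z2[symmetric] using q2 z2q[OF that] by (intro hyp2F1_bounded) auto
    thus ?thesis unfolding F_def abs_mult abs_of_nonneg[OF powr_ge_zero] using M[OF that]
      by (intro mult_mono) (auto simp: M_def)
  qed
  have F_int: "set_integrable (mu_measure a s) S F"
    unfolding set_integrable_def
  proof (rule integrable_const_bound[of _ "M * B"])
    show "AE \<theta> in mu_measure a s. norm (indicator S \<theta> *\<^sub>R F \<theta>) \<le> M * B"
      using AE_mu_measure[OF a, of s] by eventually_elim (use F_bound in \<open>simp add: S\<close>)
  qed measurable
  have "(\<integral>y. h y / norm y powr (real CARD('n) + 2 * s) \<partial>lborel)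
      = (\<integral>\<theta>. (LINT r:{0<..}|lborel. h (r *\<^sub>R \<theta>) * r powr (-1 - 2 * s)) \<partial>mu_measure a s)"
    by (rule polar(2))
  also have "\<dots> = (\<integral>\<theta>. T * (indicator S \<theta> *\<^sub>R F \<theta>) \<partial>mu_measure a s)"
  proof (rule integral_cong_AE)
    show "AE \<theta> in mu_measure a s. (LINT r:{0<..}|lborel. h (r *\<^sub>R \<theta>) * r powr (-1 - 2 * s)) = T * (indicator S \<theta> *\<^sub>R F \<theta>)"
      using AE_mu_measure[OF a, of s] by eventually_elim (use inner in \<open>simp add: S\<close>)
    show "(\<lambda>\<theta>. LINT r:{0<..}|lborel. h (r *\<^sub>R \<theta>) * r powr (-1 - 2 * s)) \<in> borel_measurable (mu_measure a s)"
      unfolding set_lebesgue_integral_def by measurable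
  qed measurable
  also have "\<dots> = T * (LINT \<theta>:S|mu_measure a s. F \<theta>)"
    unfolding set_lebesgue_integral_def by simp
  finally have polar_value: "(\<integral>y. frac_laplacian_integrand m s (u_pow a \<beta>) x y \<partial>lborel) = T * (LINT \<theta>:S|mu_measure a s. F \<theta>)"
    by (simp add: frac_laplacian_integrand_def h_def)
  have "integrable lborel (frac_laplacian_integrand m s (u_pow a \<beta>) x)"
    using polar(1) by (simp add: frac_laplacian_integrand_def[abs_def] h_def)
  moreover have "frac_laplacian m s (u_pow a \<beta>) x =
      2 powr (2 * s - 1) * Gamma (1/2 + s) * Gamma (1 + \<beta>) * frac_const CARD('n) m s *
        rGamma (1 + \<beta> - s) / (Gamma (1/2) * frac_const 1 m s) * (LINT \<theta>:S|mu_measure a s. F \<theta>)"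
  proof -
    have "(2::real) powr (2 * s - 1) = 2 powr (2 * s) / 2" by (simp add: powr_diff)
    thus ?thesis unfolding frac_laplacian_def polar_value T_def
      by (simp only: divide_inverse inverse_mult_distrib mult_ac)
  qed
  ultimately show ?thesis
    using F_int unfolding Let_def F_def S_def p_def u_def by blast
qed

end
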